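(* Let $\mathcal{N}\subset\mathbb{R}$ be a neighborhood of $0$ and let $\gamma\in(1/2,1]$. Let $f:\mathbb{R}\to\mathbb{R}$ be Lipschitz with $f(0)=0$ and $f(x)>0$ for all $x\in\mathcal{N}\setminus\{0\}$. Let $(L_t)_{t\ge 1}$ be a solution of $$\mathrm{d}L_t=\frac{f(L_t)}{t^{\gamma}}\,\mathrm{d}t+\frac{1}{t^{\gamma}}\,\mathrm{d}B_t .$$ Suppose that at least one of the following holds: (1) $\gamma=1$ and there is a constant $k>\frac12$ such that $k|x|\le f(x)$ for all $x\in\mathcal{N}$; (2) there is a constant $k>1$ with $\frac12+\frac1{2k}\ge\gamma$ such that $|x|^k\le f(x)$ for all $x\in\mathcal{N}$. Then $\mathbb{P}(L_t\to 0 \text{ as } t\to\infty)=0$.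
   Context: $(B_t)$ is a standard one-dimensional Brownian motion. *)

theory Defs
  imports "HOL-Probability.Probability"
begin

text \<open>
  Standard one-dimensional Brownian motion relative to a filtration. The filtration is indexed by
  all of \<open>real\<close> because of the library locale; only the times \<open>t \<ge> 0\<close> play a role. No completeness
  of \<open>M\<close> or \<open>F\<close> is required, hence \<open>AE\<close> for the initial value and for path continuity.
\<close>

definition brownian_motion :: "'a measure \<Rightarrow> (real \<Rightarrow> 'a measure) \<Rightarrow> (real \<Rightarrow> 'a \<Rightarrow> real) \<Rightarrow> bool" where
  "brownian_motion M F B \<longleftrightarrow>
     prob_space M \<and> filtration (space M) F \<and> (\<forall>t. sets (F t) \<subseteq> sets M) \<and>
     (\<forall>t\<ge>0. B t \<in> borel_measurable (F t)) \<and>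
     (AE \<omega> in M. B 0 \<omega> = 0) \<and>
     (AE \<omega> in M. continuous_on {0..} (\<lambda>t. B t \<omega>)) \<and>
     (\<forall>s t. 0 \<le> s \<longrightarrow> s < t \<longrightarrow>
        distributed M lborel (\<lambda>\<omega>. B t \<omega> - B s \<omega>) (normal_density 0 (sqrt (t - s))) \<and>
        prob_space.indep_set M (sets (F s))
          (sets (vimage_algebra (space M) (\<lambda>\<omega>. B t \<omega> - B s \<omega>) borel)))"

text \<open>
  The data \<open>n, \<tau>, \<xi>\<close> encode the elementary process that equals \<open>\<xi> i\<close> on the time interval
  \<open>(\<tau> i, \<tau> (i + 1)]\<close> for \<open>i < n\<close> and \<open>0\<close> elsewhere, each \<open>\<xi> i\<close> being bounded and known at time \<open>\<tau> i\<close>.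
\<close>

definition elementary_on ::
  "'a measure \<Rightarrow> (real \<Rightarrow> 'a measure) \<Rightarrow> real \<Rightarrow> real \<Rightarrow> nat \<Rightarrow> (nat \<Rightarrow> real) \<Rightarrow> (nat \<Rightarrow> 'a \<Rightarrow> real) \<Rightarrow> bool"
where
  "elementary_on M F a b n \<tau> \<xi> \<longleftrightarrow>
     a \<le> \<tau> 0 \<and> \<tau> n \<le> b \<and> (\<forall>i<n. \<tau> i \<le> \<tau> (Suc i)) \<and>
     (\<forall>i<n. \<xi> i \<in> borel_measurable (F (\<tau> i)) \<and> bounded (\<xi> i ` space M))"

definition elementary_process ::
  "nat \<Rightarrow> (nat \<Rightarrow> real) \<Rightarrow> (nat \<Rightarrow> 'a \<Rightarrow> real) \<Rightarrow> real \<Rightarrow> 'a \<Rightarrow> real"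
where
  "elementary_process n \<tau> \<xi> s \<omega> = (\<Sum>i<n. \<xi> i \<omega> * indicator {\<tau> i<..\<tau> (Suc i)} s)"

definition elementary_integral ::
  "(real \<Rightarrow> 'a \<Rightarrow> real) \<Rightarrow> nat \<Rightarrow> (nat \<Rightarrow> real) \<Rightarrow> (nat \<Rightarrow> 'a \<Rightarrow> real) \<Rightarrow> 'a \<Rightarrow> real"
where
  "elementary_integral B n \<tau> \<xi> \<omega> = (\<Sum>i<n. \<xi> i \<omega> * (B (\<tau> (Suc i)) \<omega> - B (\<tau> i) \<omega>))"

text \<open>
  \<open>I\<close> is a version of the Ito integral of \<open>H\<close> with respect to \<open>B\<close> over \<open>[a, b]\<close>: the integrals of
  elementary processes converge to \<open>I\<close> in \<open>L\<^sup>2(M)\<close> while these processes converge to \<open>H\<close> in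
  \<open>L\<^sup>2(M \<times> [a, b])\<close>. This is the square-integrable theory, without localization. The nonnegative
  integrals take values in \<open>[0, \<infinity>]\<close>, so convergence to \<open>0\<close> entails square-integrability.
\<close>

definition is_ito_integral ::
  "'a measure \<Rightarrow> (real \<Rightarrow> 'a measure) \<Rightarrow> (real \<Rightarrow> 'a \<Rightarrow> real) \<Rightarrow> (real \<Rightarrow> 'a \<Rightarrow> real) \<Rightarrow>
   real \<Rightarrow> real \<Rightarrow> ('a \<Rightarrow> real) \<Rightarrow> bool"
where
  "is_ito_integral M F B H a b I \<longleftrightarrow>
     (\<lambda>(s, \<omega>). H s \<omega>) \<in> borel_measurable (restrict_space borel {a..b} \<Otimes>\<^sub>M M) \<and>
     (\<forall>s\<in>{a..b}. H s \<in> borel_measurable (F s)) \<and>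
     I \<in> borel_measurable M \<and>
     (\<exists>n \<tau> \<xi>.
        (\<forall>m. elementary_on M F a b (n m) (\<tau> m) (\<xi> m)) \<and>
        (\<lambda>m. \<integral>\<^sup>+ \<omega>. (\<integral>\<^sup>+ s\<in>{a..b}.
             ennreal ((H s \<omega> - elementary_process (n m) (\<tau> m) (\<xi> m) s \<omega>)\<^sup>2) \<partial>lborel) \<partial>M)
          \<longlonglongrightarrow> 0 \<and>
        (\<lambda>m. \<integral>\<^sup>+ \<omega>. ennreal ((I \<omega> - elementary_integral B (n m) (\<tau> m) (\<xi> m) \<omega>)\<^sup>2) \<partial>M)
          \<longlonglongrightarrow> 0)"

text \<open>
  \<open>(X t)\<close>, \<open>t \<ge> t0\<close>, solves \<open>dX = b(t, X) dt + \<sigma>(t) dB\<close> on the given filtered probability space,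
  with arbitrary initial value \<open>X t0\<close> measurable at time \<open>t0\<close>. The diffusion coefficient is
  deterministic, so the square-integrable Ito integral is the right one whenever \<open>\<sigma>\<close> is locally
  square-integrable.
\<close>

definition additive_sde_solution ::
  "'a measure \<Rightarrow> (real \<Rightarrow> 'a measure) \<Rightarrow> (real \<Rightarrow> 'a \<Rightarrow> real) \<Rightarrow>
   (real \<Rightarrow> real \<Rightarrow> real) \<Rightarrow> (real \<Rightarrow> real) \<Rightarrow> real \<Rightarrow> (real \<Rightarrow> 'a \<Rightarrow> real) \<Rightarrow> bool"
where
  "additive_sde_solution M F B b \<sigma> t0 X \<longleftrightarrow>
     (\<forall>t\<ge>t0. X t \<in> borel_measurable (F t)) \<and>
     (AE \<omega> in M. continuous_on {t0..} (\<lambda>t. X t \<omega>)) \<and>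
     (AE \<omega> in M. \<forall>t\<ge>t0. set_integrable lborel {t0..t} (\<lambda>s. b s (X s \<omega>))) \<and>
     (\<forall>t\<ge>t0. \<exists>I. is_ito_integral M F B (\<lambda>s _. \<sigma> s) t0 t I \<and>
        (AE \<omega> in M. X t \<omega> = X t0 \<omega> + (LINT s:{t0..t}|lborel. b s (X s \<omega>)) + I \<omega>))"

end

theory Submission
  imports Defs "HOL-Real_Asymp.Real_Asymp"
begin

text \<open>
  Put \<open>\<beta> = \<gamma> - 1/2\<close>. The noise \<open>\<integral> s powr -\<gamma> dB\<close> that is still to come after time \<open>t\<close> is Gaussian with a
  standard deviation proportional to \<open>\<sigma>(t) = t powr -\<beta>\<close>, and \<open>\<sigma>(t)\<close> is the scale on which
  everything is measured. Fix \<open>\<eta>\<close> with \<open>[-\<eta>, \<eta>] \<subseteq> N\<close> and a time \<open>n\<close>, and let \<open>A\<close> be the event that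
  \<open>L\<close> stays in \<open>[-\<eta>, \<eta>]\<close> from time \<open>n\<close> on and has a nonpositive upper limit along integer times. Convergence to \<open>0\<close>
  implies such an event for some \<open>n\<close>, so it suffices that \<open>A\<close> is null. Two effects compete.

  \<^item> Near or above the origin the future noise pushes \<open>L\<close> away. On \<open>A\<close> the drift is nonnegative,
    hence \<open>L\<close> increases by at least as much as the noise does. If \<open>L t \<ge> -K \<sigma>(t)\<close>, then the
    noise after \<open>t\<close>, which is independent of the past, exceeds \<open>(K + 1) \<sigma>(t)\<close> with a probability at
    least \<open>\<delta>(K) > 0\<close> that does not depend on \<open>t\<close>, and then \<open>L\<close> ends up above \<open>\<sigma>(t)\<close>, which contradicts
    the nonpositive upper limit (\<open>confined_escape\<close>).

  \<^item> Far below the origin the drift pulls \<open>L\<close> up. Either growth hypothesis on \<open>f\<close> gives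
    \<open>f x / s powr \<gamma> \<ge> \<kappa> (-x - \<sigma>(s)) / s\<close> for some \<open>\<kappa> > \<beta>\<close>; the exponent \<open>1/2 + 1/(2k)\<close> is
    the largest \<open>\<gamma>\<close> for which \<open>\<bar>x\<bar> powr k / s powr \<gamma>\<close> dominates \<open>\<bar>x\<bar> / s\<close> as soon as \<open>\<bar>x\<bar> \<ge> \<sigma>(s)\<close>
    (\<open>superlinear_drift\<close>). Multiplying by the integrating factor \<open>t powr \<kappa>\<close> yields, along the paths in \<open>A\<close>,
    \<open>L t \<ge> -(C + V t) \<sigma>(t)\<close> with nonnegative variables \<open>V t\<close> of uniformly bounded expectation
    (\<open>perturbed_ode_lower_bound\<close>, \<open>fluctuation_expectation\<close>). The condition \<open>\<kappa> > \<beta>\<close> makes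
    the integrated noise at most of the order of \<open>\<sigma>\<close>. By Markov's inequality, for large
    \<open>K\<close> and every \<open>t \<ge> n\<close> the part of \<open>A\<close> on which \<open>L t < -K \<sigma>(t)\<close> has probability at most \<open>P(A) / 4\<close>
    (\<open>confined_not_far_below\<close>).

  The two effects are combined as in the zero-one law of Levy: \<open>A\<close> is approximated by an event \<open>E\<close> that
  is known at some time \<open>t\<close>. Up to the error of approximation and a quarter of its mass, \<open>A\<close> lies in the part of \<open>E\<close> where
  \<open>L t \<ge> -K \<sigma>(t)\<close>, but it misses at least the fraction \<open>\<delta>(K)\<close> of that part, which a good
  approximation does not permit unless \<open>P(A) = 0\<close> (\<open>confined_null\<close>).

  The stochastic input is that the Ito integral of a deterministic function has Gaussian increments that
  are independent of the past. The definition supplies some approximation by random elementary processes;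
  the isometry, applied to the difference of such a process and a deterministic step function, shows that
  Riemann sums converge to the same limit (\<open>ito_isometry\<close>, \<open>ito_integral_step_approx\<close>), and Riemann
  sums are Gaussian (\<open>step_integral_gaussian\<close>).
\<close>

section \<open>Brownian increments and the past\<close>

locale brownian_filtration =
  fixes M :: "'a measure" and F :: "real \<Rightarrow> 'a measure" and B :: "real \<Rightarrow> 'a \<Rightarrow> real"
  assumes brownian: "brownian_motion M F B"

sublocale brownian_filtration \<subseteq> prob_space M
  using brownian by (simp add: brownian_motion_def)

context brownian_filtration
begin

lemma space_F: "space (F t) = space M"
  using brownian by (auto simp: brownian_motion_def filtration_def)

lemma sets_F_mono: "s \<le> t \<Longrightarrow> sets (F s) \<subseteq> sets (F t)"
  using brownian by (auto simp: brownian_motion_def filtration_def)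

lemma sets_F: "sets (F t) \<subseteq> sets M"
  using brownian by (auto simp: brownian_motion_def)

lemma measurable_F_mono:
  assumes "Z \<in> F s \<rightarrow>\<^sub>M N" "s \<le> t" shows "Z \<in> F t \<rightarrow>\<^sub>M N"
  using assms measurable_mono[of N N "F s" "F t"] sets_F_mono[of s t] by (auto simp: space_F)

lemma measurable_F_M:
  assumes "Z \<in> F s \<rightarrow>\<^sub>M N" shows "Z \<in> M \<rightarrow>\<^sub>M N"
  using assms measurable_mono[of N N "F s" M] sets_F[of s] by (auto simp: space_F)

lemma B_F: "0 \<le> t \<Longrightarrow> B t \<in> borel_measurable (F t)"
  using brownian by (auto simp: brownian_motion_def)

lemma B_F': "0 \<le> s \<Longrightarrow> s \<le> t \<Longrightarrow> B s \<in> borel_measurable (F t)"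
  using B_F measurable_F_mono by blast

lemma B_measurable: "0 \<le> t \<Longrightarrow> B t \<in> borel_measurable M"
  using B_F measurable_F_M by blast

lemma increment_distributed:
  "0 \<le> s \<Longrightarrow> s < t \<Longrightarrow>
    distributed M lborel (\<lambda>\<omega>. B t \<omega> - B s \<omega>) (normal_density 0 (sqrt (t - s)))"
  using brownian by (auto simp: brownian_motion_def)

text \<open>
  The increment enters through an arbitrary measurable image \<open>h\<close>: its square is needed for second moments,
  and its embedding into a product type for joint laws.
\<close>

lemma increment_indep:
  assumes st: "0 \<le> s" "s < t" and Z: "Z \<in> F s \<rightarrow>\<^sub>M N" and h: "h \<in> borel \<rightarrow>\<^sub>M N'"
  shows "indep_var N Z N' (\<lambda>\<omega>. h (B t \<omega> - B s \<omega>))"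
proof -
  let ?D = "\<lambda>\<omega>. B t \<omega> - B s \<omega>"
  let ?V = "vimage_algebra (space M) ?D borel"
  have ind: "indep_set (sets (F s)) (sets (vimage_algebra (space M) ?D borel))"
    using brownian st by (auto simp: brownian_motion_def)
  have "sigma_sets (space M) {Z -` A \<inter> space M | A. A \<in> sets N} \<subseteq> sets (F s)"
    unfolding space_F[of s, symmetric]
    using Z by (intro sets.sigma_sets_subset) (auto intro: measurable_sets)
  moreover have "sigma_sets (space M) {(\<lambda>\<omega>. h (?D \<omega>)) -` A \<inter> space M | A. A \<in> sets N'} \<subseteq> sets ?V"
  proof -
    have "(\<lambda>\<omega>. h (?D \<omega>)) \<in> ?V \<rightarrow>\<^sub>M N'"
      by (rule measurable_compose[OF measurable_vimage_algebra1 h]) simp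
    then have "sigma_sets (space ?V) {(\<lambda>\<omega>. h (?D \<omega>)) -` A \<inter> space ?V | A. A \<in> sets N'} \<subseteq> sets ?V"
      by (intro sets.sigma_sets_subset) (blast intro: measurable_sets)
    then show ?thesis by simp
  qed
  ultimately have "indep_set (sigma_sets (space M) {Z -` A \<inter> space M | A. A \<in> sets N})
      (sigma_sets (space M) {(\<lambda>\<omega>. h (?D \<omega>)) -` A \<inter> space M | A. A \<in> sets N'})"
    using ind unfolding indep_set_def
    by (elim indep_sets_mono_sets) (auto split: bool.split)
  moreover have "random_variable borel ?D" using st B_measurable by simp
  ultimately show ?thesis
    unfolding indep_var_eq using Z h measurable_F_M measurable_compose by blast
qed

lemma increment_moments:
  assumes st: "0 \<le> s" "s \<le> t"
  shows "integrable M (\<lambda>\<omega>. B t \<omega> - B s \<omega>)"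
    and "expectation (\<lambda>\<omega>. B t \<omega> - B s \<omega>) = 0"
    and "integrable M (\<lambda>\<omega>. (B t \<omega> - B s \<omega>)\<^sup>2)"
    and "expectation (\<lambda>\<omega>. (B t \<omega> - B s \<omega>)\<^sup>2) = t - s"
proof -
  let ?D = "\<lambda>\<omega>. B t \<omega> - B s \<omega>"
  have *: "integrable M ?D \<and> expectation ?D = 0 \<and> integrable M (\<lambda>\<omega>. (?D \<omega>)\<^sup>2) \<and>
      expectation (\<lambda>\<omega>. (?D \<omega>)\<^sup>2) = t - s"
  proof (cases "s = t")
    case True then show ?thesis by simp
  next
    case False
    with st have lt: "s < t" by simp
    note D = increment_distributed[OF st(1) lt]
    have pos: "0 < sqrt (t - s)" using lt by simp
    have 1: "integrable M ?D"
      using distributed_integrable_var[OF D] integrable_normal_moment_nz_1[OF pos, of 0] by simp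
    have 2: "expectation ?D = 0"
      using normal_distributed_expectation[OF pos D] by simp
    have 3: "integrable M (\<lambda>\<omega>. (?D \<omega>)\<^sup>2)"
      using distributed_integrable[OF D, of "\<lambda>x. x\<^sup>2"] integrable_normal_moment[OF pos, of 0 2] by simp
    have 4: "expectation (\<lambda>\<omega>. (?D \<omega>)\<^sup>2) = t - s"
      using normal_distributed_variance[OF pos D] lt 2 by simp
    show ?thesis using 1 2 3 4 by simp
  qed
  then show "integrable M ?D" "expectation ?D = 0" "integrable M (\<lambda>\<omega>. (?D \<omega>)\<^sup>2)"
    "expectation (\<lambda>\<omega>. (?D \<omega>)\<^sup>2) = t - s" by auto
qed

lemma past_increment_moments:
  fixes Z :: "'a \<Rightarrow> real"
  assumes st: "0 \<le> s" "s \<le> t" and Z: "Z \<in> borel_measurable (F s)" "integrable M Z"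
  shows "integrable M (\<lambda>\<omega>. Z \<omega> * (B t \<omega> - B s \<omega>))"
    and "expectation (\<lambda>\<omega>. Z \<omega> * (B t \<omega> - B s \<omega>)) = 0"
    and "integrable M (\<lambda>\<omega>. Z \<omega> * (B t \<omega> - B s \<omega>)\<^sup>2)"
    and "expectation (\<lambda>\<omega>. Z \<omega> * (B t \<omega> - B s \<omega>)\<^sup>2) = expectation Z * (t - s)"
proof -
  let ?D = "\<lambda>\<omega>. B t \<omega> - B s \<omega>"
  have *: "integrable M (\<lambda>\<omega>. Z \<omega> * ?D \<omega>) \<and> expectation (\<lambda>\<omega>. Z \<omega> * ?D \<omega>) = 0 \<and>
    integrable M (\<lambda>\<omega>. Z \<omega> * (?D \<omega>)\<^sup>2) \<and> expectation (\<lambda>\<omega>. Z \<omega> * (?D \<omega>)\<^sup>2) = expectation Z * (t - s)"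
  proof (cases "s = t")
    case True then show ?thesis by simp
  next
    case False
    with st have lt: "s < t" by simp
    have ind: "indep_var borel Z borel ?D" "indep_var borel Z borel (\<lambda>\<omega>. (?D \<omega>)\<^sup>2)"
      using increment_indep[OF st(1) lt Z(1), of "\<lambda>x. x" borel]
        increment_indep[OF st(1) lt Z(1), of "\<lambda>x. x\<^sup>2" borel] by simp_all
    show ?thesis
      using indep_var_integrable[OF ind(1) Z(2) increment_moments(1)[OF st]]
        indep_var_lebesgue_integral[OF ind(1) Z(2) increment_moments(1)[OF st]]
        indep_var_integrable[OF ind(2) Z(2) increment_moments(3)[OF st]]
        indep_var_lebesgue_integral[OF ind(2) Z(2) increment_moments(3)[OF st]]
        increment_moments(2,4)[OF st] by simp
  qed
  then show "integrable M (\<lambda>\<omega>. Z \<omega> * (B t \<omega> - B s \<omega>))"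
    "expectation (\<lambda>\<omega>. Z \<omega> * (B t \<omega> - B s \<omega>)) = 0"
    "integrable M (\<lambda>\<omega>. Z \<omega> * (B t \<omega> - B s \<omega>)\<^sup>2)"
    "expectation (\<lambda>\<omega>. Z \<omega> * (B t \<omega> - B s \<omega>)\<^sup>2) = expectation Z * (t - s)" by auto
qed

lemma integrable_bounded_increment:
  fixes Z :: "'a \<Rightarrow> real"
  assumes ab: "0 \<le> a" "a \<le> b"
    and Z: "Z \<in> borel_measurable M" "\<And>\<omega>. \<omega> \<in> space M \<Longrightarrow> \<bar>Z \<omega>\<bar> \<le> C"
  shows "integrable M (\<lambda>\<omega>. Z \<omega> * (B b \<omega> - B a \<omega>))"
proof (rule Bochner_Integration.integrable_bound)
  show "integrable M (\<lambda>\<omega>. C * (B b \<omega> - B a \<omega>))"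
    using increment_moments(1)[OF ab] by simp
  show "(\<lambda>\<omega>. Z \<omega> * (B b \<omega> - B a \<omega>)) \<in> borel_measurable M"
    using Z(1) B_measurable[of a] B_measurable[of b] ab by simp
  show "AE \<omega> in M. norm (Z \<omega> * (B b \<omega> - B a \<omega>)) \<le> norm (C * (B b \<omega> - B a \<omega>))"
  proof (rule AE_I2)
    fix \<omega> assume "\<omega> \<in> space M"
    then have "\<bar>Z \<omega>\<bar> \<le> \<bar>C\<bar>" using Z(2) abs_ge_self order_trans by blast
    then show "norm (Z \<omega> * (B b \<omega> - B a \<omega>)) \<le> norm (C * (B b \<omega> - B a \<omega>))"
      by (simp add: abs_mult mult_right_mono)
  qed
qed

lemma integrable_bounded_increment_product:
  fixes Z :: "'a \<Rightarrow> real"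
  assumes "0 \<le> a" "a \<le> b" "0 \<le> c" "c \<le> d"
    and Z: "Z \<in> borel_measurable M" "\<And>\<omega>. \<omega> \<in> space M \<Longrightarrow> \<bar>Z \<omega>\<bar> \<le> C"
  shows "integrable M (\<lambda>\<omega>. Z \<omega> * (B b \<omega> - B a \<omega>) * (B d \<omega> - B c \<omega>))"
proof (rule Bochner_Integration.integrable_bound)
  have m[measurable]: "B a \<in> borel_measurable M" "B b \<in> borel_measurable M"
     "B c \<in> borel_measurable M" "B d \<in> borel_measurable M" "Z \<in> borel_measurable M"
    using assms B_measurable by auto
  show "integrable M (\<lambda>\<omega>. C * ((B b \<omega> - B a \<omega>)\<^sup>2 + (B d \<omega> - B c \<omega>)\<^sup>2))"
    using increment_moments assms by auto
  show "(\<lambda>\<omega>. Z \<omega> * (B b \<omega> - B a \<omega>) * (B d \<omega> - B c \<omega>)) \<in> borel_measurable M" by measurable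
  show "AE \<omega> in M. norm (Z \<omega> * (B b \<omega> - B a \<omega>) * (B d \<omega> - B c \<omega>))
          \<le> norm (C * ((B b \<omega> - B a \<omega>)\<^sup>2 + (B d \<omega> - B c \<omega>)\<^sup>2))"
  proof (rule AE_I2)
    fix \<omega> assume w: "\<omega> \<in> space M"
    define x where "x = B b \<omega> - B a \<omega>"
    define y where "y = B d \<omega> - B c \<omega>"
    have C: "\<bar>Z \<omega>\<bar> \<le> C" using Z w by auto
    then have C0: "0 \<le> C" by linarith
    have "2 * \<bar>x\<bar> * \<bar>y\<bar> \<le> x\<^sup>2 + y\<^sup>2"
      using sum_squares_bound[of "\<bar>x\<bar>" "\<bar>y\<bar>"] by simp
    moreover have "0 \<le> \<bar>x\<bar> * \<bar>y\<bar>" by simp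
    ultimately have "\<bar>x\<bar> * \<bar>y\<bar> \<le> x\<^sup>2 + y\<^sup>2" by linarith
    then have "\<bar>Z \<omega>\<bar> * (\<bar>x\<bar> * \<bar>y\<bar>) \<le> C * (x\<^sup>2 + y\<^sup>2)" using C C0 by (intro mult_mono) auto
    then show "norm (Z \<omega> * (B b \<omega> - B a \<omega>) * (B d \<omega> - B c \<omega>))
          \<le> norm (C * ((B b \<omega> - B a \<omega>)\<^sup>2 + (B d \<omega> - B c \<omega>)\<^sup>2))"
      using C0 by (simp add: x_def y_def abs_mult mult.assoc)
  qed
qed

lemma integrable_bounded:
  fixes Z :: "'a \<Rightarrow> real"
  assumes "Z \<in> borel_measurable M" "\<And>\<omega>. \<omega> \<in> space M \<Longrightarrow> \<bar>Z \<omega>\<bar> \<le> C"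
  shows "integrable M Z"
  using assms by (intro integrable_const_bound[where B=C]) auto

text \<open>
  The longer of the two increments is the shorter one plus a later increment; the later one is centred
  given the past, so only the square of the shorter one contributes.
\<close>

lemma increment_covariance_same_start:
  fixes Z :: "'a \<Rightarrow> real"
  assumes c: "0 \<le> c" "c \<le> b" "c \<le> d"
    and Z: "Z \<in> borel_measurable (F c)" "\<And>\<omega>. \<omega> \<in> space M \<Longrightarrow> \<bar>Z \<omega>\<bar> \<le> C"
  shows "expectation (\<lambda>\<omega>. Z \<omega> * (B b \<omega> - B c \<omega>) * (B d \<omega> - B c \<omega>)) = expectation Z * (min b d - c)"
proof -
  define m where "m = min b d"
  define e where "e = max b d"
  have me: "0 \<le> m" "c \<le> m" "m \<le> e" using c by (auto simp: m_def e_def)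
  have ZM: "Z \<in> borel_measurable M" using Z measurable_F_M by blast
  note intZ = integrable_bounded[OF ZM Z(2)]
  have [measurable]: "Z \<in> borel_measurable (F m)" "B m \<in> borel_measurable (F m)" "B c \<in> borel_measurable (F m)"
    using measurable_F_mono[OF Z(1) me(2)] B_F' c me by auto
  have Zm: "(\<lambda>\<omega>. Z \<omega> * (B m \<omega> - B c \<omega>)) \<in> borel_measurable (F m)" by measurable
  note I1 = past_increment_moments[OF c(1) me(2) Z(1) intZ]
  note I2 = past_increment_moments[OF me(1) me(3) Zm I1(1)]
  have "expectation (\<lambda>\<omega>. Z \<omega> * (B b \<omega> - B c \<omega>) * (B d \<omega> - B c \<omega>)) =
        expectation (\<lambda>\<omega>. Z \<omega> * (B m \<omega> - B c \<omega>)\<^sup>2 + Z \<omega> * (B m \<omega> - B c \<omega>) * (B e \<omega> - B m \<omega>))"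
    by (rule arg_cong[where f=expectation])
       (auto simp: m_def e_def min_def max_def power2_eq_square algebra_simps)
  also have "\<dots> = expectation Z * (m - c)"
    using I1 I2 by simp
  finally show ?thesis by (simp add: m_def)
qed

text \<open>
  An increment over \<open>(a, b]\<close> with \<open>a \<le> c\<close> splits at \<open>c\<close>. What happens before \<open>c\<close> joins the past of \<open>c\<close> and is
  orthogonal to the increment over \<open>(c, d]\<close>; what remains starts at \<open>c\<close> as well.
\<close>

lemma increment_covariance_aux:
  fixes Z :: "'a \<Rightarrow> real"
  assumes a: "0 \<le> a" "a \<le> b" "a \<le> c" "c \<le> d"
    and Z: "Z \<in> borel_measurable (F c)" "\<And>\<omega>. \<omega> \<in> space M \<Longrightarrow> \<bar>Z \<omega>\<bar> \<le> C"
  shows "expectation (\<lambda>\<omega>. Z \<omega> * (B b \<omega> - B a \<omega>) * (B d \<omega> - B c \<omega>))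
     = expectation Z * measure lborel ({a<..b} \<inter> {c<..d})"
proof (cases "b \<le> c")
  case True
  have ZM: "Z \<in> borel_measurable M" using Z measurable_F_M by blast
  have [measurable]: "Z \<in> borel_measurable (F c)" "B a \<in> borel_measurable (F c)" "B b \<in> borel_measurable (F c)"
    using Z B_F' a True by auto
  have Zm: "(\<lambda>\<omega>. Z \<omega> * (B b \<omega> - B a \<omega>)) \<in> borel_measurable (F c)" by measurable
  note int = integrable_bounded_increment[OF a(1,2) ZM Z(2)]
  from past_increment_moments(2)[OF _ a(4) Zm int] a True show ?thesis by simp
next
  case False
  then have cb: "c \<le> b" by simp
  have ZM: "Z \<in> borel_measurable M" using Z measurable_F_M by blast
  have c0: "0 \<le> c" using a by simp
  have "expectation (\<lambda>\<omega>. Z \<omega> * (B c \<omega> - B a \<omega>) * (B d \<omega> - B c \<omega>)) = 0"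
  proof -
    have [measurable]: "Z \<in> borel_measurable (F c)" "B a \<in> borel_measurable (F c)" "B c \<in> borel_measurable (F c)"
      using Z B_F' a c0 by auto
    have Zm: "(\<lambda>\<omega>. Z \<omega> * (B c \<omega> - B a \<omega>)) \<in> borel_measurable (F c)" by measurable
    note int = integrable_bounded_increment[OF a(1,3) ZM Z(2)]
    from past_increment_moments(2)[OF c0 a(4) Zm int] show ?thesis .
  qed
  moreover have "measure lborel ({a<..b} \<inter> {c<..d}) = min b d - c"
    using a cb by (auto simp: Int_greaterThanAtMost max_def)
  moreover have "expectation (\<lambda>\<omega>. Z \<omega> * (B b \<omega> - B a \<omega>) * (B d \<omega> - B c \<omega>)) =
      expectation (\<lambda>\<omega>. Z \<omega> * (B c \<omega> - B a \<omega>) * (B d \<omega> - B c \<omega>) + Z \<omega> * (B b \<omega> - B c \<omega>) * (B d \<omega> - B c \<omega>))"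
    by (rule arg_cong[where f=expectation]) (auto simp: algebra_simps)
  moreover have "\<dots> = expectation (\<lambda>\<omega>. Z \<omega> * (B c \<omega> - B a \<omega>) * (B d \<omega> - B c \<omega>)) +
      expectation (\<lambda>\<omega>. Z \<omega> * (B b \<omega> - B c \<omega>) * (B d \<omega> - B c \<omega>))"
    using a cb c0 ZM Z by (intro Bochner_Integration.integral_add integrable_bounded_increment_product[where C=C]) auto
  ultimately show ?thesis
    using increment_covariance_same_start[OF c0 cb a(4) Z] by simp
qed

text \<open>
  The bilinear form of the Ito isometry. The intervals may overlap in any way, so that linear combinations of
  elementary integrals with different partitions need no common refinement.
\<close>

lemma increment_covariance:
  fixes \<xi> \<eta> :: "'a \<Rightarrow> real"
  assumes ab: "0 \<le> a" "a \<le> b" and cd: "0 \<le> c" "c \<le> d"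
    and \<xi>: "\<xi> \<in> borel_measurable (F a)" "bounded (\<xi> ` space M)"
    and \<eta>: "\<eta> \<in> borel_measurable (F c)" "bounded (\<eta> ` space M)"
  shows "integrable M (\<lambda>\<omega>. \<xi> \<omega> * \<eta> \<omega>)"
    and "integrable M (\<lambda>\<omega>. (\<xi> \<omega> * (B b \<omega> - B a \<omega>)) * (\<eta> \<omega> * (B d \<omega> - B c \<omega>)))"
    and "expectation (\<lambda>\<omega>. (\<xi> \<omega> * (B b \<omega> - B a \<omega>)) * (\<eta> \<omega> * (B d \<omega> - B c \<omega>)))
      = expectation (\<lambda>\<omega>. \<xi> \<omega> * \<eta> \<omega>) * measure lborel ({a<..b} \<inter> {c<..d})"
proof -
  obtain C1 C2 where C: "\<And>\<omega>. \<omega> \<in> space M \<Longrightarrow> \<bar>\<xi> \<omega>\<bar> \<le> C1" "\<And>\<omega>. \<omega> \<in> space M \<Longrightarrow> \<bar>\<eta> \<omega>\<bar> \<le> C2"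
    using \<xi>(2) \<eta>(2) by (auto simp: bounded_iff)
  define Z where "Z \<omega> = \<xi> \<omega> * \<eta> \<omega>" for \<omega>
  have ZC: "\<bar>Z \<omega>\<bar> \<le> C1 * C2" if "\<omega> \<in> space M" for \<omega>
  proof -
    have "0 \<le> C1" using C(1)[OF that] by linarith
    then show ?thesis unfolding Z_def abs_mult by (intro mult_mono C that) auto
  qed
  have Zmax: "Z \<in> borel_measurable (F (max a c))"
    using measurable_F_mono[OF \<xi>(1), of "max a c"] measurable_F_mono[OF \<eta>(1), of "max a c"]
    unfolding Z_def by measurable
  then have ZM: "Z \<in> borel_measurable M" using measurable_F_M by blast
  show "integrable M (\<lambda>\<omega>. \<xi> \<omega> * \<eta> \<omega>)"
    using integrable_bounded[OF ZM ZC] by (simp add: Z_def)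
  show "integrable M (\<lambda>\<omega>. (\<xi> \<omega> * (B b \<omega> - B a \<omega>)) * (\<eta> \<omega> * (B d \<omega> - B c \<omega>)))"
    using integrable_bounded_increment_product[OF ab cd ZM ZC] by (simp add: Z_def ac_simps)
  have "expectation (\<lambda>\<omega>. Z \<omega> * (B b \<omega> - B a \<omega>) * (B d \<omega> - B c \<omega>))
     = expectation Z * measure lborel ({a<..b} \<inter> {c<..d})"
  proof (cases "a \<le> c")
    case True
    then show ?thesis
      using increment_covariance_aux[OF ab True cd(2) _ ZC] Zmax by (simp add: max_def)
  next
    case False
    then have ca: "c \<le> a" by simp
    have "Z \<in> borel_measurable (F a)" using Zmax False by (simp add: max_def)
    from increment_covariance_aux[OF cd ca ab(2) this ZC] show ?thesis
      by (simp add: Int_commute mult.commute mult.left_commute)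
  qed
  then show "expectation (\<lambda>\<omega>. (\<xi> \<omega> * (B b \<omega> - B a \<omega>)) * (\<eta> \<omega> * (B d \<omega> - B c \<omega>)))
      = expectation (\<lambda>\<omega>. \<xi> \<omega> * \<eta> \<omega>) * measure lborel ({a<..b} \<inter> {c<..d})"
    by (simp add: Z_def[abs_def] ac_simps)
qed

end

section \<open>The Ito isometry\<close>

context brownian_filtration
begin

text \<open>
  Both sides are quadratic forms in the coefficients, and \<open>increment_covariance\<close> identifies their matrices.
\<close>

lemma ito_isometry:
  fixes \<xi> :: "'k \<Rightarrow> 'a \<Rightarrow> real"
  assumes K: "finite K" and pq: "\<And>k. k \<in> K \<Longrightarrow> 0 \<le> p k \<and> p k \<le> q k"
    and \<xi>: "\<And>k. k \<in> K \<Longrightarrow> \<xi> k \<in> borel_measurable (F (p k))"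
      "\<And>k. k \<in> K \<Longrightarrow> bounded (\<xi> k ` space M)"
  shows "(\<integral>\<^sup>+\<omega>. ennreal ((\<Sum>k\<in>K. \<xi> k \<omega> * (B (q k) \<omega> - B (p k) \<omega>))\<^sup>2) \<partial>M) =
    (\<integral>\<^sup>+\<omega>. (\<integral>\<^sup>+s. ennreal ((\<Sum>k\<in>K. \<xi> k \<omega> * indicator {p k<..q k} s)\<^sup>2) \<partial>lborel) \<partial>M)"
proof -
  let ?len = "\<lambda>k l. measure lborel ({p k<..q k} \<inter> {p l<..q l})"
  have cov: "integrable M (\<lambda>\<omega>. \<xi> k \<omega> * \<xi> l \<omega>)"
    "integrable M (\<lambda>\<omega>. (\<xi> k \<omega> * (B (q k) \<omega> - B (p k) \<omega>)) * (\<xi> l \<omega> * (B (q l) \<omega> - B (p l) \<omega>)))"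
    "expectation (\<lambda>\<omega>. (\<xi> k \<omega> * (B (q k) \<omega> - B (p k) \<omega>)) * (\<xi> l \<omega> * (B (q l) \<omega> - B (p l) \<omega>)))
      = expectation (\<lambda>\<omega>. \<xi> k \<omega> * \<xi> l \<omega>) * ?len k l" if "k \<in> K" "l \<in> K" for k l
    using increment_covariance[of "p k" "q k" "p l" "q l" "\<xi> k" "\<xi> l"] that pq \<xi> by auto
  have int: "integrable M (\<lambda>\<omega>. (\<Sum>k\<in>K. \<xi> k \<omega> * (B (q k) \<omega> - B (p k) \<omega>))\<^sup>2)"
    unfolding power2_eq_square sum_product using cov(2) by (intro Bochner_Integration.integrable_sum) auto
  have "(\<integral>\<^sup>+\<omega>. ennreal ((\<Sum>k\<in>K. \<xi> k \<omega> * (B (q k) \<omega> - B (p k) \<omega>))\<^sup>2) \<partial>M) =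
      ennreal (expectation (\<lambda>\<omega>. (\<Sum>k\<in>K. \<xi> k \<omega> * (B (q k) \<omega> - B (p k) \<omega>))\<^sup>2))"
    by (rule nn_integral_eq_integral[OF int]) simp
  also have "expectation (\<lambda>\<omega>. (\<Sum>k\<in>K. \<xi> k \<omega> * (B (q k) \<omega> - B (p k) \<omega>))\<^sup>2)
      = (\<Sum>k\<in>K. \<Sum>l\<in>K. expectation (\<lambda>\<omega>. (\<xi> k \<omega> * (B (q k) \<omega> - B (p k) \<omega>)) * (\<xi> l \<omega> * (B (q l) \<omega> - B (p l) \<omega>))))"
    using cov(2) by (simp add: power2_eq_square sum_product Bochner_Integration.integral_sum
        Bochner_Integration.integrable_sum)
  also have "\<dots> = (\<Sum>k\<in>K. \<Sum>l\<in>K. expectation (\<lambda>\<omega>. \<xi> k \<omega> * \<xi> l \<omega>) * ?len k l)"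
    using cov(3) by (intro sum.cong refl) auto
  also have "\<dots> = expectation (\<lambda>\<omega>. \<Sum>k\<in>K. \<Sum>l\<in>K. \<xi> k \<omega> * \<xi> l \<omega> * ?len k l)"
    using cov(1) by (simp add: Bochner_Integration.integral_sum Bochner_Integration.integrable_sum)
  finally have L: "(\<integral>\<^sup>+\<omega>. ennreal ((\<Sum>k\<in>K. \<xi> k \<omega> * (B (q k) \<omega> - B (p k) \<omega>))\<^sup>2) \<partial>M) =
    ennreal (expectation (\<lambda>\<omega>. \<Sum>k\<in>K. \<Sum>l\<in>K. \<xi> k \<omega> * \<xi> l \<omega> * ?len k l))" .
  have inner: "(\<integral>\<^sup>+s. ennreal ((\<Sum>k\<in>K. \<xi> k \<omega> * indicator {p k<..q k} s)\<^sup>2) \<partial>lborel) =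
      ennreal (\<Sum>k\<in>K. \<Sum>l\<in>K. \<xi> k \<omega> * \<xi> l \<omega> * ?len k l) \<and>
      0 \<le> (\<Sum>k\<in>K. \<Sum>l\<in>K. \<xi> k \<omega> * \<xi> l \<omega> * ?len k l)" for \<omega>
  proof -
    have eq: "(\<lambda>s. (\<Sum>k\<in>K. \<xi> k \<omega> * indicator {p k<..q k} s)\<^sup>2) =
      (\<lambda>s. \<Sum>k\<in>K. \<Sum>l\<in>K. \<xi> k \<omega> * \<xi> l \<omega> * indicator ({p k<..q k} \<inter> {p l<..q l}) s)"
      by (simp add: power2_eq_square sum_product indicator_inter_arith fun_eq_iff ac_simps del: Int_greaterThanAtMost)
    have fin: "emeasure lborel ({p k<..q k} \<inter> {p l<..q l}) < \<infinity>" for k l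
      by (rule le_less_trans[OF emeasure_mono[of _ "{p k..q k}"]]) (auto simp: emeasure_lborel_Icc_eq)
    have int: "integrable lborel (\<lambda>s. \<Sum>k\<in>K. \<Sum>l\<in>K. \<xi> k \<omega> * \<xi> l \<omega> * indicator ({p k<..q k} \<inter> {p l<..q l}) s)"
      using fin by (intro Bochner_Integration.integrable_sum integrable_mult_right integrable_real_indicator) auto
    have val: "(\<integral>s. (\<Sum>k\<in>K. \<Sum>l\<in>K. \<xi> k \<omega> * \<xi> l \<omega> * indicator ({p k<..q k} \<inter> {p l<..q l}) s) \<partial>lborel)
       = (\<Sum>k\<in>K. \<Sum>l\<in>K. \<xi> k \<omega> * \<xi> l \<omega> * ?len k l)"
      using fin by (subst Bochner_Integration.integral_sum, intro Bochner_Integration.integrable_sum integrable_mult_right integrable_real_indicator, simp, simp)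
       (intro sum.cong refl, subst Bochner_Integration.integral_sum, intro integrable_mult_right integrable_real_indicator, auto)
    have "0 \<le> (\<integral>s. (\<Sum>k\<in>K. \<xi> k \<omega> * indicator {p k<..q k} s)\<^sup>2 \<partial>lborel)" by simp
    moreover have "(\<integral>\<^sup>+s. ennreal ((\<Sum>k\<in>K. \<xi> k \<omega> * indicator {p k<..q k} s)\<^sup>2) \<partial>lborel)
       = ennreal (\<integral>s. (\<Sum>k\<in>K. \<xi> k \<omega> * indicator {p k<..q k} s)\<^sup>2 \<partial>lborel)"
      by (rule nn_integral_eq_integral) (unfold eq, rule int, simp)
    ultimately show ?thesis unfolding eq val by auto
  qed
  have "(\<integral>\<^sup>+\<omega>. (\<integral>\<^sup>+s. ennreal ((\<Sum>k\<in>K. \<xi> k \<omega> * indicator {p k<..q k} s)\<^sup>2) \<partial>lborel) \<partial>M)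
      = (\<integral>\<^sup>+\<omega>. ennreal (\<Sum>k\<in>K. \<Sum>l\<in>K. \<xi> k \<omega> * \<xi> l \<omega> * ?len k l) \<partial>M)"
    using inner by simp
  also have "\<dots> = ennreal (expectation (\<lambda>\<omega>. \<Sum>k\<in>K. \<Sum>l\<in>K. \<xi> k \<omega> * \<xi> l \<omega> * ?len k l))"
    using cov(1) inner by (intro nn_integral_eq_integral) (auto intro!: Bochner_Integration.integrable_sum)
  finally show ?thesis using L by simp
qed

text \<open>
  This inequality replaces the triangle inequality in \<open>L\<^sup>2\<close>; the lost constants are harmless for convergence.
\<close>

lemma square_diff_le: "ennreal ((x - z)\<^sup>2) \<le> 2 * ennreal ((x - y)\<^sup>2) + 2 * ennreal ((y - z)\<^sup>2)"
proof -
  have "(x - z)\<^sup>2 \<le> 2 * (x - y)\<^sup>2 + 2 * (y - z)\<^sup>2"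
    using zero_le_power2[of "(x - y) - (y - z)"] by (simp add: power2_eq_square algebra_simps)
  then have "ennreal ((x - z)\<^sup>2) \<le> ennreal (2 * (x - y)\<^sup>2 + 2 * (y - z)\<^sup>2)" by (rule ennreal_leI)
  also have "\<dots> = 2 * ennreal ((x - y)\<^sup>2) + 2 * ennreal ((y - z)\<^sup>2)"
    by (simp add: ennreal_mult ennreal_plus)
  finally show ?thesis .
qed

lemma nn_integral_square_diff_le:
  assumes [measurable]: "X \<in> borel_measurable N" "Y \<in> borel_measurable N" "Z \<in> borel_measurable N"
  shows "(\<integral>\<^sup>+x. ennreal ((X x - Z x)\<^sup>2) \<partial>N) \<le>
    2 * (\<integral>\<^sup>+x. ennreal ((X x - Y x)\<^sup>2) \<partial>N) + 2 * (\<integral>\<^sup>+x. ennreal ((Y x - Z x)\<^sup>2) \<partial>N)"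
proof -
  have "(\<integral>\<^sup>+x. ennreal ((X x - Z x)\<^sup>2) \<partial>N) \<le>
     (\<integral>\<^sup>+x. 2 * ennreal ((X x - Y x)\<^sup>2) + 2 * ennreal ((Y x - Z x)\<^sup>2) \<partial>N)"
    by (intro nn_integral_mono square_diff_le)
  also have "\<dots> = 2 * (\<integral>\<^sup>+x. ennreal ((X x - Y x)\<^sup>2) \<partial>N) + 2 * (\<integral>\<^sup>+x. ennreal ((Y x - Z x)\<^sup>2) \<partial>N)"
    by (simp add: nn_integral_add nn_integral_cmult)
  finally show ?thesis .
qed

lemma elementary_on_bounds:
  assumes "elementary_on M F a b n \<tau> \<xi>" "i \<le> n"
  shows "a \<le> \<tau> i" "\<tau> i \<le> b"
proof -
  have step: "\<And>j. j < n \<Longrightarrow> \<tau> j \<le> \<tau> (Suc j)" and ends: "a \<le> \<tau> 0" "\<tau> n \<le> b"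
    using assms by (auto simp: elementary_on_def)
  have "\<tau> 0 \<le> \<tau> i" using assms(2)
  proof (induction i)
    case (Suc i) then show ?case using step[of i] by (auto intro: order_trans)
  qed simp
  then show "a \<le> \<tau> i" using ends by simp
  have "\<tau> i \<le> \<tau> n" using assms(2)
  proof (induction i rule: inc_induct)
    case (step j) then show ?case using assms(1) by (auto simp: elementary_on_def intro: order_trans)
  qed simp
  then show "\<tau> i \<le> b" using ends by simp
qed

text \<open>
  The Ito integral is only known as a limit of integrals of random elementary processes. The difference of such
  an integral and a deterministic step integral is again of the form treated by \<open>ito_isometry\<close>, hence is
  controlled by the distance of the integrands. In particular deterministic step functions that approximate \<open>h\<close>
  have integrals that approximate \<open>I\<close>.
\<close>

lemma ito_integral_step_approx:
  fixes c p q :: "'k \<Rightarrow> real"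
  assumes ito: "is_ito_integral M F B (\<lambda>s _. h s) a b I" and a: "0 \<le> a"
    and h[measurable]: "h \<in> borel_measurable borel"
    and K: "finite K" and pq: "\<And>k. k \<in> K \<Longrightarrow> a \<le> p k \<and> p k \<le> q k \<and> q k \<le> b"
  shows "(\<integral>\<^sup>+\<omega>. ennreal ((I \<omega> - (\<Sum>k\<in>K. c k * (B (q k) \<omega> - B (p k) \<omega>)))\<^sup>2) \<partial>M) \<le>
    4 * (\<integral>\<^sup>+s\<in>{a..b}. ennreal ((h s - (\<Sum>k\<in>K. c k * indicator {p k<..q k} s))\<^sup>2) \<partial>lborel)"
proof -
  define J where "J \<omega> = (\<Sum>k\<in>K. c k * (B (q k) \<omega> - B (p k) \<omega>))" for \<omega>
  define g where "g s = (\<Sum>k\<in>K. c k * indicator {p k<..q k} s)" for s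
  obtain n \<tau> \<xi> where el: "\<And>m. elementary_on M F a b (n m) (\<tau> m) (\<xi> m)"
    and conv1: "(\<lambda>m. \<integral>\<^sup>+ \<omega>. (\<integral>\<^sup>+ s\<in>{a..b}.
             ennreal ((h s - elementary_process (n m) (\<tau> m) (\<xi> m) s \<omega>)\<^sup>2) \<partial>lborel) \<partial>M) \<longlonglongrightarrow> 0"
    and conv2: "(\<lambda>m. \<integral>\<^sup>+ \<omega>. ennreal ((I \<omega> - elementary_integral B (n m) (\<tau> m) (\<xi> m) \<omega>)\<^sup>2) \<partial>M) \<longlonglongrightarrow> 0"
    and [measurable]: "I \<in> borel_measurable M"
    using ito unfolding is_ito_integral_def by blast
  define e1 where "e1 m = (\<integral>\<^sup>+ \<omega>. (\<integral>\<^sup>+ s\<in>{a..b}.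
             ennreal ((h s - elementary_process (n m) (\<tau> m) (\<xi> m) s \<omega>)\<^sup>2) \<partial>lborel) \<partial>M)" for m
  define e2 where "e2 m = (\<integral>\<^sup>+ \<omega>. ennreal ((I \<omega> - elementary_integral B (n m) (\<tau> m) (\<xi> m) \<omega>)\<^sup>2) \<partial>M)" for m
  define d where "d = (\<integral>\<^sup>+s\<in>{a..b}. ennreal ((h s - g s)\<^sup>2) \<partial>lborel)"
  have "B (p k) \<in> borel_measurable M" "B (q k) \<in> borel_measurable M" if "k \<in> K" for k
    using B_measurable[of "p k"] B_measurable[of "q k"] pq[OF that] a by auto
  then have J[measurable]: "J \<in> borel_measurable M"
    unfolding J_def[abs_def]
    by (intro borel_measurable_sum borel_measurable_times borel_measurable_diff) auto
  have [measurable]: "g \<in> borel_measurable borel" unfolding g_def[abs_def] by measurable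
  have bound: "(\<integral>\<^sup>+\<omega>. ennreal ((I \<omega> - J \<omega>)\<^sup>2) \<partial>M) \<le> 2 * e2 m + 4 * e1 m + 4 * d" for m
  proof -
    let ?E = "elementary_integral B (n m) (\<tau> m) (\<xi> m)"
    let ?e = "elementary_process (n m) (\<tau> m) (\<xi> m)"
    have el_m: "\<xi> m i \<in> borel_measurable (F (\<tau> m i))" "bounded (\<xi> m i ` space M)"
        "a \<le> \<tau> m i" "\<tau> m i \<le> \<tau> m (Suc i)" "\<tau> m (Suc i) \<le> b" if "i < n m" for i
      using el[of m] that elementary_on_bounds[OF el[of m]]
      by (auto simp: elementary_on_def)
    have \<xi>M: "\<xi> m i \<in> borel_measurable M" if "i < n m" for i
      using el_m[OF that] measurable_F_M by blast
    have "B (\<tau> m i) \<in> borel_measurable M" "B (\<tau> m (Suc i)) \<in> borel_measurable M" if "i < n m" for i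
      using B_measurable[of "\<tau> m i"] B_measurable[of "\<tau> m (Suc i)"] el_m[OF that] a by auto
    then have [measurable]: "?E \<in> borel_measurable M"
      unfolding elementary_integral_def[abs_def] using \<xi>M
      by (intro borel_measurable_sum borel_measurable_times borel_measurable_diff) auto
    have pm: "(\<lambda>x. ?e (snd x) (fst x)) \<in> borel_measurable (M \<Otimes>\<^sub>M lborel)"
      unfolding elementary_process_def[abs_def] using \<xi>M
      by (intro borel_measurable_sum borel_measurable_times) (auto intro!: measurable_compose[OF measurable_fst] measurable_compose[OF measurable_snd])
    have em: "(\<lambda>s. ?e s \<omega>) \<in> borel_measurable lborel" for \<omega>
      unfolding elementary_process_def[abs_def] by measurable
    let ?K = "{..<n m} <+> K"
    let ?x = "case_sum (\<xi> m) (\<lambda>k _. - c k)"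
    let ?p = "case_sum (\<tau> m) p"
    let ?q = "case_sum (\<lambda>i. \<tau> m (Suc i)) q"
    have split1: "(\<Sum>k\<in>?K. ?x k \<omega> * (B (?q k) \<omega> - B (?p k) \<omega>)) = ?E \<omega> - J \<omega>" for \<omega>
      using K by (simp add: sum.Plus J_def elementary_integral_def sum_negf comp_def)
    have split2: "(\<Sum>k\<in>?K. ?x k \<omega> * indicator {?p k<..?q k} s) = ?e s \<omega> - g s" for s \<omega>
      unfolding sum.Plus[OF finite_lessThan K] g_def elementary_process_def comp_def sum.case
      by (simp only: mult_minus_left sum_negf diff_conv_add_uminus)
    have supp: "ennreal ((?e s \<omega> - g s)\<^sup>2) = ennreal ((?e s \<omega> - g s)\<^sup>2) * indicator {a..b} s" for s \<omega>
    proof (cases "s \<in> {a..b}")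
      case False
      have "?e s \<omega> = 0" unfolding elementary_process_def
      proof (intro sum.neutral ballI)
        fix i assume "i \<in> {..<n m}"
        with el_m[of i] False show "\<xi> m i \<omega> * indicator {\<tau> m i<..\<tau> m (Suc i)} s = 0"
          by (auto simp: indicator_def)
      qed
      moreover have "g s = 0" unfolding g_def
      proof (intro sum.neutral ballI)
        fix k assume "k \<in> K"
        with pq[of k] False show "c k * indicator {p k<..q k} s = 0"
          by (auto simp: indicator_def)
      qed
      ultimately show ?thesis by simp
    qed simp
    have "(\<integral>\<^sup>+\<omega>. ennreal ((?E \<omega> - J \<omega>)\<^sup>2) \<partial>M) =
      (\<integral>\<^sup>+\<omega>. (\<integral>\<^sup>+s. ennreal ((?e s \<omega> - g s)\<^sup>2) \<partial>lborel) \<partial>M)"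
    proof -
      have "finite ?K" using K by simp
      moreover have "0 \<le> ?p k \<and> ?p k \<le> ?q k" if "k \<in> ?K" for k
      proof (cases k)
        case (Inl i) then show ?thesis using that el_m[of i] a by auto
      next
        case (Inr l) then show ?thesis using that pq[of l] a by auto
      qed
      moreover have "?x k \<in> borel_measurable (F (?p k))" if "k \<in> ?K" for k
        using that el_m by auto
      moreover have "bounded (?x k ` space M)" if "k \<in> ?K" for k
        using that el_m by (auto intro: boundedI)
      ultimately show ?thesis
        using ito_isometry[of ?K ?p ?q ?x] unfolding split1 split2 by blast
    qed
    also have "\<dots> = (\<integral>\<^sup>+\<omega>. (\<integral>\<^sup>+s\<in>{a..b}. ennreal ((?e s \<omega> - g s)\<^sup>2) \<partial>lborel) \<partial>M)"
      using supp by simp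
    also have "\<dots> \<le> (\<integral>\<^sup>+\<omega>. 2 * (\<integral>\<^sup>+s\<in>{a..b}. ennreal ((h s - ?e s \<omega>)\<^sup>2) \<partial>lborel) + 2 * d \<partial>M)"
    proof (rule nn_integral_mono)
      fix \<omega>
      note [measurable] = em[of \<omega>]
      have "(\<integral>\<^sup>+s\<in>{a..b}. ennreal ((?e s \<omega> - g s)\<^sup>2) \<partial>lborel)
        \<le> (\<integral>\<^sup>+s. 2 * (ennreal ((h s - ?e s \<omega>)\<^sup>2) * indicator {a..b} s) +
              2 * (ennreal ((h s - g s)\<^sup>2) * indicator {a..b} s) \<partial>lborel)"
        using square_diff_le[of "?e _ \<omega>" "g _" "h _"]
        by (intro nn_integral_mono) (auto simp: indicator_def power2_commute)
      also have "\<dots> = 2 * (\<integral>\<^sup>+s\<in>{a..b}. ennreal ((h s - ?e s \<omega>)\<^sup>2) \<partial>lborel) + 2 * d"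
        unfolding d_def by (subst nn_integral_add) (auto simp: nn_integral_cmult)
      finally show "(\<integral>\<^sup>+s\<in>{a..b}. ennreal ((?e s \<omega> - g s)\<^sup>2) \<partial>lborel)
         \<le> 2 * (\<integral>\<^sup>+s\<in>{a..b}. ennreal ((h s - ?e s \<omega>)\<^sup>2) \<partial>lborel) + 2 * d" .
    qed
    also have "\<dots> = 2 * e1 m + 2 * d"
    proof -
      have m: "(\<lambda>\<omega>. \<integral>\<^sup>+s\<in>{a..b}. ennreal ((h s - ?e s \<omega>)\<^sup>2) \<partial>lborel) \<in> borel_measurable M"
      proof (rule lborel.borel_measurable_nn_integral)
        have [measurable]: "(\<lambda>(\<omega>, s). ?e s \<omega>) \<in> borel_measurable (M \<Otimes>\<^sub>M lborel)"
          using pm by (simp add: case_prod_beta)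
        show "(\<lambda>(\<omega>, s). ennreal ((h s - ?e s \<omega>)\<^sup>2) * indicator {a..b} s) \<in> borel_measurable (M \<Otimes>\<^sub>M lborel)"
          by measurable
      qed
      then show ?thesis
        by (subst nn_integral_add) (auto simp: nn_integral_cmult e1_def emeasure_space_1)
    qed
    finally have 1: "(\<integral>\<^sup>+\<omega>. ennreal ((?E \<omega> - J \<omega>)\<^sup>2) \<partial>M) \<le> 2 * e1 m + 2 * d" .
    have "(\<integral>\<^sup>+\<omega>. ennreal ((I \<omega> - J \<omega>)\<^sup>2) \<partial>M) \<le> 2 * e2 m + 2 * (\<integral>\<^sup>+\<omega>. ennreal ((?E \<omega> - J \<omega>)\<^sup>2) \<partial>M)"
      unfolding e2_def by (intro nn_integral_square_diff_le) measurable
    also have "\<dots> \<le> 2 * e2 m + 2 * (2 * e1 m + 2 * d)"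
      by (intro add_left_mono mult_left_mono 1) auto
    also have "\<dots> = 2 * e2 m + 4 * e1 m + 4 * d"
      by (simp add: distrib_left mult.assoc[symmetric] add.assoc[symmetric])
    finally show ?thesis .
  qed
  have "(\<lambda>m. 2 * e2 m + 4 * e1 m + 4 * d) \<longlonglongrightarrow> 2 * 0 + 4 * 0 + 4 * d"
    using conv1 conv2 unfolding e1_def[symmetric] e2_def[symmetric]
    by (intro tendsto_add ennreal_tendsto_cmult tendsto_const) auto
  then have "(\<integral>\<^sup>+\<omega>. ennreal ((I \<omega> - J \<omega>)\<^sup>2) \<partial>M) \<le> 2 * 0 + 4 * 0 + 4 * d"
    by (rule LIMSEQ_le_const) (use bound in auto)
  then show ?thesis by (simp add: J_def g_def d_def)
qed

end

section \<open>Gaussian law of deterministic step integrals\<close>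

definition normal_tail :: "real \<Rightarrow> real" where
  "normal_tail a = measure (density lborel (\<lambda>x. ennreal (std_normal_density x))) {a<..}"

lemma normal_tail_eq: "ennreal (normal_tail a) = (\<integral>\<^sup>+x. ennreal (std_normal_density x) * indicator {a<..} x \<partial>lborel)"
proof -
  interpret N: prob_space "density lborel (\<lambda>x. ennreal (std_normal_density x))"
    by (rule prob_space_normal_density) simp
  show ?thesis
    unfolding normal_tail_def N.emeasure_eq_measure[symmetric] by (subst emeasure_density) auto
qed

lemma normal_tail_nonneg: "0 \<le> normal_tail a"
  by (simp add: normal_tail_def)

lemma normal_tail_le_1: "normal_tail a \<le> 1"
proof -
  interpret N: prob_space "density lborel (\<lambda>x. ennreal (std_normal_density x))"
    by (rule prob_space_normal_density) simp
  show ?thesis unfolding normal_tail_def by (rule N.prob_le_1)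
qed

lemma normal_tail_antimono: "a \<le> b \<Longrightarrow> normal_tail b \<le> normal_tail a"
proof -
  interpret N: prob_space "density lborel (\<lambda>x. ennreal (std_normal_density x))"
    by (rule prob_space_normal_density) simp
  show "a \<le> b \<Longrightarrow> normal_tail b \<le> normal_tail a"
    unfolding normal_tail_def by (intro N.finite_measure_mono) auto
qed

lemma normal_tail_pos: "0 < normal_tail a"
proof -
  have "ennreal (normal_tail a) \<noteq> 0"
  proof
    assume "ennreal (normal_tail a) = 0"
    then have "AE x in lborel. ennreal (std_normal_density x) * indicator {a<..} x = 0"
      unfolding normal_tail_eq by (subst (asm) nn_integral_0_iff_AE) auto
    then have "AE x in lborel. x \<notin> {a<..}"
    proof (rule AE_mp, intro AE_I2 impI)
      fix x assume "ennreal (std_normal_density x) * indicator {a<..} x = 0"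
      moreover have "0 < std_normal_density x" by (rule normal_density_pos) simp
      ultimately show "x \<notin> {a<..}" by (auto simp: indicator_def split: if_splits)
    qed
    then have "emeasure lborel {a<..} = 0"
      by (subst (asm) AE_iff_measurable[OF _ refl]) (auto simp: greaterThan_def)
    moreover have "emeasure lborel {a<..<a+1} \<le> emeasure lborel {a<..}"
      by (rule emeasure_mono) auto
    ultimately show False by simp
  qed
  then show ?thesis using normal_tail_nonneg[of a] by (cases "normal_tail a = 0") auto
qed

lemma normal_tail_scaled:
  assumes \<sigma>: "0 < \<sigma>"
  shows "(\<integral>\<^sup>+x. ennreal (normal_density 0 \<sigma> x) * indicator {a<..} x \<partial>lborel) = ennreal (normal_tail (a / \<sigma>))"
proof -
  have d: "ennreal \<sigma> * ennreal (normal_density 0 \<sigma> (\<sigma> * x)) = ennreal (std_normal_density x)" for x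
    using \<sigma> by (simp add: ennreal_mult'[symmetric] normal_density_def power_mult_distrib real_sqrt_mult)
  have "(\<integral>\<^sup>+x. ennreal (normal_density 0 \<sigma> x) * indicator {a<..} x \<partial>lborel) =
     ennreal \<bar>\<sigma>\<bar> * (\<integral>\<^sup>+x. ennreal (normal_density 0 \<sigma> (0 + \<sigma> * x)) * indicator {a<..} (0 + \<sigma> * x) \<partial>lborel)"
    using \<sigma> by (intro nn_integral_real_affine) auto
  also have "\<dots> = (\<integral>\<^sup>+x. ennreal (std_normal_density x) * indicator {a<..} (\<sigma> * x) \<partial>lborel)"
    using \<sigma> d by (subst nn_integral_cmult[symmetric]) (auto simp: mult.assoc[symmetric])
  also have "\<dots> = (\<integral>\<^sup>+x. ennreal (std_normal_density x) * indicator {a / \<sigma><..} x \<partial>lborel)"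
    using \<sigma> by (intro nn_integral_cong) (auto simp: indicator_def field_simps)
  finally show ?thesis by (simp add: normal_tail_eq)
qed

lemma normal_convolution_nn_integral:
  assumes pos: "0 < \<sigma>" "0 < \<tau>" and g[measurable]: "g \<in> borel_measurable borel"
  shows "(\<integral>\<^sup>+x. ennreal (normal_density 0 \<tau> x) * (\<integral>\<^sup>+y. ennreal (normal_density 0 \<sigma> y) * g (x + y) \<partial>lborel) \<partial>lborel)
    = (\<integral>\<^sup>+z. ennreal (normal_density 0 (sqrt (\<sigma>\<^sup>2 + \<tau>\<^sup>2)) z) * g z \<partial>lborel)"
proof -
  have "(\<integral>\<^sup>+y. ennreal (normal_density 0 \<sigma> y) * g (x + y) \<partial>lborel) =
      (\<integral>\<^sup>+z. ennreal (normal_density 0 \<sigma> (z - x)) * g z \<partial>lborel)" for x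
    using nn_integral_real_affine[of "\<lambda>z. ennreal (normal_density 0 \<sigma> (z - x)) * g z" 1 x] by simp
  then have "(\<integral>\<^sup>+x. ennreal (normal_density 0 \<tau> x) * (\<integral>\<^sup>+y. ennreal (normal_density 0 \<sigma> y) * g (x + y) \<partial>lborel) \<partial>lborel)
     = (\<integral>\<^sup>+x. (\<integral>\<^sup>+z. ennreal (normal_density 0 \<tau> x) * (ennreal (normal_density 0 \<sigma> (z - x)) * g z) \<partial>lborel) \<partial>lborel)"
    by (simp add: nn_integral_cmult)
  also have "\<dots> = (\<integral>\<^sup>+z. (\<integral>\<^sup>+x. ennreal (normal_density 0 \<tau> x) * (ennreal (normal_density 0 \<sigma> (z - x)) * g z) \<partial>lborel) \<partial>lborel)"
    by (rule lborel_pair.Fubini') measurable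
  also have "\<dots> = (\<integral>\<^sup>+z. (\<integral>\<^sup>+x. ennreal (normal_density 0 \<sigma> (z - x) * normal_density 0 \<tau> x) \<partial>lborel) * g z \<partial>lborel)"
    by (subst nn_integral_multc[symmetric]) (auto simp: ennreal_mult ac_simps)
  finally show ?thesis
    using fun_cong[OF conv_normal_density_zero_mean[OF pos]] by simp
qed

context brownian_filtration
begin

text \<open>
  Joint law of a past variable and a later increment: a product with a Gaussian factor. The first component
  of \<open>Z\<close> will carry the indicator of a past event.
\<close>

lemma nn_integral_past_increment:
  fixes Z :: "'a \<Rightarrow> ennreal \<times> real"
  assumes st: "0 \<le> s" "s < t" and Z: "Z \<in> F s \<rightarrow>\<^sub>M borel \<Otimes>\<^sub>M borel"
    and \<phi>[measurable]: "\<phi> \<in> borel_measurable ((borel \<Otimes>\<^sub>M borel) \<Otimes>\<^sub>M borel)"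
  shows "(\<integral>\<^sup>+\<omega>. \<phi> (Z \<omega>, B t \<omega> - B s \<omega>) \<partial>M) =
    (\<integral>\<^sup>+\<omega>. (\<integral>\<^sup>+y. ennreal (normal_density 0 (sqrt (t - s)) y) * \<phi> (Z \<omega>, y) \<partial>lborel) \<partial>M)"
proof -
  let ?D = "\<lambda>\<omega>. B t \<omega> - B s \<omega>"
  let ?N = "borel \<Otimes>\<^sub>M borel :: (ennreal \<times> real) measure"
  \<comment> \<open>\<^const>\<open>prob_space.indep_var\<close> relates variables of one type, so the increment is padded by \<open>0\<close>.\<close>
  let ?P = "\<lambda>\<omega>. (0 :: ennreal, ?D \<omega>)"
  have ind: "indep_var ?N Z ?N ?P"
    by (rule increment_indep[OF st Z]) measurable
  have Zm[measurable]: "Z \<in> M \<rightarrow>\<^sub>M ?N" using Z measurable_F_M by blast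
  have [measurable]: "?D \<in> borel_measurable M" using B_measurable st by simp
  interpret P: prob_space "distr M ?N ?P" by (rule prob_space_distr) simp
  have "(\<integral>\<^sup>+\<omega>. \<phi> (Z \<omega>, ?D \<omega>) \<partial>M) =
      (\<integral>\<^sup>+z. \<phi> (fst z, snd (snd z)) \<partial>distr M (?N \<Otimes>\<^sub>M ?N) (\<lambda>\<omega>. (Z \<omega>, ?P \<omega>)))"
    by (subst nn_integral_distr) auto
  also have "\<dots> = (\<integral>\<^sup>+z. \<phi> (fst z, snd (snd z)) \<partial>(distr M ?N Z \<Otimes>\<^sub>M distr M ?N ?P))"
    using ind unfolding indep_var_distribution_eq by simp
  also have "\<dots> = (\<integral>\<^sup>+x. \<integral>\<^sup>+y. \<phi> (x, snd y) \<partial>distr M ?N ?P \<partial>distr M ?N Z)"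
    by (subst P.nn_integral_fst[symmetric]) auto
  also have "\<dots> = (\<integral>\<^sup>+\<omega>. \<integral>\<^sup>+y. \<phi> (Z \<omega>, snd y) \<partial>distr M ?N ?P \<partial>M)"
    by (subst nn_integral_distr) auto
  also have "\<dots> = (\<integral>\<^sup>+\<omega>. (\<integral>\<^sup>+y. ennreal (normal_density 0 (sqrt (t - s)) y) * \<phi> (Z \<omega>, y) \<partial>lborel) \<partial>M)"
  proof (rule nn_integral_cong)
    fix \<omega> assume w: "\<omega> \<in> space M"
    have [measurable]: "(\<lambda>y. \<phi> (Z \<omega>, y)) \<in> borel_measurable borel"
      by (rule measurable_compose[OF _ \<phi>]) (use measurable_space[OF Zm w] in measurable)
    have "(\<integral>\<^sup>+y. \<phi> (Z \<omega>, snd y) \<partial>distr M ?N ?P) = (\<integral>\<^sup>+\<omega>'. \<phi> (Z \<omega>, ?D \<omega>') \<partial>M)"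
      by (subst nn_integral_distr) auto
    also have "\<dots> = (\<integral>\<^sup>+y. ennreal (normal_density 0 (sqrt (t - s)) y) * \<phi> (Z \<omega>, y) \<partial>lborel)"
      by (rule distributed_nn_integral[OF increment_distributed[OF st], symmetric]) simp
    finally show "(\<integral>\<^sup>+y. \<phi> (Z \<omega>, snd y) \<partial>distr M ?N ?P) =
        (\<integral>\<^sup>+y. ennreal (normal_density 0 (sqrt (t - s)) y) * \<phi> (Z \<omega>, y) \<partial>lborel)" .
  qed
  finally show ?thesis .
qed

lemma nn_integral_past_scaled_increment:
  fixes Z :: "'a \<Rightarrow> real"
  assumes st: "0 \<le> s" "s < t" and c: "0 < c" and Z: "Z \<in> borel_measurable (F s)" and E: "E \<in> sets (F s)"
    and g[measurable]: "g \<in> borel_measurable borel"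
  shows "(\<integral>\<^sup>+\<omega>. indicator E \<omega> * g (Z \<omega> + c * (B t \<omega> - B s \<omega>)) \<partial>M) =
    (\<integral>\<^sup>+\<omega>. indicator E \<omega> * (\<integral>\<^sup>+y. ennreal (normal_density 0 (c * sqrt (t - s)) y) * g (Z \<omega> + y) \<partial>lborel) \<partial>M)"
proof -
  have m: "(\<lambda>\<omega>. (indicator E \<omega> :: ennreal, Z \<omega>)) \<in> F s \<rightarrow>\<^sub>M borel \<Otimes>\<^sub>M borel"
    using Z E by measurable
  have d: "ennreal c * ennreal (normal_density 0 (c * sqrt (t - s)) (c * y)) = ennreal (normal_density 0 (sqrt (t - s)) y)" for y
    using c by (simp add: ennreal_mult'[symmetric] normal_density_def power_mult_distrib real_sqrt_mult)
  have "(\<integral>\<^sup>+\<omega>. indicator E \<omega> * g (Z \<omega> + c * (B t \<omega> - B s \<omega>)) \<partial>M) =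
    (\<integral>\<^sup>+\<omega>. (\<integral>\<^sup>+y. ennreal (normal_density 0 (sqrt (t - s)) y) * (indicator E \<omega> * g (Z \<omega> + c * y)) \<partial>lborel) \<partial>M)"
    using nn_integral_past_increment[OF st m, of "\<lambda>x. fst (fst x) * g (snd (fst x) + c * snd x)"] by simp
  also have "\<dots> = (\<integral>\<^sup>+\<omega>. indicator E \<omega> * (\<integral>\<^sup>+y. ennreal (normal_density 0 (c * sqrt (t - s)) y) * g (Z \<omega> + y) \<partial>lborel) \<partial>M)"
  proof (rule nn_integral_cong)
    fix \<omega>
    have "(\<integral>\<^sup>+y. ennreal (normal_density 0 (c * sqrt (t - s)) y) * g (Z \<omega> + y) \<partial>lborel) =
       ennreal \<bar>c\<bar> * (\<integral>\<^sup>+y. ennreal (normal_density 0 (c * sqrt (t - s)) (0 + c * y)) * g (Z \<omega> + (0 + c * y)) \<partial>lborel)"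
      using c by (intro nn_integral_real_affine) auto
    also have "\<dots> = (\<integral>\<^sup>+y. ennreal (normal_density 0 (sqrt (t - s)) y) * g (Z \<omega> + c * y) \<partial>lborel)"
      using c d by (subst nn_integral_cmult[symmetric]) (auto simp: mult.assoc[symmetric])
    finally have *: "(\<integral>\<^sup>+y. ennreal (normal_density 0 (c * sqrt (t - s)) y) * g (Z \<omega> + y) \<partial>lborel) =
       (\<integral>\<^sup>+y. ennreal (normal_density 0 (sqrt (t - s)) y) * g (Z \<omega> + c * y) \<partial>lborel)" .
    show "(\<integral>\<^sup>+y. ennreal (normal_density 0 (sqrt (t - s)) y) * (indicator E \<omega> * g (Z \<omega> + c * y)) \<partial>lborel) =
       indicator E \<omega> * (\<integral>\<^sup>+y. ennreal (normal_density 0 (c * sqrt (t - s)) y) * g (Z \<omega> + y) \<partial>lborel)"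
      unfolding * by (subst nn_integral_cmult[symmetric]) (auto simp: ac_simps)
  qed
  finally show ?thesis .
qed

text \<open>
  Conditionally on an event of the past, a step integral with positive coefficients is Gaussian. The induction peels
  off the last increment, which is independent of the event and of the earlier increments together, and adds
  the variances by convolution. Testing against all \<open>g\<close> makes the induction hypothesis strong enough.
\<close>

lemma step_integral_gaussian:
  fixes p c :: "nat \<Rightarrow> real"
  assumes p0: "0 \<le> p 0" and p: "\<And>j. j \<le> n \<Longrightarrow> p j < p (Suc j)" and c: "\<And>j. j \<le> n \<Longrightarrow> 0 < c j"
    and E: "E \<in> sets (F (p 0))" and g: "g \<in> borel_measurable borel"
  shows "(\<integral>\<^sup>+\<omega>. indicator E \<omega> * g (\<Sum>j<Suc n. c j * (B (p (Suc j)) \<omega> - B (p j) \<omega>)) \<partial>M) =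
    emeasure M E * (\<integral>\<^sup>+x. ennreal (normal_density 0 (sqrt (\<Sum>j<Suc n. (c j)\<^sup>2 * (p (Suc j) - p j))) x) * g x \<partial>lborel)"
  using p c g
proof (induction n arbitrary: g)
  case 0
  have EM: "E \<in> sets M" using E sets_F by blast
  have "(\<integral>\<^sup>+\<omega>. indicator E \<omega> * g (0 + c 0 * (B (p (Suc 0)) \<omega> - B (p 0) \<omega>)) \<partial>M) =
    (\<integral>\<^sup>+\<omega>. indicator E \<omega> * (\<integral>\<^sup>+y. ennreal (normal_density 0 (c 0 * sqrt (p (Suc 0) - p 0)) y) * g (0 + y) \<partial>lborel) \<partial>M)"
    by (rule nn_integral_past_scaled_increment) (use 0 p0 E in auto)
  also have "\<dots> = emeasure M E * (\<integral>\<^sup>+y. ennreal (normal_density 0 (c 0 * sqrt (p (Suc 0) - p 0)) y) * g y \<partial>lborel)"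
    using EM by (subst nn_integral_multc) auto
  also have "c 0 * sqrt (p (Suc 0) - p 0) = sqrt (\<Sum>j<Suc 0. (c j)\<^sup>2 * (p (Suc j) - p j))"
    using 0(2)[of 0] by (simp add: real_sqrt_mult)
  finally show ?case by simp
next
  case (Suc n)
  note [measurable] = Suc.prems(3)
  let ?J = "\<lambda>\<omega>. \<Sum>j<Suc n. c j * (B (p (Suc j)) \<omega> - B (p j) \<omega>)"
  let ?v = "\<Sum>j<Suc n. (c j)\<^sup>2 * (p (Suc j) - p j)"
  let ?\<sigma> = "c (Suc n) * sqrt (p (Suc (Suc n)) - p (Suc n))"
  have mono: "p i \<le> p j" if "i \<le> j" "j \<le> Suc (Suc n)" for i j
    using that
  proof (induction j rule: dec_induct)
    case (step j) then show ?case using Suc.prems(1)[of j] by simp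
  qed simp
  have nonneg: "0 \<le> p j" if "j \<le> Suc (Suc n)" for j using mono[of 0 j] that p0 by simp
  have J: "?J \<in> borel_measurable (F (p (Suc n)))"
    using mono nonneg by (intro borel_measurable_sum borel_measurable_times borel_measurable_diff B_F') auto
  have E': "E \<in> sets (F (p (Suc n)))" using E sets_F_mono mono[of 0 "Suc n"] by auto
  have v: "0 < ?v" using Suc.prems(1,2) by (intro sum_pos) (auto intro!: mult_pos_pos zero_less_power)
  have \<sigma>: "0 < ?\<sigma>" using Suc.prems(1)[of "Suc n"] Suc.prems(2)[of "Suc n"] by simp
  have sq: "?\<sigma>\<^sup>2 + (sqrt ?v)\<^sup>2 = (\<Sum>j<Suc (Suc n). (c j)\<^sup>2 * (p (Suc j) - p j))"
    using v Suc.prems(1)[of "Suc n"] by (simp add: power_mult_distrib)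
  have "(\<integral>\<^sup>+\<omega>. indicator E \<omega> * g (\<Sum>j<Suc (Suc n). c j * (B (p (Suc j)) \<omega> - B (p j) \<omega>)) \<partial>M) =
     (\<integral>\<^sup>+\<omega>. indicator E \<omega> * g (?J \<omega> + c (Suc n) * (B (p (Suc (Suc n))) \<omega> - B (p (Suc n)) \<omega>)) \<partial>M)"
    by simp
  also have "\<dots> = (\<integral>\<^sup>+\<omega>. indicator E \<omega> * (\<integral>\<^sup>+y. ennreal (normal_density 0 ?\<sigma> y) * g (?J \<omega> + y) \<partial>lborel) \<partial>M)"
    by (rule nn_integral_past_scaled_increment)
       (use Suc.prems nonneg[of "Suc n"] J E' in auto)
  also have "\<dots> = emeasure M E * (\<integral>\<^sup>+x. ennreal (normal_density 0 (sqrt ?v) x) *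
      (\<integral>\<^sup>+y. ennreal (normal_density 0 ?\<sigma> y) * g (x + y) \<partial>lborel) \<partial>lborel)"
    using Suc.prems by (intro Suc.IH) auto
  also have "\<dots> = emeasure M E * (\<integral>\<^sup>+z. ennreal (normal_density 0 (sqrt (?\<sigma>\<^sup>2 + (sqrt ?v)\<^sup>2)) z) * g z \<partial>lborel)"
    using \<sigma> v Suc.prems(3) by (subst normal_convolution_nn_integral) auto
  finally show ?case unfolding sq .
qed

lemma step_integral_tail:
  fixes p c :: "nat \<Rightarrow> real"
  assumes p0: "0 \<le> p 0" and p: "\<And>j. j < n \<Longrightarrow> p j < p (Suc j)" and c: "\<And>j. j < n \<Longrightarrow> 0 < c j"
    and n: "0 < n" and E: "E \<in> sets (F (p 0))"
  shows "prob (E \<inter> {\<omega> \<in> space M. x < (\<Sum>j<n. c j * (B (p (Suc j)) \<omega> - B (p j) \<omega>))}) =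
    prob E * normal_tail (x / sqrt (\<Sum>j<n. (c j)\<^sup>2 * (p (Suc j) - p j)))"
proof -
  obtain m where m: "n = Suc m" using n by (cases n) auto
  let ?J = "\<lambda>\<omega>. \<Sum>j<n. c j * (B (p (Suc j)) \<omega> - B (p j) \<omega>)"
  let ?v = "\<Sum>j<n. (c j)\<^sup>2 * (p (Suc j) - p j)"
  have v: "0 < ?v" using p c n by (intro sum_pos) (auto intro!: mult_pos_pos zero_less_power)
  have EM: "E \<in> sets M" using E sets_F by blast
  have nonneg: "0 \<le> p j" if "j \<le> n" for j
    using that
  proof (induction j)
    case (Suc j) then show ?case using p[of j] by simp
  qed (simp add: p0)
  have [measurable]: "?J \<in> borel_measurable M"
    using nonneg by (intro borel_measurable_sum borel_measurable_times borel_measurable_diff B_measurable) auto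
  have "emeasure M (E \<inter> {\<omega> \<in> space M. x < ?J \<omega>}) = (\<integral>\<^sup>+\<omega>. indicator (E \<inter> {\<omega> \<in> space M. x < ?J \<omega>}) \<omega> \<partial>M)"
    using EM by (subst nn_integral_indicator) auto
  also have "\<dots> = (\<integral>\<^sup>+\<omega>. indicator E \<omega> * indicator {x<..} (?J \<omega>) \<partial>M)"
    by (intro nn_integral_cong) (auto simp: indicator_def)
  also have "\<dots> = emeasure M E * (\<integral>\<^sup>+y. ennreal (normal_density 0 (sqrt ?v) y) * indicator {x<..} y \<partial>lborel)"
    unfolding m by (rule step_integral_gaussian) (use p0 p c E m in auto)
  also have "\<dots> = ennreal (prob E * normal_tail (x / sqrt ?v))"
    using v by (simp add: normal_tail_scaled emeasure_eq_measure ennreal_mult normal_tail_nonneg)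
  finally show ?thesis
    by (simp add: emeasure_eq_measure normal_tail_nonneg)
qed

end

section \<open>Riemann sums for Ito integrals of deterministic functions\<close>

lemma sum_indicator_partition:
  fixes p c :: "nat \<Rightarrow> real"
  assumes "\<And>j. j < n \<Longrightarrow> p j \<le> p (Suc j)"
  shows "p 0 \<le> p n"
    and "r \<in> {p 0<..p n} \<Longrightarrow>
      \<exists>j<n. r \<in> {p j<..p (Suc j)} \<and> (\<Sum>i<n. c i * indicator {p i<..p (Suc i)} r) = c j"
    and "r \<notin> {p 0<..p n} \<Longrightarrow> (\<Sum>i<n. c i * indicator {p i<..p (Suc i)} r) = 0"
proof -
  have "p 0 \<le> p n \<and>
    (r \<in> {p 0<..p n} \<longrightarrow>
      (\<exists>j<n. r \<in> {p j<..p (Suc j)} \<and> (\<Sum>i<n. c i * indicator {p i<..p (Suc i)} r) = c j)) \<and>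
    (r \<notin> {p 0<..p n} \<longrightarrow> (\<Sum>i<n. c i * indicator {p i<..p (Suc i)} r) = 0)"
    using assms
  proof (induction n)
    case 0 then show ?case by simp
  next
    case (Suc n)
    have IH: "p 0 \<le> p n"
      "r \<in> {p 0<..p n} \<longrightarrow>
        (\<exists>j<n. r \<in> {p j<..p (Suc j)} \<and> (\<Sum>i<n. c i * indicator {p i<..p (Suc i)} r) = c j)"
      "r \<notin> {p 0<..p n} \<longrightarrow> (\<Sum>i<n. c i * indicator {p i<..p (Suc i)} r) = 0"
      using Suc by auto
    have step: "p n \<le> p (Suc n)" using Suc.prems by simp
    consider (old) "r \<in> {p 0<..p n}" | (new) "r \<in> {p n<..p (Suc n)}"
      | (out) "r \<notin> {p 0<..p (Suc n)}" by force
    then show ?case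
    proof cases
      case old
      then obtain j where "j < n" "r \<in> {p j<..p (Suc j)}"
          "(\<Sum>i<n. c i * indicator {p i<..p (Suc i)} r) = c j" using IH by auto
      moreover have "indicator {p n<..p (Suc n)} r = (0::real)" using old by simp
      ultimately have "\<exists>j<Suc n. r \<in> {p j<..p (Suc j)} \<and>
          (\<Sum>i<Suc n. c i * indicator {p i<..p (Suc i)} r) = c j"
        by (intro exI[of _ j]) (simp only: sum.lessThan_Suc, simp)
      then show ?thesis using old IH(1) step by auto
    next
      case new
      then have "(\<Sum>i<n. c i * indicator {p i<..p (Suc i)} r) = 0" using IH(3) by auto
      then have "\<exists>j<Suc n. r \<in> {p j<..p (Suc j)} \<and>
          (\<Sum>i<Suc n. c i * indicator {p i<..p (Suc i)} r) = c j"
        using new by (intro exI[of _ n]) (simp only: sum.lessThan_Suc, simp)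
      then show ?thesis using new IH(1) step by auto
    next
      case out
      then have "(\<Sum>i<n. c i * indicator {p i<..p (Suc i)} r) = 0" "indicator {p n<..p (Suc n)} r = (0::real)"
        using IH(1,3) step by (auto simp: indicator_def)
      then have "(\<Sum>i<Suc n. c i * indicator {p i<..p (Suc i)} r) = 0"
        unfolding sum.lessThan_Suc by (simp only: mult_zero_right add_0_right)
      moreover have "p 0 \<le> p (Suc n)" using IH(1) step by simp
      ultimately show ?thesis using out by blast
    qed
  qed
  then show "p 0 \<le> p n" "r \<in> {p 0<..p n} \<Longrightarrow>
      \<exists>j<n. r \<in> {p j<..p (Suc j)} \<and> (\<Sum>i<n. c i * indicator {p i<..p (Suc i)} r) = c j"
    "r \<notin> {p 0<..p n} \<Longrightarrow> (\<Sum>i<n. c i * indicator {p i<..p (Suc i)} r) = 0"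
    by auto
qed

definition grid :: "real \<Rightarrow> real \<Rightarrow> nat \<Rightarrow> nat \<Rightarrow> real" where
  "grid s t n j = s + real j * ((t - s) / real n)"

lemma grid_Suc: "grid s t n (Suc j) = grid s t n j + (t - s) / real n"
  by (simp add: grid_def distrib_right add_divide_distrib)

lemma grid_ends: "grid s t n 0 = s" "0 < n \<Longrightarrow> grid s t n n = t"
  by (auto simp: grid_def)

lemma grid_bounds: "s \<le> t \<Longrightarrow> j \<le> n \<Longrightarrow> s \<le> grid s t n j \<and> grid s t n j \<le> t"
proof -
  assume st: "s \<le> t" and j: "j \<le> n"
  have "real j * ((t - s) / real n) \<le> t - s"
  proof (cases "n = 0")
    case False
    have "real j * ((t - s) / real n) = (real j / real n) * (t - s)" by simp
    also have "\<dots> \<le> 1 * (t - s)" using st j False by (intro mult_right_mono) auto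
    finally show ?thesis by simp
  qed (use st j in simp)
  then show ?thesis using st by (simp add: grid_def)
qed

lemma grid_cell_bounds:
  assumes "s \<le> t" "j < n"
  shows "s \<le> grid s t n j" "grid s t n j \<le> grid s t n (Suc j)" "grid s t n (Suc j) \<le> t"
  using assms grid_bounds[of s t j n] grid_bounds[of s t "Suc j" n] by (auto simp: grid_Suc)

lemma riemann_step_error:
  assumes lip: "\<And>x y. s \<le> x \<Longrightarrow> s \<le> y \<Longrightarrow> \<bar>h x - h y\<bar> \<le> \<bar>x - y\<bar>" and st: "s \<le> t" and n: "0 < n"
    and r: "r \<in> {s<..t}"
  shows "\<bar>h r - (\<Sum>j<n. h (grid s t n j) * indicator {grid s t n j<..grid s t n (Suc j)} r)\<bar> \<le> (t - s) / real n"
proof -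
  have "grid s t n j \<le> grid s t n (Suc j)" for j using st by (simp add: grid_Suc)
  from sum_indicator_partition(2)[of n "grid s t n", OF this] r n
  obtain j where j: "j < n" "r \<in> {grid s t n j<..grid s t n (Suc j)}"
    "(\<Sum>j<n. h (grid s t n j) * indicator {grid s t n j<..grid s t n (Suc j)} r) = h (grid s t n j)"
    by (fastforce simp: grid_ends)
  have "\<bar>h r - h (grid s t n j)\<bar> \<le> \<bar>r - grid s t n j\<bar>"
    using r grid_bounds[OF st, of j n] j by (intro lip) auto
  also have "\<dots> \<le> (t - s) / real n" using j(2) grid_Suc[of s t n j] by auto
  finally show ?thesis using j(3) by simp
qed

lemma riemann_step_outside:
  assumes st: "s \<le> t" and n: "0 < n" and r: "r \<notin> {s<..t}"
  shows "(\<Sum>j<n. h (grid s t n j) * indicator {grid s t n j<..grid s t n (Suc j)} r) = (0::real)"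
proof -
  have "grid s t n j \<le> grid s t n (Suc j)" for j using st by (simp add: grid_Suc)
  from sum_indicator_partition(3)[of n "grid s t n", OF this] r n show ?thesis
    by (simp only: grid_ends)
qed

text \<open>
  An Ito integral process with deterministic integrand \<open>h\<close>, of which \<open>G s\<close> bounds the
  variance accumulated after time \<open>s\<close>: the two bounds on \<open>G x - G y\<close> say in monotone form that \<open>-G\<close> is a primitive
  of \<open>h\<^sup>2\<close>, so that Riemann sums of \<open>h\<^sup>2\<close> telescope.
\<close>

locale wiener_integral = brownian_filtration M F B
  for M :: "'a measure" and F :: "real \<Rightarrow> 'a measure" and B :: "real \<Rightarrow> 'a \<Rightarrow> real" +
  fixes h G :: "real \<Rightarrow> real" and I :: "real \<Rightarrow> 'a \<Rightarrow> real"
  assumes h_measurable[measurable]: "h \<in> borel_measurable borel"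
    and h_pos: "\<And>s. 1 \<le> s \<Longrightarrow> 0 < h s" and h_le_1: "\<And>s. 1 \<le> s \<Longrightarrow> h s \<le> 1"
    and h_lipschitz: "\<And>x y. 1 \<le> x \<Longrightarrow> 1 \<le> y \<Longrightarrow> \<bar>h x - h y\<bar> \<le> \<bar>x - y\<bar>"
    and G_nonneg: "\<And>s. 1 \<le> s \<Longrightarrow> 0 \<le> G s"
    and G_diff: "\<And>x y. 1 \<le> x \<Longrightarrow> x \<le> y \<Longrightarrow> (h y)\<^sup>2 * (y - x) \<le> G x - G y"
      "\<And>x y. 1 \<le> x \<Longrightarrow> x \<le> y \<Longrightarrow> G x - G y \<le> (h x)\<^sup>2 * (y - x)"
    and ito: "\<And>t. 1 \<le> t \<Longrightarrow> is_ito_integral M F B (\<lambda>s _. h s) 1 t (I t)"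
begin

lemma I_measurable: "1 \<le> t \<Longrightarrow> I t \<in> borel_measurable M"
  using ito[of t] by (simp add: is_ito_integral_def)

definition riemann_integral :: "real \<Rightarrow> real \<Rightarrow> nat \<Rightarrow> 'a \<Rightarrow> real" where
  "riemann_integral s t n \<omega> =
    (\<Sum>j<n. h (grid s t n j) * (B (grid s t n (Suc j)) \<omega> - B (grid s t n j) \<omega>))"

definition riemann_variance :: "real \<Rightarrow> real \<Rightarrow> nat \<Rightarrow> real" where
  "riemann_variance s t n = (\<Sum>j<n. (h (grid s t n j))\<^sup>2 * (grid s t n (Suc j) - grid s t n j))"

lemma riemann_integral_measurable:
  assumes "1 \<le> s" "s \<le> t" shows "riemann_integral s t n \<in> borel_measurable M"
proof -
  have "0 \<le> grid s t n j" for j using assms by (simp add: grid_def)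
  then show ?thesis
    unfolding riemann_integral_def[abs_def]
    by (intro borel_measurable_sum borel_measurable_times borel_measurable_diff B_measurable) auto
qed

text \<open>
  Both \<open>I s\<close> and \<open>I t\<close> are compared with Riemann sums that share the same part over \<open>[1, s]\<close>, which cancels in
  the difference.
\<close>

lemma ito_increment_approx:
  assumes st: "1 \<le> s" "s \<le> t" and n: "0 < n"
  shows "(\<integral>\<^sup>+\<omega>. ennreal (((I t \<omega> - I s \<omega>) - riemann_integral s t n \<omega>)\<^sup>2) \<partial>M) \<le> ennreal (16 * t^3 / (real n)\<^sup>2)"
proof -
  have t: "1 \<le> t" using st by simp
  let ?g = "\<lambda>s t r. \<Sum>j<n. h (grid s t n j) * indicator {grid s t n j<..grid s t n (Suc j)} r"
  let ?d = "ennreal ((t / real n)\<^sup>2)"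
  have sq: "(h r - x)\<^sup>2 \<le> (t / real n)\<^sup>2" if "\<bar>h r - x\<bar> \<le> (v - u) / real n" "v - u \<le> t" for r x u v
  proof -
    have "\<bar>h r - x\<bar> \<le> t / real n"
      using that by (meson divide_right_mono of_nat_0_le_iff order_trans)
    then show ?thesis using power_mono[of "\<bar>h r - x\<bar>" _ 2] by fastforce
  qed
  have e1: "(\<integral>\<^sup>+\<omega>. ennreal ((I s \<omega> - riemann_integral 1 s n \<omega>)\<^sup>2) \<partial>M) \<le> 4 * (?d * ennreal t)"
  proof -
    have "(\<integral>\<^sup>+\<omega>. ennreal ((I s \<omega> - riemann_integral 1 s n \<omega>)\<^sup>2) \<partial>M) \<le>
       4 * (\<integral>\<^sup>+r\<in>{1..s}. ennreal ((h r - ?g 1 s r)\<^sup>2) \<partial>lborel)"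
      unfolding riemann_integral_def
      using st grid_cell_bounds[of 1 s _ n]
      by (intro ito_integral_step_approx[OF ito]) auto
    also have "(\<integral>\<^sup>+r\<in>{1..s}. ennreal ((h r - ?g 1 s r)\<^sup>2) \<partial>lborel) \<le> (\<integral>\<^sup>+r. ?d * indicator {1..t} r \<partial>lborel)"
    proof (rule nn_integral_mono_AE, rule AE_mp[OF AE_lborel_singleton[of 1]], intro AE_I2 impI)
      fix r :: real assume r1: "r \<noteq> 1"
      show "ennreal ((h r - ?g 1 s r)\<^sup>2) * indicator {1..s} r \<le> ?d * indicator {1..t} r"
      proof (cases "r \<in> {1..s}")
        case True
        with r1 have r: "r \<in> {1<..s}" by auto
        from riemann_step_error[OF h_lipschitz st(1) n this]
        have "(h r - ?g 1 s r)\<^sup>2 \<le> (t / real n)\<^sup>2" using st by (intro sq[of _ _ s 1]) auto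
        then show ?thesis using True st by (auto simp: indicator_def intro: ennreal_leI)
      qed simp
    qed
    also have "\<dots> \<le> ?d * ennreal t"
      using t by (subst nn_integral_cmult) (auto intro!: mult_left_mono ennreal_leI)
    finally show ?thesis by (simp add: mult_left_mono)
  qed
  have e2: "(\<integral>\<^sup>+\<omega>. ennreal ((I t \<omega> - (riemann_integral 1 s n \<omega> + riemann_integral s t n \<omega>))\<^sup>2) \<partial>M)
      \<le> 4 * (?d * ennreal t)"
  proof -
    let ?K = "{..<n} <+> {..<n}"
    let ?p = "case_sum (grid 1 s n) (grid s t n)"
    let ?q = "case_sum (\<lambda>j. grid 1 s n (Suc j)) (\<lambda>j. grid s t n (Suc j))"
    have J: "riemann_integral 1 s n \<omega> + riemann_integral s t n \<omega> =
        (\<Sum>k\<in>?K. h (?p k) * (B (?q k) \<omega> - B (?p k) \<omega>))" for \<omega>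
      unfolding riemann_integral_def by (simp only: sum.Plus[OF finite_lessThan finite_lessThan] comp_def sum.case)
    have g: "(\<Sum>k\<in>?K. h (?p k) * indicator {?p k<..?q k} r) = ?g 1 s r + ?g s t r" for r
      by (simp only: sum.Plus[OF finite_lessThan finite_lessThan] comp_def sum.case)
    have pq: "1 \<le> ?p k \<and> ?p k \<le> ?q k \<and> ?q k \<le> t" if "k \<in> ?K" for k
    proof (cases k)
      case (Inl j)
      then show ?thesis using that st grid_cell_bounds[of 1 s j n] by auto
    next
      case (Inr j)
      then show ?thesis using that st grid_cell_bounds[of s t j n] by auto
    qed
    have "(\<integral>\<^sup>+\<omega>. ennreal ((I t \<omega> - (riemann_integral 1 s n \<omega> + riemann_integral s t n \<omega>))\<^sup>2) \<partial>M) \<le>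
       4 * (\<integral>\<^sup>+r\<in>{1..t}. ennreal ((h r - (?g 1 s r + ?g s t r))\<^sup>2) \<partial>lborel)"
      unfolding J g[symmetric]
      by (rule ito_integral_step_approx[OF ito[OF t]]) (use pq in auto)
    also have "(\<integral>\<^sup>+r\<in>{1..t}. ennreal ((h r - (?g 1 s r + ?g s t r))\<^sup>2) \<partial>lborel) \<le> (\<integral>\<^sup>+r. ?d * indicator {1..t} r \<partial>lborel)"
    proof (rule nn_integral_mono_AE, rule AE_mp[OF AE_lborel_singleton[of 1]], intro AE_I2 impI)
      fix r :: real assume r1: "r \<noteq> 1"
      show "ennreal ((h r - (?g 1 s r + ?g s t r))\<^sup>2) * indicator {1..t} r \<le> ?d * indicator {1..t} r"
      proof (cases "r \<in> {1..t}")
        case True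
        then consider "r \<in> {1<..s}" "r \<notin> {s<..t}" | "r \<notin> {1<..s}" "r \<in> {s<..t}" using r1 st by force
        then have "(h r - (?g 1 s r + ?g s t r))\<^sup>2 \<le> (t / real n)\<^sup>2"
        proof cases
          case 1
          have "?g s t r = 0" by (rule riemann_step_outside[OF st(2) n 1(2)])
          moreover have "(h r - ?g 1 s r)\<^sup>2 \<le> (t / real n)\<^sup>2"
            using riemann_step_error[OF h_lipschitz st(1) n 1(1)] st by (intro sq[of _ _ s 1]) auto
          ultimately show ?thesis by (simp only: add_0_right)
        next
          case 2
          have "?g 1 s r = 0" by (rule riemann_step_outside[OF st(1) n 2(1)])
          moreover have "(h r - ?g s t r)\<^sup>2 \<le> (t / real n)\<^sup>2"
            using riemann_step_error[OF h_lipschitz st(2) n 2(2)] st by (intro sq[of _ _ t s]) auto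
          ultimately show ?thesis by (simp only: add_0_left)
        qed
        then show ?thesis by (intro mult_right_mono ennreal_leI) auto
      qed simp
    qed
    also have "\<dots> \<le> ?d * ennreal t"
      using t by (subst nn_integral_cmult) (auto intro!: mult_left_mono ennreal_leI)
    finally show ?thesis by (simp add: mult_left_mono)
  qed
  note [measurable] = I_measurable[OF st(1)] I_measurable[OF t]
    riemann_integral_measurable[OF order_refl st(1)] riemann_integral_measurable[OF st]
  have "(\<integral>\<^sup>+\<omega>. ennreal (((I t \<omega> - I s \<omega>) - riemann_integral s t n \<omega>)\<^sup>2) \<partial>M) =
     (\<integral>\<^sup>+\<omega>. ennreal (((I t \<omega> - riemann_integral s t n \<omega>) - I s \<omega>)\<^sup>2) \<partial>M)"
    by (simp add: algebra_simps)
  also have "\<dots> \<le> 2 * (\<integral>\<^sup>+\<omega>. ennreal (((I t \<omega> - riemann_integral s t n \<omega>) - riemann_integral 1 s n \<omega>)\<^sup>2) \<partial>M)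
     + 2 * (\<integral>\<^sup>+\<omega>. ennreal ((riemann_integral 1 s n \<omega> - I s \<omega>)\<^sup>2) \<partial>M)"
    by (rule nn_integral_square_diff_le) measurable
  also have "\<dots> \<le> 2 * (4 * (?d * ennreal t)) + 2 * (4 * (?d * ennreal t))"
    using e1 e2 by (intro add_mono mult_left_mono) (auto simp: algebra_simps power2_commute)
  also have "\<dots> = ennreal (2 * (4 * ((t / real n)\<^sup>2 * t)) + 2 * (4 * ((t / real n)\<^sup>2 * t)))"
  proof -
    have "2 * (4 * ennreal a) + 2 * (4 * ennreal a) = ennreal (2 * (4 * a) + 2 * (4 * a))" if "0 \<le> a" for a
    proof -
      have "2 * (4 * ennreal a) = ennreal (2 * (4 * a))" using that by (simp add: ennreal_mult)
      then show ?thesis using that by (simp add: ennreal_plus[symmetric] del: ennreal_plus)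
    qed
    from this[of "(t / real n)\<^sup>2 * t"] show ?thesis using t by (simp add: ennreal_mult)
  qed
  also have "2 * (4 * ((t / real n)\<^sup>2 * t)) + 2 * (4 * ((t / real n)\<^sup>2 * t)) = 16 * t^3 / (real n)\<^sup>2"
    by (simp add: power2_eq_square power3_eq_cube)
  finally show ?thesis .
qed

lemma G_strict: "1 \<le> s \<Longrightarrow> s < t \<Longrightarrow> G t < G s"
  using G_diff(1)[of s t] h_pos[of t] by (smt (verit) mult_pos_pos zero_less_power)

text \<open>
  Left endpoints give an upper sum for \<open>h\<^sup>2\<close> and right endpoints a lower sum; the two differ by the mesh times the
  total decrease of \<open>h\<^sup>2\<close>, which is at most \<open>1\<close>.
\<close>

lemma riemann_variance_bounds:
  assumes st: "1 \<le> s" "s \<le> t" and n: "0 < n"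
  shows "G s - G t \<le> riemann_variance s t n" "riemann_variance s t n \<le> G s + (t - s) / real n"
proof -
  let ?p = "grid s t n"
  have p1: "1 \<le> ?p j" "?p j \<le> ?p (Suc j)" if "j \<le> n" for j
    using st grid_bounds[OF st(2) that] by (auto simp: grid_Suc)
  have tel: "(\<Sum>j<n. u (?p j) - u (?p (Suc j))) = u s - u t" for u :: "real \<Rightarrow> real"
    using sum_lessThan_telescope'[of "\<lambda>j. u (?p j)" n] n by (simp add: grid_ends)
  have "G s - G t = (\<Sum>j<n. G (?p j) - G (?p (Suc j)))" by (simp only: tel)
  also have "\<dots> \<le> riemann_variance s t n"
    unfolding riemann_variance_def using p1 by (intro sum_mono G_diff(2)) auto
  finally show "G s - G t \<le> riemann_variance s t n" .
  have "riemann_variance s t n =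
    (\<Sum>j<n. (h (?p (Suc j)))\<^sup>2 * (?p (Suc j) - ?p j)) + (\<Sum>j<n. (h (?p j))\<^sup>2 - (h (?p (Suc j)))\<^sup>2) * ((t - s) / real n)"
    unfolding riemann_variance_def sum_distrib_right sum.distrib[symmetric]
    by (simp add: grid_Suc algebra_simps diff_divide_distrib)
  also have "(\<Sum>j<n. (h (?p j))\<^sup>2 - (h (?p (Suc j)))\<^sup>2) = (h s)\<^sup>2 - (h t)\<^sup>2"
    by (rule tel)
  also have "(\<Sum>j<n. (h (?p (Suc j)))\<^sup>2 * (?p (Suc j) - ?p j)) \<le> (\<Sum>j<n. G (?p j) - G (?p (Suc j)))"
    using p1 by (intro sum_mono G_diff(1)) auto
  also have "\<dots> = G s - G t" by (rule tel)
  also have "G s - G t + ((h s)\<^sup>2 - (h t)\<^sup>2) * ((t - s) / real n) \<le> G s + 1 * ((t - s) / real n)"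
  proof (intro add_mono mult_right_mono)
    show "G s - G t \<le> G s" using G_nonneg[of t] st by simp
    have "(h s)\<^sup>2 \<le> 1" using h_le_1[of s] h_pos[of s] st by (simp add: power_le_one)
    then show "(h s)\<^sup>2 - (h t)\<^sup>2 \<le> 1" by (smt (verit) zero_le_power2)
  qed (use st in simp)
  finally show "riemann_variance s t n \<le> G s + (t - s) / real n" by simp
qed

lemma riemann_integral_tail:
  assumes st: "1 \<le> s" "s < t" and n: "0 < n" and E: "E \<in> sets (F s)"
  shows "prob (E \<inter> {\<omega> \<in> space M. x < riemann_integral s t n \<omega>}) =
    prob E * normal_tail (x / sqrt (riemann_variance s t n))"
  unfolding riemann_integral_def riemann_variance_def
proof (rule step_integral_tail)
  show "0 < h (grid s t n j)" if "j < n" for j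
    using that grid_bounds[of s t j n] st by (intro h_pos) auto
qed (use assms in \<open>auto simp: grid_Suc grid_ends\<close>)

lemma riemann_integral_second_moment:
  assumes st: "1 \<le> s" "s < t" and n: "0 < n"
  shows "(\<integral>\<^sup>+\<omega>. ennreal ((riemann_integral s t n \<omega>)\<^sup>2) \<partial>M) = ennreal (riemann_variance s t n)"
proof -
  obtain m where m: "n = Suc m" using n by (cases n) auto
  have v: "0 < riemann_variance s t n"
    using riemann_variance_bounds(1)[of s t n] G_strict[OF st] st n by simp
  have "space M \<in> sets (F s)" by (metis sets.top space_F)
  then have E: "space M \<in> sets (F (grid s t n 0))" by (simp add: grid_ends)
  have "(\<integral>\<^sup>+\<omega>. ennreal ((riemann_integral s t n \<omega>)\<^sup>2) \<partial>M) =
     (\<integral>\<^sup>+\<omega>. indicator (space M) \<omega> * ennreal ((riemann_integral s t n \<omega>)\<^sup>2) \<partial>M)"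
    by (intro nn_integral_cong) auto
  also have "\<dots> = emeasure M (space M) *
      (\<integral>\<^sup>+x. ennreal (normal_density 0 (sqrt (riemann_variance s t n)) x) * ennreal (x\<^sup>2) \<partial>lborel)"
    unfolding riemann_integral_def riemann_variance_def m
  proof (rule step_integral_gaussian)
    show "0 < h (grid s t (Suc m) j)" if "j \<le> m" for j
      using that grid_bounds[of s t j "Suc m"] st by (intro h_pos) auto
  qed (use st E[unfolded m] in \<open>auto simp: grid_Suc grid_ends\<close>)
  also have "\<dots> = (\<integral>\<^sup>+x. ennreal (normal_density 0 (sqrt (riemann_variance s t n)) x * (x - 0)^(2 * 1)) \<partial>lborel)"
    by (simp add: emeasure_space_1 ennreal_mult)
  also have "\<dots> = ennreal (\<integral>x. normal_density 0 (sqrt (riemann_variance s t n)) x * (x - 0)^(2 * 1) \<partial>lborel)"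
    using v by (intro nn_integral_eq_integral integrable_normal_moment) auto
  also have "\<dots> = ennreal (riemann_variance s t n)"
    using v by (subst integral_normal_moment_even) auto
  finally show ?thesis .
qed

lemma ito_increment_second_moment:
  assumes st: "1 \<le> s" "s \<le> t"
  shows "(\<integral>\<^sup>+\<omega>. ennreal ((I t \<omega> - I s \<omega>)\<^sup>2) \<partial>M) \<le> ennreal (2 * G s)"
proof (cases "s = t")
  case True then show ?thesis by simp
next
  case False
  then have lt: "s < t" using st by simp
  have t: "1 \<le> t" using st by simp
  note [measurable] = I_measurable[OF st(1)] I_measurable[OF t] riemann_integral_measurable[OF st]
  let ?b = "\<lambda>n. 2 * (16 * t^3 / (real n)\<^sup>2) + 2 * (G s + (t - s) / real n)"
  have "(\<integral>\<^sup>+\<omega>. ennreal ((I t \<omega> - I s \<omega>)\<^sup>2) \<partial>M) \<le> ennreal (?b n)" if n: "0 < n" for n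
  proof -
    have "(\<integral>\<^sup>+\<omega>. ennreal ((I t \<omega> - I s \<omega>)\<^sup>2) \<partial>M) = (\<integral>\<^sup>+\<omega>. ennreal (((I t \<omega> - I s \<omega>) - 0)\<^sup>2) \<partial>M)" by simp
    also have "\<dots> \<le> 2 * (\<integral>\<^sup>+\<omega>. ennreal (((I t \<omega> - I s \<omega>) - riemann_integral s t n \<omega>)\<^sup>2) \<partial>M)
      + 2 * (\<integral>\<^sup>+\<omega>. ennreal ((riemann_integral s t n \<omega> - 0)\<^sup>2) \<partial>M)"
      by (rule nn_integral_square_diff_le) measurable
    also have "\<dots> \<le> 2 * ennreal (16 * t^3 / (real n)\<^sup>2) + 2 * ennreal (G s + (t - s) / real n)"
      using ito_increment_approx[OF st n] riemann_variance_bounds(2)[OF st n]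
      by (intro add_mono mult_left_mono) (auto simp: riemann_integral_second_moment[OF st(1) lt n] intro: ennreal_leI)
    also have "\<dots> = ennreal (?b n)"
    proof -
      have two: "2 * ennreal a + 2 * ennreal c = ennreal (2 * a + 2 * c)" if "0 \<le> a" "0 \<le> c" for a c
        using that by (simp add: ennreal_mult ennreal_plus)
      show ?thesis by (rule two) (use t st G_nonneg[of s] in auto)
    qed
    finally show ?thesis .
  qed
  moreover have "?b \<longlonglongrightarrow> 2 * 0 + 2 * (G s + 0)"
  proof (intro tendsto_add tendsto_mult tendsto_const)
    show "(\<lambda>n. 16 * t ^ 3 / (real n)\<^sup>2) \<longlonglongrightarrow> 0" by real_asymp
    show "(\<lambda>n. (t - s) / real n) \<longlonglongrightarrow> 0" by real_asymp
  qed
  then have "(\<lambda>n. ennreal (?b n)) \<longlonglongrightarrow> ennreal (2 * 0 + 2 * (G s + 0))" by (rule tendsto_ennrealI)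
  ultimately have "(\<integral>\<^sup>+\<omega>. ennreal ((I t \<omega> - I s \<omega>)\<^sup>2) \<partial>M) \<le> ennreal (2 * 0 + 2 * (G s + 0))"
    by (intro LIMSEQ_le_const[where X="\<lambda>n. ennreal (?b n)"]) (auto intro!: exI[of _ 1])
  then show ?thesis by simp
qed

lemma ito_increment_first_moment:
  assumes st: "1 \<le> s" "s \<le> t"
  shows "(\<integral>\<^sup>+\<omega>. ennreal \<bar>I t \<omega> - I s \<omega>\<bar> \<partial>M) \<le> ennreal (sqrt (2 * G s))"
proof -
  have t: "1 \<le> t" using st by simp
  note [measurable] = I_measurable[OF st(1)] I_measurable[OF t]
  have "0 < G s" using G_strict[of s "s + 1"] G_nonneg[of "s + 1"] st by simp
  \<comment> \<open>This \<open>r\<close> minimizes the bound on the first moment that the second moment bound \<open>2 * G s\<close> yields below.\<close>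
  define r where "r = sqrt (2 * G s)"
  have r: "0 < r" "r\<^sup>2 = 2 * G s" using \<open>0 < G s\<close> by (auto simp: r_def)
  have "\<bar>x\<bar> \<le> 1 / (2 * r) * x\<^sup>2 + r / 2" for x :: real
  proof -
    have "2 * r * \<bar>x\<bar> \<le> x\<^sup>2 + r\<^sup>2" using sum_squares_bound[of r "\<bar>x\<bar>"] by (simp add: add.commute)
    then show ?thesis using r(1) by (simp add: field_simps power2_eq_square)
  qed
  then have "(\<integral>\<^sup>+\<omega>. ennreal \<bar>I t \<omega> - I s \<omega>\<bar> \<partial>M) \<le>
     (\<integral>\<^sup>+\<omega>. ennreal (1 / (2 * r)) * ennreal ((I t \<omega> - I s \<omega>)\<^sup>2) + ennreal (r / 2) \<partial>M)"
    using r(1) by (intro nn_integral_mono)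
      (auto simp: ennreal_mult[symmetric] ennreal_plus[symmetric] simp del: ennreal_plus intro!: ennreal_leI)
  also have "\<dots> = ennreal (1 / (2 * r)) * (\<integral>\<^sup>+\<omega>. ennreal ((I t \<omega> - I s \<omega>)\<^sup>2) \<partial>M) + ennreal (r / 2)"
    by (simp add: nn_integral_add nn_integral_cmult emeasure_space_1)
  also have "\<dots> \<le> ennreal (1 / (2 * r)) * ennreal (2 * G s) + ennreal (r / 2)"
    by (intro add_right_mono mult_left_mono ito_increment_second_moment st) simp
  also have "\<dots> = ennreal (1 / (2 * r) * r\<^sup>2 + r / 2)"
  proof -
    have three: "ennreal a * ennreal b + ennreal c = ennreal (a * b + c)" if "0 \<le> a" "0 \<le> b" "0 \<le> c" for a b c
      using that by (simp add: ennreal_mult ennreal_plus)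
    show ?thesis unfolding r(2)[symmetric] by (rule three) (use r(1) in auto)
  qed
  also have "1 / (2 * r) * r\<^sup>2 + r / 2 = r" using r(1) by (simp add: power2_eq_square)
  finally show ?thesis by (simp add: r_def)
qed

text \<open>
  Riemann sums have exactly Gaussian tails, with variance at least \<open>G s - G t\<close> because left endpoints
  overestimate the decreasing function \<open>h\<^sup>2\<close>. The margin \<open>\<epsilon>\<close> absorbs the error of
  approximation, which tends to \<open>0\<close> in probability.
\<close>

lemma ito_increment_tail:
  assumes st: "1 \<le> s" "s < t" and E: "E \<in> sets (F s)" and x: "0 \<le> x" and \<epsilon>: "0 < \<epsilon>"
  shows "prob E * normal_tail ((x + \<epsilon>) / sqrt (G s - G t)) \<le> prob (E \<inter> {\<omega> \<in> space M. x < I t \<omega> - I s \<omega>})"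
proof -
  have st': "s \<le> t" "1 \<le> t" using st by auto
  note [measurable] = I_measurable[OF st(1)] I_measurable[OF st'(2)] riemann_integral_measurable[OF st(1) st'(1)]
  have EM[measurable]: "E \<in> sets M" using E sets_F by blast
  let ?J = "riemann_integral s t"
  let ?D = "\<lambda>\<omega>. I t \<omega> - I s \<omega>"
  have "prob E * normal_tail ((x + \<epsilon>) / sqrt (G s - G t)) \<le>
     prob (E \<inter> {\<omega> \<in> space M. x < ?D \<omega>}) + 1 / \<epsilon>\<^sup>2 * (16 * t^3 / (real n)\<^sup>2)" if n: "0 < n" for n
  proof -
    have v: "G s - G t \<le> riemann_variance s t n" "0 < G s - G t"
      using riemann_variance_bounds(1)[OF st(1) st'(1) n] G_strict[OF st] by auto
    have "(x + \<epsilon>) / sqrt (riemann_variance s t n) \<le> (x + \<epsilon>) / sqrt (G s - G t)"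
      using v x \<epsilon> by (intro divide_left_mono) auto
    then have "prob E * normal_tail ((x + \<epsilon>) / sqrt (G s - G t)) \<le>
        prob E * normal_tail ((x + \<epsilon>) / sqrt (riemann_variance s t n))"
      by (intro mult_left_mono normal_tail_antimono) auto
    also have "\<dots> = prob (E \<inter> {\<omega> \<in> space M. x + \<epsilon> < ?J n \<omega>})"
      by (rule riemann_integral_tail[OF st n E, symmetric])
    also have "\<dots> \<le> prob ((E \<inter> {\<omega> \<in> space M. x < ?D \<omega>}) \<union> {\<omega> \<in> space M. 1 \<le> ennreal (1 / \<epsilon>\<^sup>2) * ennreal ((?D \<omega> - ?J n \<omega>)\<^sup>2)})"
    proof (intro finite_measure_mono subsetI)
      fix \<omega> assume w: "\<omega> \<in> E \<inter> {\<omega> \<in> space M. x + \<epsilon> < ?J n \<omega>}"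
      show "\<omega> \<in> (E \<inter> {\<omega> \<in> space M. x < ?D \<omega>}) \<union> {\<omega> \<in> space M. 1 \<le> ennreal (1 / \<epsilon>\<^sup>2) * ennreal ((?D \<omega> - ?J n \<omega>)\<^sup>2)}"
      proof (cases "x < ?D \<omega>")
        case False
        then have "\<epsilon> \<le> \<bar>?D \<omega> - ?J n \<omega>\<bar>" using w by auto
        then have "\<epsilon>\<^sup>2 \<le> (?D \<omega> - ?J n \<omega>)\<^sup>2" using \<epsilon> power_mono[of \<epsilon> _ 2] by fastforce
        then have "1 \<le> 1 / \<epsilon>\<^sup>2 * (?D \<omega> - ?J n \<omega>)\<^sup>2" using \<epsilon> by (simp add: field_simps)
        then show ?thesis using w \<epsilon> by (simp add: ennreal_mult'[symmetric] del: ennreal_1)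
      qed (use w in auto)
    qed measurable
    also have "\<dots> \<le> prob (E \<inter> {\<omega> \<in> space M. x < ?D \<omega>}) + prob {\<omega> \<in> space M. 1 \<le> ennreal (1 / \<epsilon>\<^sup>2) * ennreal ((?D \<omega> - ?J n \<omega>)\<^sup>2)}"
      by (rule measure_Un_le) measurable
    also have "prob {\<omega> \<in> space M. 1 \<le> ennreal (1 / \<epsilon>\<^sup>2) * ennreal ((?D \<omega> - ?J n \<omega>)\<^sup>2)} \<le> 1 / \<epsilon>\<^sup>2 * (16 * t^3 / (real n)\<^sup>2)"
    proof -
      have "emeasure M {\<omega> \<in> space M. 1 \<le> ennreal (1 / \<epsilon>\<^sup>2) * ennreal ((?D \<omega> - ?J n \<omega>)\<^sup>2)} \<le>
         ennreal (1 / \<epsilon>\<^sup>2) * (\<integral>\<^sup>+\<omega>. ennreal ((?D \<omega> - ?J n \<omega>)\<^sup>2) * indicator (space M) \<omega> \<partial>M)"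
        by (rule nn_integral_Markov_inequality) measurable
      also have "\<dots> \<le> ennreal (1 / \<epsilon>\<^sup>2) * ennreal (16 * t^3 / (real n)\<^sup>2)"
      proof (rule mult_left_mono)
        have "(\<integral>\<^sup>+\<omega>. ennreal ((?D \<omega> - ?J n \<omega>)\<^sup>2) * indicator (space M) \<omega> \<partial>M) = (\<integral>\<^sup>+\<omega>. ennreal ((?D \<omega> - ?J n \<omega>)\<^sup>2) \<partial>M)"
          by (intro nn_integral_cong) auto
        then show "(\<integral>\<^sup>+\<omega>. ennreal ((?D \<omega> - ?J n \<omega>)\<^sup>2) * indicator (space M) \<omega> \<partial>M) \<le> ennreal (16 * t^3 / (real n)\<^sup>2)"
          using ito_increment_approx[OF st(1) st'(1) n] by simp
      qed simp
      also have "\<dots> = ennreal (1 / \<epsilon>\<^sup>2 * (16 * t^3 / (real n)\<^sup>2))"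
        using st' by (intro ennreal_mult[symmetric]) auto
      finally show ?thesis
        using st' by (simp add: emeasure_eq_measure)
    qed
    finally show ?thesis by simp
  qed
  moreover have "(\<lambda>n. prob (E \<inter> {\<omega> \<in> space M. x < ?D \<omega>}) + 1 / \<epsilon>\<^sup>2 * (16 * t^3 / (real n)\<^sup>2)) \<longlonglongrightarrow>
      prob (E \<inter> {\<omega> \<in> space M. x < ?D \<omega>}) + 1 / \<epsilon>\<^sup>2 * 0"
  proof (intro tendsto_add tendsto_mult tendsto_const)
    show "(\<lambda>n. 16 * t ^ 3 / (real n)\<^sup>2) \<longlonglongrightarrow> 0" by real_asymp
  qed
  ultimately have "prob E * normal_tail ((x + \<epsilon>) / sqrt (G s - G t)) \<le> prob (E \<inter> {\<omega> \<in> space M. x < ?D \<omega>}) + 1 / \<epsilon>\<^sup>2 * 0"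
    by (intro LIMSEQ_le_const[where X="\<lambda>n. prob (E \<inter> {\<omega> \<in> space M. x < ?D \<omega>}) + 1 / \<epsilon>\<^sup>2 * (16 * t^3 / (real n)\<^sup>2)"])
       (auto intro!: exI[of _ 1])
  then show ?thesis by simp
qed

end

section \<open>Approximation of events, joint measurability, and a perturbed differential inequality\<close>

text \<open>
  The events that can be approximated by events of the increasing sequence form a \<open>\<sigma>\<close>-algebra.
\<close>

lemma (in prob_space) approx_by_algebra_union:
  fixes F :: "nat \<Rightarrow> 'a measure"
  assumes mono: "\<And>i j. i \<le> j \<Longrightarrow> sets (F i) \<subseteq> sets (F j)"
    and space: "\<And>i. space (F i) = space M" and sub: "\<And>i. sets (F i) \<subseteq> sets M"
    and A: "A \<in> sigma_sets (space M) (\<Union>i. sets (F i))" and e: "0 < e"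
  shows "\<exists>n. \<exists>E\<in>sets (F n). prob ((A - E) \<union> (E - A)) < e"
  using A e
proof (induction arbitrary: e)
  case (Basic a)
  then obtain n where "a \<in> sets (F n)" by auto
  then show ?case using Basic by (intro exI[of _ n] bexI[of _ a]) auto
next
  case Empty
  then show ?case by (intro exI[of _ 0] bexI[of _ "{}"]) auto
next
  case (Compl a)
  then obtain n E where E: "E \<in> sets (F n)" "prob ((a - E) \<union> (E - a)) < e" by blast
  have "a \<subseteq> space M"
    using Compl.hyps sigma_sets_into_sp[of "\<Union>i. sets (F i)" "space M" a] sets.sets_into_space space by blast
  moreover have "E \<subseteq> space M" using E sets.sets_into_space space by blast
  ultimately have "((space M - a) - (space M - E)) \<union> ((space M - E) - (space M - a)) = (a - E) \<union> (E - a)" by auto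
  moreover have "space M - E \<in> sets (F n)" using E(1) space[of n] sets.compl_sets by metis
  ultimately show ?case using E(2) by metis
next
  case (Union a)
  have aM: "a i \<in> sets M" for i
  proof -
    have "sigma_sets (space M) (\<Union>i. sets (F i)) \<subseteq> sets M"
      using sub by (intro sets.sigma_sets_subset) auto
    then show ?thesis using Union.hyps by auto
  qed
  have "(\<lambda>k. prob (\<Union>i. a i) - prob (\<Union>i<k. a i)) \<longlonglongrightarrow> prob (\<Union>i. a i) - prob (\<Union>k. \<Union>i<k. a i)"
    using aM by (intro tendsto_diff tendsto_const finite_Lim_measure_incseq)
      (auto simp: incseq_def intro: less_le_trans)
  also have "(\<Union>k. \<Union>i<k. a i) = (\<Union>i. a i)" by auto
  finally have "eventually (\<lambda>k. prob (\<Union>i. a i) - prob (\<Union>i<k. a i) < e / 2) sequentially"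
    using Union.prems by (intro order_tendstoD(2)[where a="e / 2"]) auto
  then obtain k where k: "prob (\<Union>i. a i) - prob (\<Union>i<k. a i) < e / 2"
    by (auto simp: eventually_sequentially)
  have e': "0 < e / (2 * real (Suc k))" using Union.prems by simp
  have "\<exists>n E. E \<in> sets (F n) \<and> prob ((a i - E) \<union> (E - a i)) < e / (2 * real (Suc k))" for i
    using Union.IH[OF e', of i] by blast
  then obtain n E where E: "\<And>i. E i \<in> sets (F (n i))"
    "\<And>i. prob ((a i - E i) \<union> (E i - a i)) < e / (2 * real (Suc k))" by metis
  define N where "N = Max (insert 0 (n ` {..<k}))"
  define U where "U = (\<Union>i<k. E i)"
  have "E i \<in> sets (F N)" if "i < k" for i
  proof -
    have "n i \<le> N" unfolding N_def using that by (intro Max_ge) auto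
    then show ?thesis using mono E(1) by blast
  qed
  then have U: "U \<in> sets (F N)" unfolding U_def by auto
  have EM: "E i \<in> sets M" for i using E(1) sub by blast
  have UM: "U \<in> sets M" using U sub by blast
  have diff: "prob ((\<Union>i. a i) - (\<Union>i<k. a i)) = prob (\<Union>i. a i) - prob (\<Union>i<k. a i)"
    using aM by (intro finite_measure_Diff) auto
  have "prob (((\<Union>i. a i) - U) \<union> (U - (\<Union>i. a i))) \<le>
     prob (((\<Union>i. a i) - (\<Union>i<k. a i)) \<union> (\<Union>i<k. (a i - E i) \<union> (E i - a i)))"
    using aM EM by (intro finite_measure_mono) (auto simp: U_def)
  also have "\<dots> \<le> prob ((\<Union>i. a i) - (\<Union>i<k. a i)) + prob (\<Union>i<k. (a i - E i) \<union> (E i - a i))"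
    using aM EM by (intro measure_Un_le) auto
  also have "\<dots> \<le> prob ((\<Union>i. a i) - (\<Union>i<k. a i)) + (\<Sum>i<k. prob ((a i - E i) \<union> (E i - a i)))"
    using aM EM by (intro add_left_mono measure_UNION_le) auto
  also have "\<dots> \<le> prob ((\<Union>i. a i) - (\<Union>i<k. a i)) + (\<Sum>i<k. e / (2 * real (Suc k)))"
    using E(2) by (intro add_left_mono sum_mono) (auto intro: less_imp_le)
  also have "\<dots> < e / 2 + e / 2"
  proof (rule add_less_le_mono)
    show "prob ((\<Union>i. a i) - (\<Union>i<k. a i)) < e / 2" using k diff by simp
    show "(\<Sum>i<k. e / (2 * real (Suc k))) \<le> e / 2" using Union.prems by (simp add: field_simps)
  qed
  finally show ?case using U by auto
qed

text \<open>
  A continuous process is the limit of its discretizations at the times \<open>\<lfloor>t k\<rfloor> / k\<close>, each of which is a countable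
  combination of measurable pieces.
\<close>

lemma borel_measurable_continuous_process:
  fixes X :: "real \<Rightarrow> 'a \<Rightarrow> real"
  assumes X: "\<And>t. X t \<in> borel_measurable M"
    and cont: "\<And>\<omega>. \<omega> \<in> space M \<Longrightarrow> continuous_on UNIV (\<lambda>t. X t \<omega>)"
  shows "(\<lambda>(\<omega>, t). X t \<omega>) \<in> borel_measurable (M \<Otimes>\<^sub>M borel)"
proof (rule borel_measurable_LIMSEQ_real)
  let ?u = "\<lambda>k (z :: 'a \<times> real). X (of_int \<lfloor>snd z * real (Suc k)\<rfloor> / real (Suc k)) (fst z)"
  show "?u k \<in> borel_measurable (M \<Otimes>\<^sub>M borel)" for k
    by (rule measurable_compose_countable[where f="\<lambda>i z. X (of_int i / real (Suc k)) (fst z)"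
          and g="\<lambda>z. \<lfloor>snd z * real (Suc k)\<rfloor>"])
       (auto intro!: measurable_compose[OF measurable_fst] X)
  show "(\<lambda>k. ?u k z) \<longlonglongrightarrow> (case z of (\<omega>, t) \<Rightarrow> X t \<omega>)" if z: "z \<in> space (M \<Otimes>\<^sub>M borel)" for z
  proof -
    obtain \<omega> t where zt: "z = (\<omega>, t)" "\<omega> \<in> space M" using z by (auto simp: space_pair_measure)
    have "(\<lambda>k. of_int \<lfloor>t * real (Suc k)\<rfloor> / real (Suc k)) \<longlonglongrightarrow> t"
    proof (rule tendsto_sandwich)
      show "eventually (\<lambda>k. t - 1 / real (Suc k) \<le> of_int \<lfloor>t * real (Suc k)\<rfloor> / real (Suc k)) sequentially"
      proof (intro always_eventually allI)
        fix k
        have "t * real (Suc k) - 1 \<le> of_int \<lfloor>t * real (Suc k)\<rfloor>" by linarith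
        then have "(t * real (Suc k) - 1) / real (Suc k) \<le> of_int \<lfloor>t * real (Suc k)\<rfloor> / real (Suc k)"
          by (intro divide_right_mono) auto
        then show "t - 1 / real (Suc k) \<le> of_int \<lfloor>t * real (Suc k)\<rfloor> / real (Suc k)"
          by (simp add: diff_divide_distrib del: of_nat_Suc)
      qed
      show "eventually (\<lambda>k. of_int \<lfloor>t * real (Suc k)\<rfloor> / real (Suc k) \<le> t) sequentially"
        by (intro always_eventually allI) (simp add: divide_le_eq del: of_nat_Suc)
      have "(\<lambda>k. t - 1 / real (Suc k)) \<longlonglongrightarrow> t - 0"
        by (intro tendsto_diff tendsto_const LIMSEQ_Suc lim_1_over_n)
      then show "(\<lambda>k. t - 1 / real (Suc k)) \<longlonglongrightarrow> t" by simp
    qed simp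
    then have "(\<lambda>k. X (of_int \<lfloor>t * real (Suc k)\<rfloor> / real (Suc k)) \<omega>) \<longlonglongrightarrow> X t \<omega>"
      using continuous_on_tendsto_compose[OF cont[OF zt(2)]] by auto
    then show ?thesis by (simp add: zt)
  qed
qed

text \<open>
  Here \<open>X\<close> solves \<open>dX = g dt + dm\<close> with a merely continuous perturbation \<open>m\<close>. For fixed \<open>t\<close> the path
  \<open>y s = X s + (m t - m s)\<close> is differentiable with derivative \<open>g\<close> and ends at \<open>X t\<close>. The drift condition bounds the
  derivative of \<open>s powr \<kappa> * y s\<close> from below by two error terms, whose integrals are compensated in the monotone
  function \<open>\<Psi>\<close>.
\<close>

lemma perturbed_ode_lower_bound:
  fixes X m g :: "real \<Rightarrow> real"
  assumes n: "1 \<le> n" "n \<le> t" and \<kappa>: "\<beta> < \<kappa>" "0 < \<kappa>"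
    and X: "continuous_on UNIV X" and g: "continuous_on UNIV g"
    and m: "\<And>s. 1 \<le> s \<Longrightarrow> m s = X s - X 1 - integral {1..s} g"
    and drift: "\<And>s. n \<le> s \<Longrightarrow> s \<le> t \<Longrightarrow> \<kappa> * (- X s - s powr (- \<beta>)) / s \<le> g s"
  shows "n powr \<kappa> * (X n + (m t - m n)) - integral {n..t} (\<lambda>s. \<kappa> * s powr (\<kappa> - 1) * \<bar>m t - m s\<bar>)
      - \<kappa> / (\<kappa> - \<beta>) * t powr (\<kappa> - \<beta>) \<le> t powr \<kappa> * X t"
proof -
  define w where "w s = \<kappa> * s powr (\<kappa> - 1) * \<bar>m t - m s\<bar>" for s
  define y where "y s = X 1 + integral {1..s} g + m t" for s
  \<comment> \<open>The drift error \<open>s powr -\<beta>\<close> and the noise error \<open>w\<close> enter through their primitives, so \<open>\<Psi>\<close> is nondecreasing.\<close>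
  define \<Psi> where "\<Psi> s = s powr \<kappa> * y s + integral {n..s} w + \<kappa> / (\<kappa> - \<beta>) * s powr (\<kappa> - \<beta>)" for s
  have gc: "continuous_on {a..b} g" for a b using g continuous_on_subset by blast
  have Gc: "continuous_on {1..t} (\<lambda>s. integral {1..s} g)"
    by (rule indefinite_integral_continuous_1) (intro integrable_continuous_interval gc)
  have "continuous_on {1..t} (\<lambda>s. X s - X 1 - integral {1..s} g)"
    by (intro continuous_intros Gc continuous_on_subset[OF X]) auto
  then have "continuous_on {1..t} m"
    by (rule continuous_on_eq) (simp add: m)
  then have mc: "continuous_on {n..t} m" by (rule continuous_on_subset) (use n in auto)
  have wc: "continuous_on {n..t} w"
    unfolding w_def[abs_def] using n by (intro continuous_intros mc) auto
  have yc: "continuous_on {n..t} y"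
    unfolding y_def[abs_def] by (intro continuous_intros continuous_on_subset[OF Gc]) (use n in auto)
  have Wc: "continuous_on {n..t} (\<lambda>s. integral {n..s} w)"
    by (rule indefinite_integral_continuous_1) (intro integrable_continuous_interval wc)
  have y_eq: "y s = X s + (m t - m s)" if "1 \<le> s" for s
    using m[OF that] by (simp add: y_def)
  have "\<Psi> n \<le> \<Psi> t"
  proof (rule DERIV_nonneg_imp_increasing_open[OF n(2)])
    show "continuous_on {n..t} \<Psi>"
      unfolding \<Psi>_def[abs_def] using n by (intro continuous_intros yc Wc) auto
    fix s assume s: "n < s" "s < t"
    have s1: "1 < s" "0 < s" using s n by auto
    have "((\<lambda>s. integral {1..s} g) has_real_derivative g s) (at s within {1..t})"
      using s1 s by (intro integral_has_real_derivative gc) auto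
    then have dG: "((\<lambda>s. integral {1..s} g) has_real_derivative g s) (at s)"
      using s1 s by (subst (asm) at_within_interior) auto
    then have "((\<lambda>s. X 1 + integral {1..s} g + m t) has_real_derivative 0 + g s + 0) (at s)"
      by (intro DERIV_add DERIV_const)
    then have dy: "(y has_real_derivative g s) (at s)"
      by (simp add: y_def[abs_def])
    have "((\<lambda>s. integral {n..s} w) has_real_derivative w s) (at s within {n..t})"
      using s by (intro integral_has_real_derivative wc) auto
    then have dW: "((\<lambda>s. integral {n..s} w) has_real_derivative w s) (at s)"
      using s by (subst (asm) at_within_interior) auto
    have dp: "((\<lambda>s. s powr a) has_real_derivative a * s powr (a - 1)) (at s)" for a
      by (rule has_real_derivative_powr[OF s1(2)])
    have d\<Psi>: "(\<Psi> has_real_derivative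
        (\<kappa> * s powr (\<kappa> - 1) * y s + g s * s powr \<kappa> + w s + \<kappa> / (\<kappa> - \<beta>) * ((\<kappa> - \<beta>) * s powr (\<kappa> - \<beta> - 1)))) (at s)"
      unfolding \<Psi>_def[abs_def]
      by (rule DERIV_add[OF DERIV_add[OF DERIV_mult[OF dp dy] dW] DERIV_cmult[OF dp]])
    have pw: "s powr \<kappa> = s powr (\<kappa> - 1) * s" "s powr (\<kappa> - \<beta> - 1) = s powr (\<kappa> - 1) * s powr (- \<beta>)"
    proof -
      have "s powr \<kappa> = s powr ((\<kappa> - 1) + 1)" by simp
      also have "\<dots> = s powr (\<kappa> - 1) * s" using s1 by (simp only: powr_add powr_one)
      finally show "s powr \<kappa> = s powr (\<kappa> - 1) * s" .
      show "s powr (\<kappa> - \<beta> - 1) = s powr (\<kappa> - 1) * s powr (- \<beta>)"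
        unfolding powr_add[symmetric] by (rule arg_cong) simp
    qed
    have "s powr (\<kappa> - 1) * (\<kappa> * (- X s - s powr (- \<beta>))) \<le> s powr (\<kappa> - 1) * (s * g s)"
    proof (rule mult_left_mono)
      show "\<kappa> * (- X s - s powr (- \<beta>)) \<le> s * g s"
        using drift[of s] s s1 by (simp only: pos_divide_le_eq mult.commute[of s])
    qed simp
    then have 1: "s powr (\<kappa> - 1) * (\<kappa> * (- X s - s powr (- \<beta>))) \<le> s powr \<kappa> * g s"
      by (simp only: pw(1) mult.assoc)
    have 2: "- (\<kappa> * s powr (\<kappa> - 1) * (m t - m s)) \<le> w s"
    proof -
      have "\<kappa> * s powr (\<kappa> - 1) * (- (m t - m s)) \<le> \<kappa> * s powr (\<kappa> - 1) * \<bar>m t - m s\<bar>"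
        using \<kappa> by (intro mult_left_mono) auto
      then show ?thesis by (simp only: w_def mult_minus_right)
    qed
    have 3: "\<kappa> / (\<kappa> - \<beta>) * ((\<kappa> - \<beta>) * s powr (\<kappa> - \<beta> - 1)) = \<kappa> * (s powr (\<kappa> - 1) * s powr (- \<beta>))"
      using \<kappa> by (simp add: pw(2))
    have 4: "\<kappa> * s powr (\<kappa> - 1) * y s = \<kappa> * s powr (\<kappa> - 1) * X s + \<kappa> * s powr (\<kappa> - 1) * (m t - m s)"
      using y_eq[of s] s1 by (simp add: distrib_left)
    have 5: "s powr (\<kappa> - 1) * (\<kappa> * (- X s - s powr (- \<beta>))) =
        - (\<kappa> * s powr (\<kappa> - 1) * X s) - \<kappa> * (s powr (\<kappa> - 1) * s powr (- \<beta>))"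
      by (simp add: right_diff_distrib mult.left_commute mult.assoc)
    have "0 \<le> \<kappa> * s powr (\<kappa> - 1) * y s + g s * s powr \<kappa> + w s + \<kappa> / (\<kappa> - \<beta>) * ((\<kappa> - \<beta>) * s powr (\<kappa> - \<beta> - 1))"
      using 1 2 unfolding 3 4 5 by (simp only: mult.commute[of "g s"])
    with d\<Psi> show "\<exists>z. (\<Psi> has_real_derivative z) (at s) \<and> 0 \<le> z" by blast
  qed
  moreover have "n powr \<kappa> * (X n + (m t - m n)) \<le> \<Psi> n"
    using y_eq[of n] n \<kappa> by (simp add: \<Psi>_def)
  moreover have "\<Psi> t = t powr \<kappa> * X t + integral {n..t} w + \<kappa> / (\<kappa> - \<beta>) * t powr (\<kappa> - \<beta>)"
    using y_eq[of t] n by (simp add: \<Psi>_def)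
  ultimately show ?thesis by (simp add: w_def[abs_def])
qed

section \<open>Power-law noise and trajectories far below the origin\<close>

lemma power_law_lipschitz:
  fixes \<gamma> x y :: real
  assumes \<gamma>: "0 \<le> \<gamma>" "\<gamma> \<le> 1" and x: "1 \<le> x" and y: "1 \<le> y"
  shows "\<bar>1 / x powr \<gamma> - 1 / y powr \<gamma>\<bar> \<le> \<bar>x - y\<bar>"
proof -
  have *: "\<bar>1 / x powr \<gamma> - 1 / y powr \<gamma>\<bar> \<le> y - x" if xy: "1 \<le> x" "x < y" for x y :: real
  proof -
    have "\<exists>z>x. z < y \<and> y powr (- \<gamma>) - x powr (- \<gamma>) = (y - x) * (- \<gamma> * z powr (- \<gamma> - 1))"
      using xy by (intro MVT2 has_real_derivative_powr) auto
    then obtain z where z: "x < z" "y powr (- \<gamma>) - x powr (- \<gamma>) = (y - x) * (- \<gamma> * z powr (- \<gamma> - 1))" by blast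
    have "z powr (- \<gamma> - 1) \<le> 1" using powr_mono[of "- \<gamma> - 1" 0 z] z xy \<gamma> by simp
    then have "\<gamma> * z powr (- \<gamma> - 1) \<le> 1 * 1" using \<gamma> by (intro mult_mono) auto
    then have "(y - x) * (\<gamma> * z powr (- \<gamma> - 1)) \<le> (y - x) * 1" using xy by (intro mult_left_mono) auto
    moreover have "0 \<le> (y - x) * (\<gamma> * z powr (- \<gamma> - 1))" using xy \<gamma> by simp
    ultimately show ?thesis using z(2) by (simp add: powr_minus_divide[symmetric] abs_le_iff)
  qed
  show ?thesis
    using *[of x y] *[of y x] x y by (cases x y rule: linorder_cases) (auto simp: abs_minus_commute)
qed

lemma power_law_tail_variance:
  fixes \<gamma> x y :: real
  assumes \<gamma>: "1/2 < \<gamma>" and xy: "1 \<le> x" "x \<le> y"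
  defines "G \<equiv> \<lambda>s::real. s powr (1 - 2 * \<gamma>) / (2 * \<gamma> - 1)"
  shows "(1 / y powr \<gamma>)\<^sup>2 * (y - x) \<le> G x - G y" "G x - G y \<le> (1 / x powr \<gamma>)\<^sup>2 * (y - x)"
proof -
  have sq: "(1 / s powr \<gamma>)\<^sup>2 = s powr (- 2 * \<gamma>)" if "1 \<le> s" for s
    using that by (simp add: powr_minus_divide[symmetric] powr_power)
  have "(1 / y powr \<gamma>)\<^sup>2 * (y - x) \<le> G x - G y \<and> G x - G y \<le> (1 / x powr \<gamma>)\<^sup>2 * (y - x)"
  proof (cases "x = y")
    case True then show ?thesis by simp
  next
    case False
    with xy have lt: "x < y" by simp
    have "\<exists>z>x. z < y \<and> G y - G x = (y - x) * (- (z powr (- 2 * \<gamma>)))"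
    proof (rule MVT2[OF lt])
      fix z assume "x \<le> z" "z \<le> y"
      then have "0 < z" using xy by simp
      have "(G has_real_derivative ((1 - 2 * \<gamma>) * z powr (1 - 2 * \<gamma> - 1)) / (2 * \<gamma> - 1)) (at z)"
        unfolding G_def by (intro DERIV_cdivide has_real_derivative_powr \<open>0 < z\<close>)
      moreover have "((1 - 2 * \<gamma>) * z powr (1 - 2 * \<gamma> - 1)) / (2 * \<gamma> - 1) = - (z powr (- 2 * \<gamma>))"
        using \<gamma> by (simp add: field_simps)
      ultimately show "(G has_real_derivative - (z powr (- 2 * \<gamma>))) (at z)" by simp
    qed
    then obtain z where z: "x < z" "z < y" "G y - G x = (y - x) * (- (z powr (- 2 * \<gamma>)))" by blast
    have "y powr (- 2 * \<gamma>) \<le> z powr (- 2 * \<gamma>)" "z powr (- 2 * \<gamma>) \<le> x powr (- 2 * \<gamma>)"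
      using z xy \<gamma> by (auto intro!: powr_mono2')
    then have "(y - x) * y powr (- 2 * \<gamma>) \<le> (y - x) * z powr (- 2 * \<gamma>)"
      "(y - x) * z powr (- 2 * \<gamma>) \<le> (y - x) * x powr (- 2 * \<gamma>)"
      using lt by (auto intro!: mult_left_mono)
    then show ?thesis using z(3) sq[of x] sq[of y] xy by (simp add: mult.commute)
  qed
  then show "(1 / y powr \<gamma>)\<^sup>2 * (y - x) \<le> G x - G y" "G x - G y \<le> (1 / x powr \<gamma>)\<^sup>2 * (y - x)" by auto
qed

text \<open>
  \<open>X\<close> is a version of \<open>L\<close> all of whose paths are continuous, with times before \<open>1\<close> filled in. It is not adapted,
  as it may differ from \<open>L\<close> on a null set outside the filtration; it serves for pathwise arguments and
  joint measurability, while \<open>L\<close> serves for independence. The drift condition is the common consequence of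
  the two growth hypotheses on \<open>f\<close>.
\<close>

locale unstable_solution =
  wiener_integral M F B "\<lambda>s. 1 / s powr \<gamma>" "\<lambda>s. s powr (1 - 2 * \<gamma>) / (2 * \<gamma> - 1)" I
  for M :: "'a measure" and F :: "real \<Rightarrow> 'a measure" and B :: "real \<Rightarrow> 'a \<Rightarrow> real"
    and \<gamma> :: real and I :: "real \<Rightarrow> 'a \<Rightarrow> real" +
  fixes \<beta> \<kappa> \<eta> :: real and f :: "real \<Rightarrow> real" and L X :: "real \<Rightarrow> 'a \<Rightarrow> real"
  assumes \<beta>_def: "\<beta> = \<gamma> - 1/2" and \<beta>_pos: "0 < \<beta>" and \<kappa>: "\<beta> < \<kappa>"
    and \<eta>: "0 \<le> \<eta>"
    and f_continuous: "continuous_on UNIV f"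
    and f_nonneg: "\<And>x. \<bar>x\<bar> \<le> \<eta> \<Longrightarrow> 0 \<le> f x"
    and drift: "\<And>x s. \<bar>x\<bar> \<le> \<eta> \<Longrightarrow> 1 \<le> s \<Longrightarrow> \<kappa> * (- x - s powr (- \<beta>)) / s \<le> f x / s powr \<gamma>"
    and L_adapted: "\<And>t. 1 \<le> t \<Longrightarrow> L t \<in> borel_measurable (F t)"
    and X_measurable: "\<And>t. X t \<in> borel_measurable M"
    and X_continuous: "\<And>\<omega>. \<omega> \<in> space M \<Longrightarrow> continuous_on UNIV (\<lambda>t. X t \<omega>)"
    and X_eq_L: "AE \<omega> in M. \<forall>t\<ge>1. X t \<omega> = L t \<omega>"
    and solution: "\<And>t. 1 \<le> t \<Longrightarrow>
      AE \<omega> in M. X t \<omega> - X 1 \<omega> - (LINT s:{1..t}|lborel. f (X s \<omega>) / max 1 s powr \<gamma>) = I t \<omega>"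
begin

definition noise :: "real \<Rightarrow> 'a \<Rightarrow> real" where
  "noise t \<omega> = X t \<omega> - X 1 \<omega> - (LINT s:{1..t}|lborel. f (X s \<omega>) / max 1 s powr \<gamma>)"

text \<open>
  The error terms of \<open>perturbed_ode_lower_bound\<close>, apart from the constant one.
\<close>

definition fluctuation :: "real \<Rightarrow> real \<Rightarrow> 'a \<Rightarrow> ennreal" where
  "fluctuation n t \<omega> = ennreal (n powr \<kappa> * \<bar>noise t \<omega> - noise n \<omega>\<bar>) +
    (\<integral>\<^sup>+s\<in>{n..t}. ennreal (\<kappa> * s powr (\<kappa> - 1) * \<bar>noise t \<omega> - noise s \<omega>\<bar>) \<partial>lborel)"

lemma \<kappa>_pos: "0 < \<kappa>" using \<kappa> \<beta>_pos by simp

lemma X_joint_measurable: "(\<lambda>(\<omega>, t). X t \<omega>) \<in> borel_measurable (M \<Otimes>\<^sub>M borel)"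
  by (rule borel_measurable_continuous_process[OF X_measurable X_continuous])

lemma f_measurable[measurable]: "f \<in> borel_measurable borel"
  using f_continuous by (rule borel_measurable_continuous_onI)

lemma noise_joint_measurable: "(\<lambda>(\<omega>, t). noise t \<omega>) \<in> borel_measurable (M \<Otimes>\<^sub>M borel)"
proof -
  have [measurable]: "(\<lambda>z. X (snd z) (fst (fst z))) \<in> borel_measurable ((M \<Otimes>\<^sub>M borel) \<Otimes>\<^sub>M lborel)"
    using measurable_compose[OF _ X_joint_measurable, of "\<lambda>z. (fst (fst z), snd z)" "(M \<Otimes>\<^sub>M borel) \<Otimes>\<^sub>M lborel"]
    by simp
  have "(\<lambda>x. \<integral>s. (if 1 \<le> s \<and> s \<le> snd x then f (X s (fst x)) / max 1 s powr \<gamma> else 0) \<partial>lborel) \<in> borel_measurable (M \<Otimes>\<^sub>M borel)"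
    by (rule lborel.borel_measurable_lebesgue_integral) measurable
  moreover have "(LINT s:{1..t}|lborel. f (X s \<omega>) / max 1 s powr \<gamma>) =
      (\<integral>s. (if 1 \<le> s \<and> s \<le> t then f (X s \<omega>) / max 1 s powr \<gamma> else 0) \<partial>lborel)" for t \<omega>
    unfolding set_lebesgue_integral_def by (intro Bochner_Integration.integral_cong) (auto simp: indicator_def)
  ultimately show ?thesis
    using X_joint_measurable X_measurable unfolding noise_def[abs_def] by (simp add: case_prod_beta)
qed

lemma noise_measurable[measurable]: "noise t \<in> borel_measurable M"
  using measurable_compose[OF _ noise_joint_measurable, of "\<lambda>\<omega>. (\<omega>, t)" M] by simp

lemma fluctuation_integrand_measurable:
  "(\<lambda>(\<omega>, s). ennreal (\<kappa> * s powr (\<kappa> - 1) * \<bar>noise t \<omega> - noise s \<omega>\<bar>) * indicator {n..t} s)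
    \<in> borel_measurable (M \<Otimes>\<^sub>M lborel)"
proof -
  have [measurable]: "(\<lambda>z. noise (snd z) (fst z)) \<in> borel_measurable (M \<Otimes>\<^sub>M lborel)"
    using noise_joint_measurable by (simp add: case_prod_beta)
  show ?thesis by (simp add: case_prod_beta)
qed

lemma fluctuation_measurable[measurable]: "fluctuation n t \<in> borel_measurable M"
  unfolding fluctuation_def[abs_def]
  by (intro borel_measurable_add lborel.borel_measurable_nn_integral fluctuation_integrand_measurable) measurable

lemma drift_continuous:
  "\<omega> \<in> space M \<Longrightarrow> continuous_on UNIV (\<lambda>s. f (X s \<omega>) / max 1 s powr \<gamma>)"
  using X_continuous[of \<omega>]
  by (intro continuous_intros continuous_on_compose2[OF f_continuous]) (auto simp: max_def)

lemma noise_eq: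
  assumes "\<omega> \<in> space M"
  shows "noise t \<omega> = X t \<omega> - X 1 \<omega> - integral {1..t} (\<lambda>s. f (X s \<omega>) / max 1 s powr \<gamma>)"
proof -
  have "set_integrable lborel {1..t} (\<lambda>s. f (X s \<omega>) / max 1 s powr \<gamma>)"
    by (intro borel_integrable_atLeastAtMost' continuous_on_subset[OF drift_continuous[OF assms]]) auto
  then show ?thesis by (simp add: noise_def set_borel_integral_eq_integral(2))
qed

lemma noise_eq_I: "1 \<le> t \<Longrightarrow> AE \<omega> in M. noise t \<omega> = I t \<omega>"
  unfolding noise_def by (rule solution)

lemma tail_variance_eq: "1 \<le> s \<Longrightarrow> s powr (1 - 2 * \<gamma>) / (2 * \<gamma> - 1) = (s powr (- \<beta>))\<^sup>2 / (2 * \<beta>)"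
proof -
  have "(s powr (- \<beta>))\<^sup>2 = s powr (1 - 2 * \<gamma>)"
    unfolding power2_eq_square powr_add[symmetric] by (rule arg_cong) (simp add: \<beta>_def)
  moreover have "2 * \<gamma> - 1 = 2 * \<beta>" by (simp add: \<beta>_def)
  ultimately show ?thesis by simp
qed

lemma noise_first_moment:
  assumes st: "1 \<le> s" "s \<le> t"
  shows "(\<integral>\<^sup>+\<omega>. ennreal \<bar>noise t \<omega> - noise s \<omega>\<bar> \<partial>M) \<le> ennreal (s powr (- \<beta>) / sqrt \<beta>)"
proof -
  have "AE \<omega> in M. noise t \<omega> - noise s \<omega> = I t \<omega> - I s \<omega>"
    using noise_eq_I[of t] noise_eq_I[of s] st by auto
  then have "(\<integral>\<^sup>+\<omega>. ennreal \<bar>noise t \<omega> - noise s \<omega>\<bar> \<partial>M) = (\<integral>\<^sup>+\<omega>. ennreal \<bar>I t \<omega> - I s \<omega>\<bar> \<partial>M)"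
    by (intro nn_integral_cong_AE) auto
  also have "\<dots> \<le> ennreal (sqrt (2 * (s powr (1 - 2 * \<gamma>) / (2 * \<gamma> - 1))))"
    by (rule ito_increment_first_moment[OF st])
  also have "2 * (s powr (1 - 2 * \<gamma>) / (2 * \<gamma> - 1)) = (s powr (- \<beta>))\<^sup>2 / \<beta>"
    using tail_variance_eq[OF st(1)] by simp
  also have "sqrt ((s powr (- \<beta>))\<^sup>2 / \<beta>) = s powr (- \<beta>) / sqrt \<beta>"
    by (simp add: real_sqrt_divide)
  finally show ?thesis .
qed

text \<open>
  A noise increment after time \<open>s\<close> has size \<open>s powr -\<beta>\<close>, and \<open>s powr (\<kappa> - 1 - \<beta>)\<close> integrates to a multiple of
  \<open>t powr (\<kappa> - \<beta>)\<close> since \<open>\<kappa> > \<beta>\<close>.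
\<close>

lemma fluctuation_expectation:
  assumes n: "1 \<le> n" "n \<le> t"
  shows "(\<integral>\<^sup>+\<omega>. fluctuation n t \<omega> \<partial>M) \<le> ennreal ((n powr \<kappa> + \<kappa> / (\<kappa> - \<beta>)) / sqrt \<beta> * t powr (\<kappa> - \<beta>))"
proof -
  interpret P: pair_sigma_finite M lborel by standard
  let ?c = "1 / sqrt \<beta>"
  have c: "0 < ?c" using \<beta>_pos by simp
  have "(\<integral>\<^sup>+\<omega>. ennreal (n powr \<kappa> * \<bar>noise t \<omega> - noise n \<omega>\<bar>) \<partial>M) =
      ennreal (n powr \<kappa>) * (\<integral>\<^sup>+\<omega>. ennreal \<bar>noise t \<omega> - noise n \<omega>\<bar> \<partial>M)"
    by (subst nn_integral_cmult[symmetric]) (auto simp: ennreal_mult)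
  also have "\<dots> \<le> ennreal (n powr \<kappa>) * ennreal (n powr (- \<beta>) / sqrt \<beta>)"
    by (intro mult_left_mono noise_first_moment n) simp
  also have "\<dots> = ennreal (n powr \<kappa> * (n powr (- \<beta>) / sqrt \<beta>))"
    using \<beta>_pos by (intro ennreal_mult[symmetric]) auto
  also have "\<dots> \<le> ennreal (n powr \<kappa> * ?c * t powr (\<kappa> - \<beta>))"
  proof (rule ennreal_leI)
    have "n powr (- \<beta>) \<le> 1" using powr_mono[of "- \<beta>" 0 n] n \<beta>_pos by simp
    moreover have "1 \<le> t powr (\<kappa> - \<beta>)" using n \<kappa> by (intro ge_one_powr_ge_zero) auto
    ultimately have "n powr (- \<beta>) * ?c \<le> ?c * t powr (\<kappa> - \<beta>)"
      using c by (smt (verit, best) mult.commute mult_left_mono)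
    then have "n powr \<kappa> * (n powr (- \<beta>) * ?c) \<le> n powr \<kappa> * (?c * t powr (\<kappa> - \<beta>))"
      by (intro mult_left_mono) auto
    then show "n powr \<kappa> * (n powr (- \<beta>) / sqrt \<beta>) \<le> n powr \<kappa> * ?c * t powr (\<kappa> - \<beta>)" by simp
  qed
  finally have 1: "(\<integral>\<^sup>+\<omega>. ennreal (n powr \<kappa> * \<bar>noise t \<omega> - noise n \<omega>\<bar>) \<partial>M) \<le> ennreal (n powr \<kappa> * ?c * t powr (\<kappa> - \<beta>))" .
  have "(\<integral>\<^sup>+\<omega>. (\<integral>\<^sup>+s\<in>{n..t}. ennreal (\<kappa> * s powr (\<kappa> - 1) * \<bar>noise t \<omega> - noise s \<omega>\<bar>) \<partial>lborel) \<partial>M) =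
    (\<integral>\<^sup>+s. (\<integral>\<^sup>+\<omega>. ennreal (\<kappa> * s powr (\<kappa> - 1) * \<bar>noise t \<omega> - noise s \<omega>\<bar>) * indicator {n..t} s \<partial>M) \<partial>lborel)"
    by (rule P.Fubini'[OF fluctuation_integrand_measurable, symmetric])
  also have "\<dots> \<le> (\<integral>\<^sup>+s\<in>{n..t}. ennreal (\<kappa> * ?c * s powr (\<kappa> - \<beta> - 1)) \<partial>lborel)"
  proof (rule nn_integral_mono)
    fix s
    show "(\<integral>\<^sup>+\<omega>. ennreal (\<kappa> * s powr (\<kappa> - 1) * \<bar>noise t \<omega> - noise s \<omega>\<bar>) * indicator {n..t} s \<partial>M) \<le>
        ennreal (\<kappa> * ?c * s powr (\<kappa> - \<beta> - 1)) * indicator {n..t} s"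
    proof (cases "s \<in> {n..t}")
      case True
      have s: "1 \<le> s" "s \<le> t" using True n by auto
      have "(\<integral>\<^sup>+\<omega>. ennreal (\<kappa> * s powr (\<kappa> - 1) * \<bar>noise t \<omega> - noise s \<omega>\<bar>) \<partial>M) =
         ennreal (\<kappa> * s powr (\<kappa> - 1)) * (\<integral>\<^sup>+\<omega>. ennreal \<bar>noise t \<omega> - noise s \<omega>\<bar> \<partial>M)"
        using \<kappa>_pos by (subst nn_integral_cmult[symmetric]) (auto simp: ennreal_mult)
      also have "\<dots> \<le> ennreal (\<kappa> * s powr (\<kappa> - 1)) * ennreal (s powr (- \<beta>) / sqrt \<beta>)"
        by (intro mult_left_mono noise_first_moment s) simp
      also have "\<dots> = ennreal (\<kappa> * s powr (\<kappa> - 1) * (s powr (- \<beta>) / sqrt \<beta>))"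
        using \<beta>_pos \<kappa>_pos by (intro ennreal_mult[symmetric]) auto
      also have "\<kappa> * s powr (\<kappa> - 1) * (s powr (- \<beta>) / sqrt \<beta>) = \<kappa> * ?c * s powr (\<kappa> - \<beta> - 1)"
      proof -
        have "s powr (\<kappa> - \<beta> - 1) = s powr (\<kappa> - 1) * s powr (- \<beta>)"
          unfolding powr_add[symmetric] by (rule arg_cong) simp
        then show ?thesis by simp
      qed
      finally show ?thesis using True by simp
    qed simp
  qed
  also have "\<dots> = ennreal (\<kappa> * ?c / (\<kappa> - \<beta>) * t powr (\<kappa> - \<beta>) - \<kappa> * ?c / (\<kappa> - \<beta>) * n powr (\<kappa> - \<beta>))"
  proof (rule nn_integral_FTC_Icc[where F="\<lambda>s. \<kappa> * ?c / (\<kappa> - \<beta>) * s powr (\<kappa> - \<beta>)"])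
    fix s assume "s \<in> {n..t}"
    then have s: "0 < s" using n by simp
    have "((\<lambda>s. \<kappa> * ?c / (\<kappa> - \<beta>) * s powr (\<kappa> - \<beta>)) has_real_derivative
        \<kappa> * ?c / (\<kappa> - \<beta>) * ((\<kappa> - \<beta>) * s powr (\<kappa> - \<beta> - 1))) (at s)"
      by (intro DERIV_cmult has_real_derivative_powr s)
    moreover have "\<kappa> * ?c / (\<kappa> - \<beta>) * ((\<kappa> - \<beta>) * s powr (\<kappa> - \<beta> - 1)) = \<kappa> * ?c * s powr (\<kappa> - \<beta> - 1)"
      using \<kappa> by simp
    ultimately show "((\<lambda>s. \<kappa> * ?c / (\<kappa> - \<beta>) * s powr (\<kappa> - \<beta>)) has_real_derivative
        \<kappa> * ?c * s powr (\<kappa> - \<beta> - 1)) (at s)" by (simp only:)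
  next
    show "0 \<le> \<kappa> * ?c * s powr (\<kappa> - \<beta> - 1)" for s using \<kappa>_pos c by simp
  qed (use n in auto)
  also have "\<dots> \<le> ennreal (\<kappa> * ?c / (\<kappa> - \<beta>) * t powr (\<kappa> - \<beta>))"
    using \<kappa>_pos c \<kappa> by (intro ennreal_leI) simp
  finally have 2: "(\<integral>\<^sup>+\<omega>. (\<integral>\<^sup>+s\<in>{n..t}. ennreal (\<kappa> * s powr (\<kappa> - 1) * \<bar>noise t \<omega> - noise s \<omega>\<bar>) \<partial>lborel) \<partial>M)
     \<le> ennreal (\<kappa> * ?c / (\<kappa> - \<beta>) * t powr (\<kappa> - \<beta>))" .
  have "(\<integral>\<^sup>+\<omega>. fluctuation n t \<omega> \<partial>M) =
     (\<integral>\<^sup>+\<omega>. ennreal (n powr \<kappa> * \<bar>noise t \<omega> - noise n \<omega>\<bar>) \<partial>M) +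
     (\<integral>\<^sup>+\<omega>. (\<integral>\<^sup>+s\<in>{n..t}. ennreal (\<kappa> * s powr (\<kappa> - 1) * \<bar>noise t \<omega> - noise s \<omega>\<bar>) \<partial>lborel) \<partial>M)"
    unfolding fluctuation_def
    by (rule nn_integral_add) (auto intro!: lborel.borel_measurable_nn_integral fluctuation_integrand_measurable)
  also have "\<dots> \<le> ennreal (n powr \<kappa> * ?c * t powr (\<kappa> - \<beta>)) + ennreal (\<kappa> * ?c / (\<kappa> - \<beta>) * t powr (\<kappa> - \<beta>))"
    by (rule add_mono[OF 1 2])
  also have "\<dots> = ennreal (n powr \<kappa> * ?c * t powr (\<kappa> - \<beta>) + \<kappa> * ?c / (\<kappa> - \<beta>) * t powr (\<kappa> - \<beta>))"
    using \<kappa>_pos c \<kappa> by (intro ennreal_plus[symmetric]) auto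
  also have "n powr \<kappa> * ?c * t powr (\<kappa> - \<beta>) + \<kappa> * ?c / (\<kappa> - \<beta>) * t powr (\<kappa> - \<beta>) =
      (n powr \<kappa> + \<kappa> / (\<kappa> - \<beta>)) / sqrt \<beta> * t powr (\<kappa> - \<beta>)"
    by (simp add: add_divide_distrib distrib_right)
  finally show ?thesis .
qed

lemma fluctuation_tail:
  assumes n: "1 \<le> n" "n \<le> t" and r: "0 < r"
  shows "prob {\<omega> \<in> space M. ennreal (r * t powr (\<kappa> - \<beta>)) < fluctuation n t \<omega>}
    \<le> (n powr \<kappa> + \<kappa> / (\<kappa> - \<beta>)) / sqrt \<beta> / r"
proof -
  let ?C = "(n powr \<kappa> + \<kappa> / (\<kappa> - \<beta>)) / sqrt \<beta>"
  let ?q = "r * t powr (\<kappa> - \<beta>)"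
  have q: "0 < ?q" using r n by simp
  have C: "0 \<le> ?C" using \<kappa>_pos \<kappa> \<beta>_pos by simp
  have "emeasure M {\<omega> \<in> space M. ennreal ?q < fluctuation n t \<omega>} \<le>
      emeasure M {\<omega> \<in> space M. 1 \<le> ennreal (1 / ?q) * fluctuation n t \<omega>}"
  proof (rule emeasure_mono)
    show "{\<omega> \<in> space M. ennreal ?q < fluctuation n t \<omega>} \<subseteq> {\<omega> \<in> space M. 1 \<le> ennreal (1 / ?q) * fluctuation n t \<omega>}"
    proof safe
      fix \<omega> assume "ennreal ?q < fluctuation n t \<omega>"
      then have "ennreal (1 / ?q) * ennreal ?q \<le> ennreal (1 / ?q) * fluctuation n t \<omega>"
        by (intro mult_left_mono) auto
      moreover have "ennreal (1 / ?q) * ennreal ?q = 1"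
        using q by (subst ennreal_mult[symmetric]) auto
      ultimately show "1 \<le> ennreal (1 / ?q) * fluctuation n t \<omega>" by simp
    qed
  qed measurable
  also have "\<dots> \<le> ennreal (1 / ?q) * (\<integral>\<^sup>+\<omega>. fluctuation n t \<omega> * indicator (space M) \<omega> \<partial>M)"
    by (rule nn_integral_Markov_inequality) measurable
  also have "(\<integral>\<^sup>+\<omega>. fluctuation n t \<omega> * indicator (space M) \<omega> \<partial>M) = (\<integral>\<^sup>+\<omega>. fluctuation n t \<omega> \<partial>M)"
    by (intro nn_integral_cong) auto
  also have "ennreal (1 / ?q) * \<dots> \<le> ennreal (1 / ?q) * ennreal (?C * t powr (\<kappa> - \<beta>))"
    by (intro mult_left_mono fluctuation_expectation n) simp
  also have "\<dots> = ennreal (1 / ?q * (?C * t powr (\<kappa> - \<beta>)))"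
    using q C by (intro ennreal_mult[symmetric] mult_nonneg_nonneg[OF C]) auto
  also have "1 / ?q * (?C * t powr (\<kappa> - \<beta>)) = ?C / r"
    using n by simp
  finally show ?thesis
    using divide_nonneg_pos[OF C r] by (simp only: emeasure_eq_measure ennreal_le_iff)
qed

lemma lower_bound_of_fluctuation:
  assumes \<omega>: "\<omega> \<in> space M" and n: "1 \<le> n" "n \<le> t" and r: "0 \<le> r"
    and small: "\<And>s. n \<le> s \<Longrightarrow> s \<le> t \<Longrightarrow> \<bar>X s \<omega>\<bar> \<le> \<eta>"
    and fl: "fluctuation n t \<omega> \<le> ennreal (r * t powr (\<kappa> - \<beta>))"
  shows "- (n powr \<kappa> * \<eta> + r + \<kappa> / (\<kappa> - \<beta>)) * t powr (- \<beta>) \<le> X t \<omega>"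
proof -
  let ?g = "\<lambda>s. f (X s \<omega>) / max 1 s powr \<gamma>"
  let ?m = "\<lambda>s. noise s \<omega>"
  let ?w = "\<lambda>s. \<kappa> * s powr (\<kappa> - 1) * \<bar>?m t - ?m s\<bar>"
  have t: "1 \<le> t" "0 < t" using n by auto
  have lower: "n powr \<kappa> * (X n \<omega> + (?m t - ?m n)) - integral {n..t} ?w - \<kappa> / (\<kappa> - \<beta>) * t powr (\<kappa> - \<beta>)
      \<le> t powr \<kappa> * X t \<omega>"
  proof (rule perturbed_ode_lower_bound[OF n \<kappa> \<kappa>_pos X_continuous[OF \<omega>] drift_continuous[OF \<omega>]])
    show "?m s = X s \<omega> - X 1 \<omega> - integral {1..s} ?g" for s by (rule noise_eq[OF \<omega>])
    show "\<kappa> * (- X s \<omega> - s powr (- \<beta>)) / s \<le> ?g s" if "n \<le> s" "s \<le> t" for s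
      using drift[of "X s \<omega>" s] small[OF that] that n by (simp add: max_def)
  qed
  have mc: "continuous_on {n..t} ?m"
  proof -
    have "continuous_on {1..t} (\<lambda>s. integral {1..s} ?g)"
      by (intro indefinite_integral_continuous_1 integrable_continuous_interval
          continuous_on_subset[OF drift_continuous[OF \<omega>]]) auto
    then have "continuous_on {n..t} (\<lambda>s. integral {1..s} ?g)"
      by (rule continuous_on_subset) (use n in auto)
    then have "continuous_on {n..t} (\<lambda>s. X s \<omega> - X 1 \<omega> - integral {1..s} ?g)"
      by (intro continuous_intros continuous_on_subset[OF X_continuous[OF \<omega>]]) auto
    then show ?thesis by (simp add: noise_eq[OF \<omega>])
  qed
  have wc: "continuous_on {n..t} ?w"
    using n by (intro continuous_intros mc) auto
  have wi: "set_integrable lborel {n..t} ?w" by (rule borel_integrable_atLeastAtMost'[OF wc])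
  have w0: "0 \<le> ?w s" for s using \<kappa>_pos by simp
  have "(\<integral>\<^sup>+s\<in>{n..t}. ennreal (?w s) \<partial>lborel) = (\<integral>\<^sup>+s. ennreal (indicator {n..t} s *\<^sub>R ?w s) \<partial>lborel)"
    by (intro nn_integral_cong) (auto simp: indicator_def)
  also have "\<dots> = ennreal (\<integral>s. indicator {n..t} s *\<^sub>R ?w s \<partial>lborel)"
    using wi w0 unfolding set_integrable_def by (intro nn_integral_eq_integral) (auto simp del: real_scaleR_def intro!: scaleR_nonneg_nonneg)
  also have "(\<integral>s. indicator {n..t} s *\<^sub>R ?w s \<partial>lborel) = integral {n..t} ?w"
    using set_borel_integral_eq_integral(2)[OF wi] by (simp add: set_lebesgue_integral_def)
  finally have W: "(\<integral>\<^sup>+s\<in>{n..t}. ennreal (?w s) \<partial>lborel) = ennreal (integral {n..t} ?w)" .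
  have "0 \<le> integral {n..t} ?w"
    using w0 by (intro Henstock_Kurzweil_Integration.integral_nonneg integrable_continuous_interval wc) auto
  then have "fluctuation n t \<omega> = ennreal (n powr \<kappa> * \<bar>?m t - ?m n\<bar> + integral {n..t} ?w)"
    unfolding fluctuation_def W by (intro ennreal_plus[symmetric]) auto
  then have fl': "n powr \<kappa> * \<bar>?m t - ?m n\<bar> + integral {n..t} ?w \<le> r * t powr (\<kappa> - \<beta>)"
    using fl r by (simp add: ennreal_le_iff)
  have "- (n powr \<kappa> * \<bar>?m t - ?m n\<bar>) \<le> n powr \<kappa> * (?m t - ?m n)"
  proof -
    have "n powr \<kappa> * (- \<bar>?m t - ?m n\<bar>) \<le> n powr \<kappa> * (?m t - ?m n)"
      by (intro mult_left_mono) auto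
    then show ?thesis by (simp only: mult_minus_right)
  qed
  moreover have "- (n powr \<kappa> * \<eta> * t powr (\<kappa> - \<beta>)) \<le> n powr \<kappa> * X n \<omega>"
  proof -
    have "- \<eta> \<le> X n \<omega>" using small[of n] n by auto
    then have 1: "n powr \<kappa> * (- \<eta>) \<le> n powr \<kappa> * X n \<omega>" by (intro mult_left_mono) auto
    have "1 \<le> t powr (\<kappa> - \<beta>)" using t \<kappa> by (intro ge_one_powr_ge_zero) auto
    then have "n powr \<kappa> * \<eta> * 1 \<le> n powr \<kappa> * \<eta> * t powr (\<kappa> - \<beta>)"
      using \<eta> by (intro mult_left_mono) auto
    with 1 show ?thesis by simp
  qed
  ultimately have "- (n powr \<kappa> * \<eta> * t powr (\<kappa> - \<beta>)) - r * t powr (\<kappa> - \<beta>) - \<kappa> / (\<kappa> - \<beta>) * t powr (\<kappa> - \<beta>)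
      \<le> t powr \<kappa> * X t \<omega>"
    using lower fl' by (simp only: distrib_left)
  moreover have "t powr (\<kappa> - \<beta>) = t powr \<kappa> * t powr (- \<beta>)"
    unfolding powr_add[symmetric] by (rule arg_cong) simp
  ultimately have "t powr \<kappa> * (- (n powr \<kappa> * \<eta> + r + \<kappa> / (\<kappa> - \<beta>)) * t powr (- \<beta>)) \<le> t powr \<kappa> * X t \<omega>"
    by (simp add: algebra_simps)
  then show ?thesis using t by (simp only: mult_le_cancel_left_pos powr_gt_zero)
qed

end

section \<open>Confined trajectories have probability zero\<close>

context unstable_solution
begin

text \<open>
  Only countably many conditions on adapted values of \<open>L\<close> occur, so that the event belongs to the \<open>\<sigma>\<close>-algebra
  generated by the filtration. The second condition says that the upper limit along integer times is at most \<open>0\<close>;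
  the truncation at time \<open>1\<close> keeps all times in the range where \<open>L\<close> is adapted.
\<close>

definition confined :: "nat \<Rightarrow> 'a set" where
  "confined n = {\<omega> \<in> space M.
    (\<forall>q::rat. real n \<le> of_rat q \<longrightarrow> \<bar>L (max 1 (of_rat q)) \<omega>\<bar> \<le> \<eta>) \<and>
    (\<forall>k. \<exists>i0. \<forall>i\<ge>i0. L (max 1 (real i)) \<omega> < 1 / real (Suc k))}"

lemma confined_in_sigma: "confined n \<in> sigma_sets (space M) (\<Union>i. sets (F (real i)))"
proof -
  let ?N = "sigma (space M) (\<Union>i. sets (F (real i)))"
  have sub: "(\<Union>i. sets (F (real i))) \<subseteq> Pow (space M)"
    using sets_F sets.sets_into_space by blast
  have N: "space ?N = space M" "sets ?N = sigma_sets (space M) (\<Union>i. sets (F (real i)))"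
    using sub by (auto simp: space_measure_of_conv)
  have [measurable]: "L (max 1 t) \<in> borel_measurable ?N" for t
  proof -
    obtain i where i: "max 1 t \<le> real i" using real_arch_simple by blast
    have "L (max 1 t) \<in> borel_measurable (F (real i))"
      by (rule measurable_F_mono[OF L_adapted i]) simp
    moreover have "sets (F (real i)) \<subseteq> sets ?N" unfolding N(2) by (auto intro: sigma_sets.Basic)
    ultimately show ?thesis
      using measurable_mono[of borel borel "F (real i)" ?N] by (auto simp: space_F N(1))
  qed
  have "confined n = {\<omega> \<in> space ?N.
    (\<forall>q::rat. real n \<le> of_rat q \<longrightarrow> \<bar>L (max 1 (of_rat q)) \<omega>\<bar> \<le> \<eta>) \<and>
    (\<forall>k. \<exists>i0. \<forall>i\<ge>i0. L (max 1 (real i)) \<omega> < 1 / real (Suc k))}"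
    by (simp only: confined_def N(1))
  also have "\<dots> \<in> sets ?N" by measurable
  finally show ?thesis by (simp only: N(2))
qed

lemma confined_measurable[measurable]: "confined n \<in> sets M"
proof -
  have "sigma_sets (space M) (\<Union>i. sets (F (real i))) \<subseteq> sets M"
    using sets_F by (intro sets.sigma_sets_subset) auto
  then show ?thesis using confined_in_sigma by blast
qed

lemma confined_approx:
  assumes e: "0 < e"
  obtains t E where "n \<le> t" "E \<in> sets (F (real t))"
    "prob ((confined n - E) \<union> (E - confined n)) < e"
proof -
  obtain i E where E: "E \<in> sets (F (real i))" "prob ((confined n - E) \<union> (E - confined n)) < e"
    using approx_by_algebra_union[of "\<lambda>i. F (real i)" "confined n" e] confined_in_sigma sets_F sets_F_mono space_F e
    by auto
  moreover have "sets (F (real i)) \<subseteq> sets (F (real (max n i)))" by (intro sets_F_mono) auto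
  ultimately show ?thesis using that[of "max n i" E] by auto
qed

text \<open>
  The event controls \<open>L\<close> at rational times, and the paths of \<open>X\<close> are continuous.
\<close>

lemma confined_bound:
  assumes n: "1 \<le> n"
  shows "AE \<omega> in M. \<omega> \<in> confined n \<longrightarrow> (\<forall>s\<ge>real n. \<bar>X s \<omega>\<bar> \<le> \<eta>)"
  using X_eq_L AE_space
proof eventually_elim
  case (elim \<omega>)
  show ?case
  proof (intro impI allI)
    fix s assume c: "\<omega> \<in> confined n" and s: "real n \<le> s"
    show "\<bar>X s \<omega>\<bar> \<le> \<eta>"
    proof (rule ccontr)
      assume "\<not> \<bar>X s \<omega>\<bar> \<le> \<eta>"
      then have "s \<in> {r. \<eta> < \<bar>X r \<omega>\<bar>}" by simp
      moreover have "open {r. \<eta> < \<bar>X r \<omega>\<bar>}"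
        using X_continuous[OF elim(2)] by (intro open_Collect_less continuous_intros)
      ultimately obtain d where d: "0 < d" "\<And>r. dist r s < d \<Longrightarrow> \<eta> < \<bar>X r \<omega>\<bar>"
        unfolding open_dist by blast
      obtain q :: rat where q: "s < of_rat q" "of_rat q < s + d" using of_rat_dense[of s "s + d"] d by auto
      have "\<bar>L (max 1 (of_rat q)) \<omega>\<bar> \<le> \<eta>" using c q s by (simp add: confined_def)
      moreover have "max 1 (of_rat q) = (of_rat q :: real)" using q s n by simp
      moreover have "1 \<le> (of_rat q :: real)" using q s n by linarith
      then have "X (of_rat q) \<omega> = L (of_rat q) \<omega>" using elim(1) by blast
      moreover have "\<eta> < \<bar>X (of_rat q) \<omega>\<bar>" using q by (intro d(2)) (simp add: dist_real_def)
      ultimately show False by simp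
    qed
  qed
qed

lemma L_measurable: "1 \<le> t \<Longrightarrow> L t \<in> borel_measurable M"
  using L_adapted measurable_F_M by blast

text \<open>
  A confined path far below the origin at time \<open>t\<close> needs a large fluctuation, which Markov's inequality makes unlikely
  uniformly in \<open>t\<close>.
\<close>

lemma confined_not_far_below:
  assumes n: "1 \<le> n" "n \<le> t" and r: "0 < r"
  shows "prob (confined n - {\<omega> \<in> space M. - (real n powr \<kappa> * \<eta> + r + \<kappa> / (\<kappa> - \<beta>)) * real t powr (- \<beta>) \<le> L t \<omega>})
    \<le> (real n powr \<kappa> + \<kappa> / (\<kappa> - \<beta>)) / sqrt \<beta> / r"
proof -
  have t: "1 \<le> real n" "real n \<le> real t" "1 \<le> real t" using n by auto
  have "prob (confined n - {\<omega> \<in> space M. - (real n powr \<kappa> * \<eta> + r + \<kappa> / (\<kappa> - \<beta>)) * real t powr (- \<beta>) \<le> L t \<omega>})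
     \<le> prob {\<omega> \<in> space M. ennreal (r * real t powr (\<kappa> - \<beta>)) < fluctuation n t \<omega>}"
  proof (rule finite_measure_mono_AE)
    show "AE \<omega> in M. \<omega> \<in> confined n - {\<omega> \<in> space M. - (real n powr \<kappa> * \<eta> + r + \<kappa> / (\<kappa> - \<beta>)) * real t powr (- \<beta>) \<le> L t \<omega>}
       \<longrightarrow> \<omega> \<in> {\<omega> \<in> space M. ennreal (r * real t powr (\<kappa> - \<beta>)) < fluctuation n t \<omega>}"
      using confined_bound[OF n(1)] X_eq_L AE_space
    proof eventually_elim
      case (elim \<omega>)
      show ?case
      proof (rule impI, rule ccontr)
        assume c: "\<omega> \<in> confined n - {\<omega> \<in> space M. - (real n powr \<kappa> * \<eta> + r + \<kappa> / (\<kappa> - \<beta>)) * real t powr (- \<beta>) \<le> L t \<omega>}"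
          and "\<omega> \<notin> {\<omega> \<in> space M. ennreal (r * real t powr (\<kappa> - \<beta>)) < fluctuation n t \<omega>}"
        then have "fluctuation n t \<omega> \<le> ennreal (r * real t powr (\<kappa> - \<beta>))" using elim by auto
        then have "- (real n powr \<kappa> * \<eta> + r + \<kappa> / (\<kappa> - \<beta>)) * real t powr (- \<beta>) \<le> X t \<omega>"
          using elim(1) c r by (intro lower_bound_of_fluctuation[OF elim(3) t(1,2)]) auto
        then show False using c elim t by auto
      qed
    qed
  qed measurable
  also have "\<dots> \<le> (real n powr \<kappa> + \<kappa> / (\<kappa> - \<beta>)) / sqrt \<beta> / r"
    by (rule fluctuation_tail[OF t(1,2) r])
  finally show ?thesis .
qed

lemma confined_eventually_small:
  assumes c: "0 < c"
  shows "(\<lambda>u. prob (confined n \<inter> {\<omega> \<in> space M. c < L (max 1 (real u)) \<omega>})) \<longlonglongrightarrow> 0"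
proof -
  have D: "confined n \<inter> {\<omega> \<in> space M. c < L (max 1 (real u)) \<omega>} \<in> sets M" for u
    using L_measurable[of "max 1 (real u)"] by measurable
  let ?D = "\<lambda>u. confined n \<inter> {\<omega> \<in> space M. c < L (max 1 (real u)) \<omega>}"
  let ?C = "\<lambda>k. \<Union>u\<in>{k..}. ?D u"
  have CM: "?C k \<in> sets M" for k
  proof (rule sets.countable_UN')
    show "?D ` {k..} \<subseteq> sets M" unfolding image_subset_iff using D by blast
  qed simp
  have "(\<lambda>k. prob (?C k)) \<longlonglongrightarrow> prob (\<Inter>k. ?C k)"
  proof (rule finite_Lim_measure_decseq)
    show "range ?C \<subseteq> sets M" using CM by blast
    show "decseq ?C" unfolding decseq_def by (intro allI impI UN_mono) auto
  qed
  moreover have "(\<Inter>k. ?C k) = {}"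
  proof (rule ccontr)
    assume "(\<Inter>k. ?C k) \<noteq> {}"
    then obtain \<omega> where w: "\<And>k. \<omega> \<in> ?C k" by blast
    obtain k where k: "1 / real (Suc k) < c" using c nat_approx_posE by blast
    have "\<omega> \<in> confined n" using w[of 0] by auto
    then obtain i0 where i0: "\<And>i. i0 \<le> i \<Longrightarrow> L (max 1 (real i)) \<omega> < 1 / real (Suc k)"
      unfolding confined_def by blast
    from w[of i0] obtain u where "i0 \<le> u" "c < L (max 1 (real u)) \<omega>" by auto
    with i0[of u] k show False by simp
  qed
  ultimately have "(\<lambda>k. prob (?C k)) \<longlonglongrightarrow> 0" by simp
  then show ?thesis
  proof (rule tendsto_sandwich[OF _ _ tendsto_const, rotated 2])
    show "eventually (\<lambda>u. prob (?D u) \<le> prob (?C u)) sequentially"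
      using CM by (intro always_eventually allI finite_measure_mono) auto
  qed simp
qed

text \<open>
  On the confined event \<open>L u - L t\<close> is at least the noise increment over \<open>[t, u]\<close>. For large \<open>u\<close> that increment carries
  half of the remaining variance or more, so it exceeds \<open>(K + 1) * t powr -\<beta>\<close> with probability at least the tail
  value below, independently of \<open>E \<inter> S\<close>; in that case \<open>L u > t powr -\<beta>\<close>, which confinement excludes in
  the limit.
\<close>

lemma confined_escape:
  assumes n: "1 \<le> n" "n \<le> t" and K: "0 \<le> K" and E: "E \<in> sets (F (real t))"
  defines "S \<equiv> {\<omega> \<in> space M. - K * real t powr (- \<beta>) \<le> L t \<omega>}"
  shows "prob (confined n \<inter> (E \<inter> S)) \<le> (1 - normal_tail (2 * sqrt \<beta> * (K + 2))) * prob (E \<inter> S)"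
proof -
  let ?\<delta> = "normal_tail (2 * sqrt \<beta> * (K + 2))"
  let ?G = "\<lambda>s. s powr (1 - 2 * \<gamma>) / (2 * \<gamma> - 1)"
  define c where "c = real t powr (- \<beta>)"
  have t: "1 \<le> real t" "real n \<le> real t" using n by auto
  have c: "0 < c" using t by (simp add: c_def)
  have [measurable]: "L (real t) \<in> borel_measurable (F (real t))" using L_adapted t by auto
  have "S = {\<omega> \<in> space (F (real t)). - K * real t powr (- \<beta>) \<le> L t \<omega>}"
    by (simp add: S_def space_F)
  also have "\<dots> \<in> sets (F (real t))" by measurable
  finally have ES: "E \<inter> S \<in> sets (F (real t))" using E by auto
  then have ESM[measurable]: "E \<inter> S \<in> sets M" using sets_F by blast
  have bound: "prob (confined n \<inter> (E \<inter> S)) \<le>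
      prob (confined n \<inter> {\<omega> \<in> space M. c < L (max 1 (real u)) \<omega>}) + (1 - ?\<delta>) * prob (E \<inter> S)"
    if u: "t < u" "real u powr (- \<beta>) < c / sqrt 2" for u
  proof -
    have u1: "1 \<le> real u" "real t < real u" "real t \<le> real u" "max 1 (real u) = real u" using u t by auto
    note [measurable] = I_measurable[OF t(1)] I_measurable[OF u1(1)] L_measurable[OF u1(1)]
    let ?J = "{\<omega> \<in> space M. (K + 1) * c < I u \<omega> - I t \<omega>}"
    have "prob (confined n \<inter> (E \<inter> S)) \<le> prob ((confined n \<inter> {\<omega> \<in> space M. c < L u \<omega>}) \<union> (E \<inter> S - ?J))"
    proof (rule finite_measure_mono_AE)
      show "AE \<omega> in M. \<omega> \<in> confined n \<inter> (E \<inter> S) \<longrightarrow> \<omega> \<in> (confined n \<inter> {\<omega> \<in> space M. c < L u \<omega>}) \<union> (E \<inter> S - ?J)"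
        using confined_bound[OF n(1)] X_eq_L AE_space noise_eq_I[OF t(1)] noise_eq_I[OF u1(1)]
      proof eventually_elim
        case (elim \<omega>)
        show ?case
        proof (rule impI, rule ccontr)
          assume in_c: "\<omega> \<in> confined n \<inter> (E \<inter> S)"
            and "\<omega> \<notin> (confined n \<inter> {\<omega> \<in> space M. c < L u \<omega>}) \<union> (E \<inter> S - ?J)"
          then have small: "L u \<omega> \<le> c" and big: "(K + 1) * c < I u \<omega> - I t \<omega>" using elim by auto
          let ?g = "\<lambda>s. f (X s \<omega>) / max 1 s powr \<gamma>"
          have gi: "?g integrable_on {a..b}" for a b
            by (intro integrable_continuous_interval continuous_on_subset[OF drift_continuous[OF elim(3)]]) auto
          have "0 \<le> integral {real t..real u} ?g"
          proof (rule Henstock_Kurzweil_Integration.integral_nonneg[OF gi])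
            fix s assume "s \<in> {real t..real u}"
            then have "\<bar>X s \<omega>\<bar> \<le> \<eta>" using elim(1) in_c t by auto
            then show "0 \<le> ?g s" using f_nonneg by simp
          qed
          moreover have "integral {1..real t} ?g + integral {real t..real u} ?g = integral {1..real u} ?g"
            by (rule Henstock_Kurzweil_Integration.integral_combine[OF t(1) u1(3) gi])
          ultimately have "X t \<omega> + (I u \<omega> - I t \<omega>) \<le> X u \<omega>"
            using noise_eq[OF elim(3), of u] noise_eq[OF elim(3), of t] elim(4,5) by linarith
          moreover have "X t \<omega> = L t \<omega>" "X u \<omega> = L u \<omega>" using elim(2) t u1 by auto
          moreover have "- K * c \<le> L t \<omega>" using in_c by (simp add: S_def c_def)
          ultimately have "- K * c + (K + 1) * c < c" using small big by linarith
          then show False by (simp add: algebra_simps)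
        qed
      qed
    qed measurable
    also have "\<dots> \<le> prob (confined n \<inter> {\<omega> \<in> space M. c < L u \<omega>}) + prob (E \<inter> S - ?J)"
      by (rule measure_Un_le) measurable
    also have "prob (E \<inter> S - ?J) = prob (E \<inter> S) - prob (E \<inter> S \<inter> ?J)"
      by (rule finite_measure_Diff') measurable
    finally have "prob (confined n \<inter> (E \<inter> S)) \<le>
        prob (confined n \<inter> {\<omega> \<in> space M. c < L u \<omega>}) + (prob (E \<inter> S) - prob (E \<inter> S \<inter> ?J))" .
    moreover have "prob (E \<inter> S) * ?\<delta> \<le> prob (E \<inter> S \<inter> ?J)"
    proof -
      \<comment> \<open>At most half of the variance \<open>c\<^sup>2 / (2 * \<beta>)\<close> that remains at time \<open>t\<close> is left at time \<open>u\<close>.\<close>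
      have Gu: "?G u \<le> c\<^sup>2 / (4 * \<beta>)"
      proof -
        have "(real u powr (- \<beta>))\<^sup>2 \<le> (c / sqrt 2)\<^sup>2" using u(2) by (intro power_mono) auto
        also have "\<dots> = c\<^sup>2 / 2" by (simp add: power_divide)
        finally have "(real u powr (- \<beta>))\<^sup>2 / (2 * \<beta>) \<le> c\<^sup>2 / 2 / (2 * \<beta>)"
          using \<beta>_pos by (intro divide_right_mono) auto
        then show ?thesis using tail_variance_eq[OF u1(1)] by simp
      qed
      moreover have "?G t = c\<^sup>2 / (2 * \<beta>)" using tail_variance_eq[OF t(1)] by (simp add: c_def)
      moreover have "c\<^sup>2 / (2 * \<beta>) = c\<^sup>2 / (4 * \<beta>) + c\<^sup>2 / (4 * \<beta>)" by simp
      ultimately have v: "c\<^sup>2 / (4 * \<beta>) \<le> ?G t - ?G u" by linarith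
      have "sqrt (c\<^sup>2 / (4 * \<beta>)) = c / (2 * sqrt \<beta>)" using c by (simp add: real_sqrt_divide real_sqrt_mult)
      with v have sv: "c / (2 * sqrt \<beta>) \<le> sqrt (?G t - ?G u)" using real_sqrt_le_mono by fastforce
      have pos: "0 < c / (2 * sqrt \<beta>)" using c \<beta>_pos by simp
      have "((K + 1) * c + c) / sqrt (?G t - ?G u) \<le> ((K + 1) * c + c) / (c / (2 * sqrt \<beta>))"
      proof (rule divide_left_mono[OF sv])
        show "0 < sqrt (?G t - ?G u) * (c / (2 * sqrt \<beta>))" using sv pos by (intro mult_pos_pos) linarith+
      qed (use c K in simp)
      also have "\<dots> = 2 * sqrt \<beta> * (K + 2)" using c by (simp add: field_simps)
      finally have "prob (E \<inter> S) * ?\<delta> \<le> prob (E \<inter> S) * normal_tail (((K + 1) * c + c) / sqrt (?G t - ?G u))"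
        by (intro mult_left_mono normal_tail_antimono) auto
      also have "\<dots> \<le> prob (E \<inter> S \<inter> ?J)"
        using c K by (intro ito_increment_tail[OF t(1) u1(2) ES]) auto
      finally show ?thesis .
    qed
    ultimately show ?thesis by (simp add: u1(4) algebra_simps)
  qed
  have "(\<lambda>u. real u powr (- \<beta>)) \<longlonglongrightarrow> 0"
    using \<beta>_pos by (intro tendsto_neg_powr filterlim_real_sequentially) auto
  then have "eventually (\<lambda>u. real u powr (- \<beta>) < c / sqrt 2) sequentially"
    using c by (intro order_tendstoD(2)) auto
  moreover have "eventually (\<lambda>u. t < u) sequentially" by (rule eventually_gt_at_top)
  ultimately have "eventually (\<lambda>u. prob (confined n \<inter> (E \<inter> S)) \<le>
      prob (confined n \<inter> {\<omega> \<in> space M. c < L (max 1 (real u)) \<omega>}) + (1 - ?\<delta>) * prob (E \<inter> S)) sequentially"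
    by eventually_elim (rule bound)
  moreover have "(\<lambda>u. prob (confined n \<inter> {\<omega> \<in> space M. c < L (max 1 (real u)) \<omega>}) + (1 - ?\<delta>) * prob (E \<inter> S))
      \<longlonglongrightarrow> 0 + (1 - ?\<delta>) * prob (E \<inter> S)"
    by (intro tendsto_add tendsto_const confined_eventually_small c)
  ultimately have "prob (confined n \<inter> (E \<inter> S)) \<le> 0 + (1 - ?\<delta>) * prob (E \<inter> S)"
    by (intro tendsto_lowerbound[where F=sequentially]) auto
  then show ?thesis by simp
qed

text \<open>
  The level \<open>K\<close> is chosen first, so that at most a quarter of the event lies below \<open>-K * t powr -\<beta>\<close> at any
  time \<open>t\<close>. It fixes the escape probability \<open>\<delta>\<close>, and the event is then approximated with precision
  \<open>\<delta> / 4\<close> relative to its probability. All three parts of the event have at most a quarter of its probability.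
\<close>

lemma confined_null:
  assumes n: "1 \<le> n"
  shows "prob (confined n) = 0"
proof (rule ccontr)
  let ?A = "confined n"
  assume "prob ?A \<noteq> 0"
  then have a: "0 < prob ?A" by (simp add: zero_less_measure_iff)
  define C where "C = (real n powr \<kappa> + \<kappa> / (\<kappa> - \<beta>)) / sqrt \<beta>"
  have C: "0 < C"
    unfolding C_def using \<kappa> \<kappa>_pos \<beta>_pos by (intro divide_pos_pos add_nonneg_pos) auto
  \<comment> \<open>The value for which the Markov bound \<open>C / r\<close> is a quarter of the probability of the event.\<close>
  define r where "r = 4 * C / prob ?A"
  have r: "0 < r" "C / r = prob ?A / 4" using C a by (auto simp: r_def)
  define K where "K = real n powr \<kappa> * \<eta> + r + \<kappa> / (\<kappa> - \<beta>)"
  have K: "0 \<le> K" unfolding K_def using r \<kappa> \<kappa>_pos \<eta> by (intro add_nonneg_nonneg) auto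
  define \<delta> where "\<delta> = normal_tail (2 * sqrt \<beta> * (K + 2))"
  have \<delta>: "0 < \<delta>" "\<delta> \<le> 1" by (auto simp: \<delta>_def normal_tail_pos normal_tail_le_1)
  have "0 < \<delta> * prob ?A / 4" using \<delta> a by simp
  from confined_approx[OF this, of n] obtain t E where E: "n \<le> t" "E \<in> sets (F (real t))"
    "prob ((?A - E) \<union> (E - ?A)) < \<delta> * prob ?A / 4" by blast
  define S where "S = {\<omega> \<in> space M. - K * real t powr (- \<beta>) \<le> L t \<omega>}"
  have EM[measurable]: "E \<in> sets M" using E(2) sets_F by blast
  have "1 \<le> real t" using n E by auto
  from L_measurable[OF this] have SM[measurable]: "S \<in> sets M" unfolding S_def by measurable
  let ?\<epsilon> = "\<delta> * prob ?A / 4"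
  have ae: "prob (?A - E) < ?\<epsilon>" "prob (E - ?A) < ?\<epsilon>"
    by (rule le_less_trans[OF finite_measure_mono E(3)]; auto)+
  have out: "prob (?A - S) \<le> prob ?A / 4"
    using confined_not_far_below[OF n E(1) r(1)] r(2) unfolding K_def[symmetric] C_def[symmetric] S_def by simp
  have "prob (E \<inter> S) \<le> prob ((?A \<inter> (E \<inter> S)) \<union> (E - ?A))"
    by (intro finite_measure_mono) auto
  also have "\<dots> \<le> prob (?A \<inter> (E \<inter> S)) + prob (E - ?A)"
    by (rule measure_Un_le) measurable
  finally have "prob (E \<inter> S) \<le> prob (?A \<inter> (E \<inter> S)) + ?\<epsilon>" using ae by linarith
  then have "(1 - \<delta>) * prob (E \<inter> S) \<le> (1 - \<delta>) * (prob (?A \<inter> (E \<inter> S)) + ?\<epsilon>)"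
    using \<delta> by (intro mult_left_mono) auto
  moreover have "prob (?A \<inter> (E \<inter> S)) \<le> (1 - \<delta>) * prob (E \<inter> S)"
    unfolding \<delta>_def S_def by (rule confined_escape[OF n E(1) K E(2)])
  ultimately have "prob (?A \<inter> (E \<inter> S)) \<le> (1 - \<delta>) * (prob (?A \<inter> (E \<inter> S)) + ?\<epsilon>)" by linarith
  then have "\<delta> * prob (?A \<inter> (E \<inter> S)) \<le> (1 - \<delta>) * ?\<epsilon>" by (simp add: algebra_simps)
  also have "\<dots> \<le> 1 * ?\<epsilon>" using \<delta> a by (intro mult_right_mono) auto
  also have "\<dots> = \<delta> * (prob ?A / 4)" by simp
  finally have core: "prob (?A \<inter> (E \<inter> S)) \<le> prob ?A / 4" using \<delta> by (simp only: mult_le_cancel_left_pos)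
  have "prob ?A \<le> prob ((?A \<inter> (E \<inter> S)) \<union> ((?A - E) \<union> (?A - S)))"
    by (intro finite_measure_mono) auto
  also have "\<dots> \<le> prob (?A \<inter> (E \<inter> S)) + prob ((?A - E) \<union> (?A - S))"
    by (rule measure_Un_le) measurable
  also have "prob ((?A - E) \<union> (?A - S)) \<le> prob (?A - E) + prob (?A - S)"
    by (rule measure_Un_le) measurable
  finally have "prob ?A \<le> prob ?A / 4 + ?\<epsilon> + prob ?A / 4" using core ae out by linarith
  moreover have "?\<epsilon> \<le> prob ?A / 4" using \<delta> a by (simp add: mult_left_le_one_le)
  ultimately show False using a by linarith
qed

theorem not_convergent_to_zero:
  assumes "0 < \<eta>"
  shows "AE \<omega> in M. \<not> ((\<lambda>t. L t \<omega>) \<longlongrightarrow> 0) at_top"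
proof -
  have "AE \<omega> in M. \<omega> \<notin> confined (Suc n)" for n
    using confined_null[of "Suc n"] by (intro AE_not_in) (auto simp: null_sets_def emeasure_eq_measure)
  then have "AE \<omega> in M. \<forall>n. \<omega> \<notin> confined (Suc n)" by (simp add: AE_all_countable)
  then show ?thesis
    using AE_space
  proof eventually_elim
    case (elim \<omega>)
    show ?case
    proof
      assume lim: "((\<lambda>t. L t \<omega>) \<longlongrightarrow> 0) at_top"
      have ev: "\<exists>T. \<forall>t\<ge>T. \<bar>L t \<omega>\<bar> < e" if "0 < e" for e
        using tendstoD[OF lim that] by (simp add: eventually_at_top_linorder)
      obtain T where T: "\<And>t. T \<le> t \<Longrightarrow> \<bar>L t \<omega>\<bar> < \<eta>" using ev[OF assms] by blast
      obtain n where nT: "T \<le> real n" using real_arch_simple by blast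
      have "\<omega> \<in> confined (Suc n)"
        unfolding confined_def
      proof (intro CollectI conjI allI impI elim(2))
        fix q :: rat assume "real (Suc n) \<le> of_rat q"
        then show "\<bar>L (max 1 (of_rat q)) \<omega>\<bar> \<le> \<eta>" using nT by (intro less_imp_le T) auto
      next
        fix k
        obtain T' where T': "\<And>t. T' \<le> t \<Longrightarrow> \<bar>L t \<omega>\<bar> < 1 / real (Suc k)" using ev[of "1 / real (Suc k)"] by auto
        obtain i0 where i0: "T' \<le> real i0" using real_arch_simple by blast
        show "\<exists>i0. \<forall>i\<ge>i0. L (max 1 (real i)) \<omega> < 1 / real (Suc k)"
        proof (intro exI allI impI)
          fix i assume "i0 \<le> i"
          then have "T' \<le> max 1 (real i)" using i0 by auto
          from T'[OF this] show "L (max 1 (real i)) \<omega> < 1 / real (Suc k)" by linarith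
        qed
      qed
      then show False using elim(1) by blast
    qed
  qed
qed

end

text \<open>
  The left-hand side is positive only if \<open>-x\<close> exceeds the scale \<open>s powr -(\<gamma> - 1/2)\<close>. Then \<open>\<bar>x\<bar> powr k\<close> is at least
  \<open>\<bar>x\<bar>\<close> times the power \<open>k - 1\<close> of this scale, and the upper bound on \<open>\<gamma>\<close> is equivalent to this power being at
  least \<open>s powr (\<gamma> - 1)\<close> for all \<open>s \<ge> 1\<close>.
\<close>

lemma superlinear_drift:
  fixes \<gamma> k x y s :: real
  assumes \<gamma>: "1/2 < \<gamma>" "\<gamma> \<le> 1/2 + 1/(2*k)" and k: "1 < k" and fx: "\<bar>x\<bar> powr k \<le> y" and s: "1 \<le> s"
  shows "(- x - s powr (- (\<gamma> - 1/2))) / s \<le> y / s powr \<gamma>"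
proof -
  define b where "b = \<gamma> - 1/2"
  let ?c = "s powr (- b)"
  have y0: "0 \<le> y" using fx powr_ge_zero[of "\<bar>x\<bar>" k] by linarith
  have c: "0 < ?c" using s by simp
  have "(- x - ?c) / s \<le> y / s powr \<gamma>"
  proof (cases "- x \<le> ?c")
    case True
    then have "(- x - ?c) / s \<le> 0" using s by (intro divide_nonpos_pos) linarith+
    also have "0 \<le> y / s powr \<gamma>" using y0 by (intro divide_nonneg_nonneg) auto
    finally show ?thesis .
  next
    case False
    have x: "?c \<le> \<bar>x\<bar>" "0 < \<bar>x\<bar>" "- x = \<bar>x\<bar>" using False c by linarith+
    have e: "\<gamma> - 1 \<le> - (b * (k - 1))"
    proof -
      have "\<gamma> * k \<le> (1/2 + 1/(2*k)) * k" using \<gamma> k by (intro mult_right_mono) auto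
      also have "\<dots> = k/2 + 1/2" using k by (simp add: field_simps)
      finally have "\<gamma> * k \<le> k/2 + 1/2" .
      moreover have "b * (k - 1) + \<gamma> = \<gamma> * k - k/2 + 1/2" by (simp add: b_def field_simps)
      ultimately show ?thesis by linarith
    qed
    have "s powr \<gamma> = s powr (\<gamma> - 1) * s"
    proof -
      have "s powr (\<gamma> - 1) * s powr 1 = s powr (\<gamma> - 1 + 1)" by (rule powr_add[symmetric])
      then show ?thesis using s by simp
    qed
    also have "\<dots> \<le> ?c powr (k - 1) * s"
    proof (intro mult_right_mono)
      have "?c powr (k - 1) = s powr (- (b * (k - 1)))" by (simp only: powr_powr mult_minus_left)
      then show "s powr (\<gamma> - 1) \<le> ?c powr (k - 1)" using powr_mono[OF e s] by simp
    qed (use s in simp)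
    also have "\<dots> \<le> \<bar>x\<bar> powr (k - 1) * s"
      using x(1) c k s by (intro mult_right_mono powr_mono2) auto
    finally have "\<bar>x\<bar> * s powr \<gamma> \<le> \<bar>x\<bar> * (\<bar>x\<bar> powr (k - 1) * s)"
      by (intro mult_left_mono) auto
    also have "\<dots> = \<bar>x\<bar> powr k * s"
    proof -
      have "\<bar>x\<bar> powr 1 * \<bar>x\<bar> powr (k - 1) = \<bar>x\<bar> powr (1 + (k - 1))" by (rule powr_add[symmetric])
      then show ?thesis by simp
    qed
    also have "\<dots> \<le> y * s" using fx s by (intro mult_right_mono) auto
    finally have "\<bar>x\<bar> * s powr \<gamma> \<le> y * s" .
    then have "\<bar>x\<bar> / s \<le> y / s powr \<gamma>"
    proof -
      have "0 < s" "0 < s powr \<gamma>" using s by auto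
      with \<open>\<bar>x\<bar> * s powr \<gamma> \<le> y * s\<close> show ?thesis by (simp only: pos_divide_le_eq times_divide_eq_left pos_le_divide_eq)
    qed
    moreover have "(- x - ?c) / s \<le> \<bar>x\<bar> / s" using x c s by (intro divide_right_mono) linarith+
    ultimately show ?thesis by linarith
  qed
  then show ?thesis by (simp only: b_def)
qed

theorem theorem1p1:
  fixes N :: "real set" and \<gamma> :: real and f :: "real \<Rightarrow> real"
    and M :: "'a measure" and F :: "real \<Rightarrow> 'a measure"
    and B L :: "real \<Rightarrow> 'a \<Rightarrow> real"
  assumes "0 \<in> interior N"
    and "1/2 < \<gamma>" and "\<gamma> \<le> 1"
    and "\<exists>C. C-lipschitz_on UNIV f"
    and "f 0 = 0"
    and "\<forall>x\<in>N - {0}. f x > 0"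
    and "brownian_motion M F B"
    and "additive_sde_solution M F B (\<lambda>t x. f x / t powr \<gamma>) (\<lambda>t. 1 / t powr \<gamma>) 1 L"
    and "(\<gamma> = 1 \<and> (\<exists>k>1/2. \<forall>x\<in>N. k * \<bar>x\<bar> \<le> f x)) \<or>
         (\<exists>k>1. 1/2 + 1/(2*k) \<ge> \<gamma> \<and> (\<forall>x\<in>N. \<bar>x\<bar> powr k \<le> f x))"
  shows "AE \<omega> in M. \<not> ((\<lambda>t. L t \<omega>) \<longlongrightarrow> 0) at_top"
proof -
  define \<beta> where "\<beta> = \<gamma> - 1/2"
  obtain \<eta> where nbhd: "0 < \<eta>" "\<And>x. \<bar>x\<bar> \<le> \<eta> \<Longrightarrow> x \<in> N"
  proof -
    obtain e where "0 < e" "cball 0 e \<subseteq> N" using assms(1) by (meson mem_interior_cball)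
    then show ?thesis by (intro that[of e]) (auto simp: subset_iff dist_real_def)
  qed
  have f_nonneg: "0 \<le> f x" if "\<bar>x\<bar> \<le> \<eta>" for x
    using assms(5,6) nbhd(2)[OF that] by (cases "x = 0") (auto intro: less_imp_le)
  obtain \<kappa> where \<kappa>: "\<beta> < \<kappa>"
    and drift: "\<And>x s. \<bar>x\<bar> \<le> \<eta> \<Longrightarrow> 1 \<le> s \<Longrightarrow> \<kappa> * (- x - s powr (- \<beta>)) / s \<le> f x / s powr \<gamma>"
    using assms(9)
  proof
    assume "\<gamma> = 1 \<and> (\<exists>k>1/2. \<forall>x\<in>N. k * \<bar>x\<bar> \<le> f x)"
    then obtain k where k: "\<gamma> = 1" "1/2 < k" "\<And>x. x \<in> N \<Longrightarrow> k * \<bar>x\<bar> \<le> f x" by blast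
    show ?thesis
    proof (rule that[of k])
      show "\<beta> < k" using k by (simp add: \<beta>_def)
      fix x s :: real assume x: "\<bar>x\<bar> \<le> \<eta>" and s: "1 \<le> s"
      have "- x - s powr (- \<beta>) \<le> \<bar>x\<bar>" using powr_ge_zero[of s "- \<beta>"] by linarith
      then have "k * (- x - s powr (- \<beta>)) \<le> k * \<bar>x\<bar>" using k by (intro mult_left_mono) auto
      also have "\<dots> \<le> f x" using k(3) nbhd(2) x by blast
      finally show "k * (- x - s powr (- \<beta>)) / s \<le> f x / s powr \<gamma>"
        using k(1) s by (simp add: divide_right_mono)
    qed
  next
    assume "\<exists>k>1. 1/2 + 1/(2*k) \<ge> \<gamma> \<and> (\<forall>x\<in>N. \<bar>x\<bar> powr k \<le> f x)"
    then obtain k where k: "1 < k" "\<gamma> \<le> 1/2 + 1/(2*k)" "\<And>x. x \<in> N \<Longrightarrow> \<bar>x\<bar> powr k \<le> f x" by blast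
    show ?thesis
    proof (rule that[of 1])
      show "\<beta> < 1" using assms(3) by (simp add: \<beta>_def)
      fix x s :: real assume x: "\<bar>x\<bar> \<le> \<eta>" and s: "1 \<le> s"
      show "1 * (- x - s powr (- \<beta>)) / s \<le> f x / s powr \<gamma>"
        using superlinear_drift[OF assms(2) k(2,1) k(3)[OF nbhd(2)[OF x]] s] by (simp add: \<beta>_def)
    qed
  qed
  have f_cont: "continuous_on UNIV f" using assms(4) lipschitz_on_continuous_on by blast
  interpret bm: brownian_filtration M F B by standard (rule assms(7))
  have L_adapted: "L t \<in> borel_measurable (F t)" if "1 \<le> t" for t
    using assms(8) that by (simp add: additive_sde_solution_def)
  have "AE \<omega> in M. continuous_on {1..} (\<lambda>t. L t \<omega>)"
    using assms(8) by (simp add: additive_sde_solution_def)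
  then obtain Z where Z: "{\<omega> \<in> space M. \<not> continuous_on {1..} (\<lambda>t. L t \<omega>)} \<subseteq> Z" "Z \<in> null_sets M"
    by (elim AE_E) (auto simp: null_sets_def)
  define X where "X t \<omega> = (if \<omega> \<in> Z then 0 else L (max 1 t) \<omega>)" for t \<omega>
  obtain I where I: "\<And>t. 1 \<le> t \<Longrightarrow> is_ito_integral M F B (\<lambda>s _. 1 / s powr \<gamma>) 1 t (I t)"
    "\<And>t. 1 \<le> t \<Longrightarrow> AE \<omega> in M. L t \<omega> = L 1 \<omega> + (LINT s:{1..t}|lborel. f (L s \<omega>) / s powr \<gamma>) + I t \<omega>"
  proof -
    have "\<forall>t\<in>{1..}. \<exists>I. is_ito_integral M F B (\<lambda>s _. 1 / s powr \<gamma>) 1 t I \<and>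
        (AE \<omega> in M. L t \<omega> = L 1 \<omega> + (LINT s:{1..t}|lborel. f (L s \<omega>) / s powr \<gamma>) + I \<omega>)"
      using assms(8) by (simp add: additive_sde_solution_def)
    from bchoice[OF this] show ?thesis using that by auto
  qed
  have notZ: "AE \<omega> in M. \<omega> \<notin> Z" using Z(2) by (rule AE_not_in)
  interpret unstable_solution M F B \<gamma> I \<beta> \<kappa> \<eta> f L X
  proof (unfold_locales)
    show "(\<lambda>s. 1 / s powr \<gamma>) \<in> borel_measurable borel" by measurable
    show "0 < 1 / s powr \<gamma>" if "1 \<le> s" for s using that by simp
    show "1 / s powr \<gamma> \<le> 1" if "1 \<le> s" for s
      using ge_one_powr_ge_zero[OF that, of \<gamma>] assms(2) by (simp add: divide_le_eq_1)
    show "\<bar>1 / x powr \<gamma> - 1 / y powr \<gamma>\<bar> \<le> \<bar>x - y\<bar>" if "1 \<le> x" "1 \<le> y" for x y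
      using power_law_lipschitz[OF _ assms(3) that] assms(2) by simp
    show "0 \<le> s powr (1 - 2 * \<gamma>) / (2 * \<gamma> - 1)" if "1 \<le> s" for s :: real using assms(2) by simp
    show "(1 / y powr \<gamma>)\<^sup>2 * (y - x) \<le> x powr (1 - 2 * \<gamma>) / (2 * \<gamma> - 1) - y powr (1 - 2 * \<gamma>) / (2 * \<gamma> - 1)"
      "x powr (1 - 2 * \<gamma>) / (2 * \<gamma> - 1) - y powr (1 - 2 * \<gamma>) / (2 * \<gamma> - 1) \<le> (1 / x powr \<gamma>)\<^sup>2 * (y - x)"
      if "1 \<le> x" "x \<le> y" for x y
      using power_law_tail_variance[OF assms(2) that] by simp_all
    show "is_ito_integral M F B (\<lambda>s _. 1 / s powr \<gamma>) 1 t (I t)" if "1 \<le> t" for t by (rule I(1)[OF that])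
    show "\<beta> = \<gamma> - 1/2" "0 < \<beta>" using assms(2) by (auto simp: \<beta>_def)
    show "\<beta> < \<kappa>" by (rule \<kappa>)
    show "0 \<le> \<eta>" using nbhd(1) by simp
    show "continuous_on UNIV f" by (rule f_cont)
    show "0 \<le> f x" if "\<bar>x\<bar> \<le> \<eta>" for x by (rule f_nonneg[OF that])
    show "\<kappa> * (- x - s powr (- \<beta>)) / s \<le> f x / s powr \<gamma>" if "\<bar>x\<bar> \<le> \<eta>" "1 \<le> s" for x s
      by (rule drift[OF that])
    show "L t \<in> borel_measurable (F t)" if "1 \<le> t" for t by (rule L_adapted[OF that])
    show "X t \<in> borel_measurable M" for t
    proof -
      have [measurable]: "L (max 1 t) \<in> borel_measurable M"
        using L_adapted[of "max 1 t"] bm.measurable_F_M by auto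
      have [measurable]: "Z \<in> sets M" using Z(2) by auto
      show ?thesis unfolding X_def[abs_def] by measurable
    qed
    show "continuous_on UNIV (\<lambda>t. X t \<omega>)" if "\<omega> \<in> space M" for \<omega>
    proof (cases "\<omega> \<in> Z")
      case True then show ?thesis by (simp add: X_def)
    next
      case False
      then have "continuous_on {1..} (\<lambda>t. L t \<omega>)" using Z(1) that by blast
      then have "continuous_on UNIV (\<lambda>t. L (max 1 t) \<omega>)"
        by (rule continuous_on_compose2) (auto intro!: continuous_intros)
      then show ?thesis using False by (simp add: X_def)
    qed
    show "AE \<omega> in M. \<forall>t\<ge>1. X t \<omega> = L t \<omega>"
      using notZ by eventually_elim (simp add: X_def)
    show "AE \<omega> in M. X t \<omega> - X 1 \<omega> - (LINT s:{1..t}|lborel. f (X s \<omega>) / max 1 s powr \<gamma>) = I t \<omega>"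
      if "1 \<le> t" for t
      using notZ I(2)[OF that]
    proof eventually_elim
      case (elim \<omega>)
      have "(LINT s:{1..t}|lborel. f (X s \<omega>) / max 1 s powr \<gamma>) = (LINT s:{1..t}|lborel. f (L s \<omega>) / s powr \<gamma>)"
        using elim(1) by (intro set_lebesgue_integral_cong) (auto simp: X_def)
      then show ?case using elim that by (simp add: X_def)
    qed
  qed
  show ?thesis by (rule not_convergent_to_zero[OF nbhd(1)])
qed

end
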